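(* Let $d\geq2$ be an integer and $m$ a real number with $\frac{N(m-1)}{2d}\geq2$ and $m\geq2$. Let $f:\mathbb{R}\to\mathbb{R}$ satisfy $f(0)=0$ and $$|f(u)-f(v)|\leq C|u-v|\big(|u|^{m-1}e^{\lambda u^2}+|v|^{m-1}e^{\lambda v^2}\big)\quad\text{for all }u,v\in\mathbb{R},$$ for some constants $C>0$, $\lambda>0$. Then there exists $\varepsilon>0$ such that for every $u_0\in\exp L^2(\mathbb{R}^N)$ with $\|u_0\|_{\exp L^2}\leq\varepsilon$ there exists a weak-mild solution $u\in L^\infty(0,\infty;\exp L^2(\mathbb{R}^N))$ of the Cauchy problem $\partial_tu+(-\Delta)^du=f(u)$, $u(0)=u_0$, satisfying $$\lim_{t\to0}\|u(t)-e^{-t(-\Delta)^d}u_0\|_{\exp L^2}=0.$$ Moreover there exists $C>0$ such that $\|u(t)\|_{L^p}\leq C\,t^{-\sigma}$ for all $t>0$, where $\sigma=\frac{1}{m-1}-\frac{N}{2dp}>0$, with $\frac{N(m-1)}{2d}<p<\infty$ if $N\geq4d$, and $\max\{m,\frac{2N(m-1)}{4d-N}\}\leq p\leq\infty$ if $N<4d$.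
   Context: $e^{-t(-\Delta)^d}$ denotes the polyharmonic heat semigroup on $\mathbb{R}^N$, $e^{-t(-\Delta)^d}\varphi=E_{d,t}\star\varphi$ with $E_{d,t}(x)=(2\pi)^{-N}\int_{\mathbb{R}^N}e^{-t|\xi|^{2d}}e^{ix\cdot\xi}\,d\xi$. The Orlicz space $\exp L^2(\mathbb{R}^N)$ is the set of $u\in L^1_{loc}(\mathbb{R}^N)$ such that $\int_{\mathbb{R}^N}(e^{|u(x)|^2/\alpha^2}-1)\,dx<\infty$ for some $\alpha>0$, with the Luxemburg norm $\|u\|_{\exp L^2}=\inf\{\alpha>0:\int_{\mathbb{R}^N}(e^{|u(x)|^2/\alpha^2}-1)\,dx\leq 1\}$. A weak-mild solution on $(0,\infty)$ is a function $u\in L^\infty(0,\infty;\exp L^2)$ satisfying $u(t)=e^{-t(-\Delta)^d}u_0+\int_0^te^{-(t-s)(-\Delta)^d}f(u(s))\,ds$ in $\exp L^2$ for almost every $t>0$, and such that $u(t)\to u_0$ in the weak-$*$ topology as $t\searrow0$. *)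

theory Defs
  imports "HOL-Analysis.Analysis"
begin

text \<open>Polyharmonic heat kernel
  E_{d,t}(x) = (2 pi)^{-N} int exp(-t |xi|^{2d}) e^{i x . xi} dxi  on R^N, N = DIM('a).
  The integral is complex; its value is real, and we take the real part.\<close>
definition polyharm_kernel :: "nat \<Rightarrow> real \<Rightarrow> 'a::euclidean_space \<Rightarrow> real" where
  "polyharm_kernel d t x =
     Re (complex_of_real ((2 * pi) powr (- real DIM('a))) *
         integral\<^sup>L lborel (\<lambda>\<xi>::'a. complex_of_real (exp (- t * norm \<xi> ^ (2 * d))) * cis (x \<bullet> \<xi>)))"

definition polyharm_heat :: "nat \<Rightarrow> real \<Rightarrow> ('a::euclidean_space \<Rightarrow> real) \<Rightarrow> 'a \<Rightarrow> real" where
  "polyharm_heat d t \<phi> x = (\<integral>y. polyharm_kernel d t (x - y) * \<phi> y \<partial>lebesgue)"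

definition loc_integrable :: "('a::euclidean_space \<Rightarrow> real) \<Rightarrow> bool" where
  "loc_integrable u \<longleftrightarrow> u \<in> borel_measurable lebesgue \<and>
     (\<forall>K. compact K \<longrightarrow> set_integrable lebesgue K u)"

definition expL2 :: "('a::euclidean_space \<Rightarrow> real) set" where
  "expL2 = {u. loc_integrable u \<and>
     (\<exists>\<alpha>>0. (\<integral>\<^sup>+x. ennreal (exp ((u x)\<^sup>2 / \<alpha>\<^sup>2) - 1) \<partial>lebesgue) < \<infinity>)}"

definition expL2_norm :: "('a::euclidean_space \<Rightarrow> real) \<Rightarrow> real" where
  "expL2_norm u = Inf {\<alpha>. \<alpha> > 0 \<and>
     (\<integral>\<^sup>+x. ennreal (exp ((u x)\<^sup>2 / \<alpha>\<^sup>2) - 1) \<partial>lebesgue) \<le> 1}"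

text \<open>Complementary Young function of Phi(s) = exp(s^2) - 1, and the corresponding
  Orlicz space L^{Phi*}, whose dual is exp L^2 (predual for the weak-* topology).\<close>
definition young_conj_expsq :: "real \<Rightarrow> real" where
  "young_conj_expsq s = Sup {r * s - (exp (r\<^sup>2) - 1) | r. r \<ge> 0}"

definition expL2_predual :: "('a::euclidean_space \<Rightarrow> real) set" where
  "expL2_predual = {\<phi>. \<phi> \<in> borel_measurable lebesgue \<and>
     (\<exists>\<alpha>>0. (\<integral>\<^sup>+x. ennreal (young_conj_expsq (\<bar>\<phi> x\<bar> / \<alpha>)) \<partial>lebesgue) < \<infinity>)}"

definition Linf_expL2 :: "(real \<Rightarrow> 'a::euclidean_space \<Rightarrow> real) \<Rightarrow> bool" where
  "Linf_expL2 u \<longleftrightarrow>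
     (\<lambda>(t, x). u t x) \<in> borel_measurable (lborel \<Otimes>\<^sub>M lebesgue) \<and>
     (AE t in lborel. t > 0 \<longrightarrow> u t \<in> expL2) \<and>
     (\<exists>M. AE t in lborel. t > 0 \<longrightarrow> expL2_norm (u t) \<le> M)"

definition weak_mild_solution ::
  "nat \<Rightarrow> (real \<Rightarrow> real) \<Rightarrow> ('a::euclidean_space \<Rightarrow> real) \<Rightarrow> (real \<Rightarrow> 'a \<Rightarrow> real) \<Rightarrow> bool" where
  "weak_mild_solution d f u0 u \<longleftrightarrow>
     Linf_expL2 u \<and>
     (AE t in lborel. t > 0 \<longrightarrow>
        (AE x in lebesgue.
           set_integrable lborel {0..t} (\<lambda>s. polyharm_heat d (t - s) (\<lambda>y. f (u s y)) x) \<and>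
           u t x = polyharm_heat d t u0 x +
                   (\<integral>s\<in>{0..t}. polyharm_heat d (t - s) (\<lambda>y. f (u s y)) x \<partial>lborel))) \<and>
     (\<forall>\<phi>\<in>expL2_predual.
        ((\<lambda>t. \<integral>x. u t x * \<phi> x \<partial>lebesgue) \<longlongrightarrow> (\<integral>x. u0 x * \<phi> x \<partial>lebesgue)) (at_right 0))"

definition Lp_decay :: "(real \<Rightarrow> 'a::euclidean_space \<Rightarrow> real) \<Rightarrow> ereal \<Rightarrow> real \<Rightarrow> real \<Rightarrow> bool" where
  "Lp_decay u p C \<sigma> \<longleftrightarrow>
     (\<forall>t>0. (case p of
        ereal q \<Rightarrow> (\<integral>\<^sup>+x. ennreal (\<bar>u t x\<bar> powr q) \<partial>lebesgue) \<le> ennreal ((C * t powr (- \<sigma>)) powr q)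
      | PInfty \<Rightarrow> (AE x in lebesgue. \<bar>u t x\<bar> \<le> C * t powr (- \<sigma>))
      | MInfty \<Rightarrow> False))"

end

theory Submission
  imports Defs "HOL-Probability.Probability" "HOL-Complex_Analysis.Complex_Analysis"
begin

text \<open>
  The heat kernel \<open>E\<close> is not positive, but \<open>\<bar>E\<bar> \<le> K\<close> for a positive kernel \<open>K\<close> with the same scaling, constant mass and
  \<open>K \<le> A t\<^sup>-\<^sup>g\<close>, where \<open>g = N / (2d)\<close>: the decay of \<open>E\<close> in \<open>x\<close> comes from finite differences of its entire
  Fourier symbol. The growth condition gives \<open>\<bar>f u - f v\<bar> \<le> F b - F a\<close> whenever \<open>\<bar>u\<bar> \<le> b\<close>, \<open>\<bar>v\<bar> \<le> a\<close> and \<open>\<bar>u - v\<bar> \<le> b - a\<close>,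
  with \<open>F r = 2 C0 r\<^sup>m exp (lam r\<^sup>2)\<close>. Put \<open>V = K * \<bar>u0\<bar>\<close> and iterate \<open>W \<mapsto> K * F (V + W)\<close> (convolution in space-time) from
  \<open>W = 0\<close>. The increasing iterates \<open>W n\<close> dominate the Picard iterates of the equation, so that
  \<open>\<bar>u (n + 1) - u n\<bar> \<le> W (n + 1) - W n\<close>, and everything reduces to a bound for \<open>W n\<close>.
  Jensen's inequality transfers the smallness of \<open>u0\<close> in \<open>exp L\<^sup>2\<close> to \<open>V\<close>; hence, for small \<open>\<rho>\<close>, the bounds
  \<open>W \<le> \<rho> (1 + t)\<close> to the power \<open>- g / 2\<close> and \<open>\<parallel>W\<parallel> \<le> \<rho>\<close> in \<open>L\<^sup>2\<close> are preserved by the iteration, since \<open>g (m - 1) \<ge> 2\<close>.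
\<close>

section \<open>Changes of variables and products over the standard basis\<close>

text \<open>Two features fix the form of the estimates. A datum in exp L^2 is unbounded, so near
  time 0 the nonlinearity is controlled only by an exponential moment, and the factor exp (lam r^2)
  stays integrable only while lam \<rho>^2 is small. For large times the moment alone gives no
  decay; there the smoothing of the kernel from L^2 to the supremum supplies it. A sup bound
  together with an L^2 bound is the natural class for W: between them they control every L^q with q
  \<ge> 2 and the exp L^2 norm.

  The iteration closes because m \<ge> 2: data and W of size \<rho> give a source of size \<rho>^m
  \<le> \<rho>^2, and the Duhamel term is linear in its source, so for small \<rho> the bound \<rho>
  reproduces itself. The comparison of increments replaces a contraction estimate in exp L^2: the
  limit is taken pointwise, by dominated convergence.

  In general the linear flow of u0 returns to u0 only in the weak-* sense. Norm convergence is
  therefore proved for the difference of u and the linear flow, which W dominates.\<close>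

lemma nn_integral_lborel_affine:
  fixes f :: "'a::euclidean_space \<Rightarrow> ennreal"
  assumes [measurable]: "f \<in> borel_measurable borel" and "c \<noteq> 0"
  shows "(\<integral>\<^sup>+x. f x \<partial>lborel) = ennreal (\<bar>c\<bar> ^ DIM('a)) * (\<integral>\<^sup>+x. f (t + c *\<^sub>R x) \<partial>lborel)"
  by (subst lborel_affine[OF \<open>c \<noteq> 0\<close>, of t])
     (simp add: nn_integral_density nn_integral_distr nn_integral_cmult)

lemma nn_integral_lborel_reflect:
  fixes f :: "'a::euclidean_space \<Rightarrow> ennreal"
  assumes "f \<in> borel_measurable borel"
  shows "(\<integral>\<^sup>+y. f (x - y) \<partial>lborel) = (\<integral>\<^sup>+y. f y \<partial>lborel)"
  using nn_integral_lborel_affine[OF assms, of "-1" x] by simp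

lemma nn_integral_lborel_shift:
  fixes f :: "'a::euclidean_space \<Rightarrow> ennreal"
  assumes "f \<in> borel_measurable borel"
  shows "(\<integral>\<^sup>+x. f (x - y) \<partial>lborel) = (\<integral>\<^sup>+x. f x \<partial>lborel)"
  using nn_integral_lborel_affine[OF assms, of 1 "-y"] by simp

lemma lborel_integral_affine:
  fixes f :: "'a::euclidean_space \<Rightarrow> real"
  assumes [measurable]: "f \<in> borel_measurable borel" and c: "c \<noteq> 0"
  shows "(\<integral>x. f x \<partial>lborel) = \<bar>c\<bar> ^ DIM('a) * (\<integral>x. f (t + c *\<^sub>R x) \<partial>lborel)"
  by (subst lborel_affine[OF \<open>c \<noteq> 0\<close>, of t])
     (simp add: integral_density integral_distr)

lemma lborel_integrable_affine:
  fixes f :: "'a::euclidean_space \<Rightarrow> real"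
  assumes f: "integrable lborel f" and c: "c \<noteq> 0"
  shows "integrable lborel (\<lambda>x. f (t + c *\<^sub>R x))"
proof -
  have m[measurable]: "f \<in> borel_measurable borel"
    using borel_measurable_integrable[OF f] by simp
  have "(\<integral>\<^sup>+x. ennreal (norm (f x)) \<partial>lborel) < \<infinity>"
    using f by (simp add: integrable_iff_bounded)
  moreover have "0 < \<bar>c\<bar> ^ DIM('a)"
    using c by simp
  ultimately have "(\<integral>\<^sup>+x. ennreal (norm (f (t + c *\<^sub>R x))) \<partial>lborel) < \<infinity>"
    using c by (subst (asm) nn_integral_lborel_affine[of _ c t])
      (auto simp: ennreal_mult_less_top ennreal_eq_0_iff)
  then show ?thesis
    by (simp add: integrable_iff_bounded)
qed

lemma inner_sum_Basis:
  fixes f :: "'a::euclidean_space \<Rightarrow> real"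
  assumes "b \<in> Basis"
  shows "(\<Sum>c\<in>Basis. f c *\<^sub>R c) \<bullet> b = f b"
  using assms by simp

interpretation basis_lborel: product_sigma_finite "\<lambda>_. lborel :: real measure" ..

lemma nn_integral_prod_Basis:
  fixes f :: "'a::euclidean_space \<Rightarrow> real \<Rightarrow> ennreal"
  assumes [measurable]: "\<And>b. b \<in> Basis \<Longrightarrow> f b \<in> borel_measurable borel"
  shows "(\<integral>\<^sup>+x. (\<Prod>b\<in>Basis. f b (x \<bullet> b)) \<partial>lborel) = (\<Prod>b\<in>Basis. \<integral>\<^sup>+s. f b s \<partial>lborel)"
proof -
  have "(\<integral>\<^sup>+x. (\<Prod>b\<in>Basis. f b (x \<bullet> b)) \<partial>lborel)
      = (\<integral>\<^sup>+y. (\<Prod>b\<in>Basis. f b (y b)) \<partial>(\<Pi>\<^sub>M b\<in>Basis. lborel))"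
    by (subst lborel_eq, subst nn_integral_distr) (auto simp: inner_sum_Basis intro!: borel_measurable_prod)
  also have "\<dots> = (\<Prod>b\<in>Basis. \<integral>\<^sup>+s. f b s \<partial>lborel)"
    by (rule basis_lborel.product_nn_integral_prod) auto
  finally show ?thesis .
qed

lemma integral_prod_Basis:
  fixes f :: "'a::euclidean_space \<Rightarrow> real \<Rightarrow> complex"
  assumes f: "\<And>b. b \<in> Basis \<Longrightarrow> integrable lborel (f b)"
  shows "(\<integral>x. (\<Prod>b\<in>Basis. f b (x \<bullet> b)) \<partial>lborel) = (\<Prod>b\<in>Basis. \<integral>s. f b s \<partial>lborel)"
proof -
  have [measurable]: "f b \<in> borel_measurable borel" if "b \<in> Basis" for b
    using borel_measurable_integrable[OF f[OF that]] by simp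
  have "(\<integral>x. (\<Prod>b\<in>Basis. f b (x \<bullet> b)) \<partial>lborel)
      = (\<integral>y. (\<Prod>b\<in>Basis. f b (y b)) \<partial>(\<Pi>\<^sub>M b\<in>Basis. lborel))"
    by (subst lborel_eq, subst integral_distr) (auto simp: inner_sum_Basis intro!: borel_measurable_prod)
  also have "\<dots> = (\<Prod>b\<in>Basis. \<integral>s. f b s \<partial>lborel)"
    by (rule basis_lborel.product_integral_prod) (auto intro: f)
  finally show ?thesis .
qed

lemma norm_square_Basis: "(norm (x::'a::euclidean_space))\<^sup>2 = (\<Sum>b\<in>Basis. (x \<bullet> b)\<^sup>2)"
  by (simp add: norm_eq_sqrt_inner euclidean_inner[of x x] power2_eq_square[symmetric] sum_nonneg)

section \<open>Gaussian integrals\<close>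

lemma integrable_gaussian_real: "integrable lborel (\<lambda>s::real. exp (- s\<^sup>2 / 2))"
proof -
  have "integrable lborel (\<lambda>s::real. sqrt (2 * pi) * std_normal_density s)"
    using integrable_std_normal_moment[of 0] by (intro integrable_mult_right) simp
  then show ?thesis by (simp add: std_normal_density_def)
qed

text \<open>The characteristic function of the standard normal law, with the normalizing constant of
  its density moved to the right.\<close>

lemma gaussian_fourier_real:
  "(\<integral>s. complex_of_real (exp (- s\<^sup>2 / 2)) * cis (s * a) \<partial>lborel)
     = complex_of_real (sqrt (2 * pi) * exp (- a\<^sup>2 / 2))"
proof -
  have "char std_normal_distribution a = (\<integral>s. std_normal_density s *\<^sub>R iexp (a * s) \<partial>lborel)"
    unfolding char_def by (subst integral_density) (auto simp: normal_density_nonneg)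
  also have "\<dots> = complex_of_real (1 / sqrt (2*pi)) * (\<integral>s. complex_of_real (exp (- s\<^sup>2 / 2)) * cis (s * a) \<partial>lborel)"
    unfolding std_normal_density_def
    by (subst integral_mult_right_zero[symmetric])
      (auto intro!: Bochner_Integration.integral_cong simp: cis_conv_exp scaleR_conv_of_real mult.commute mult.left_commute)
  finally have "complex_of_real (1 / sqrt (2*pi)) * (\<integral>s. complex_of_real (exp (- s\<^sup>2 / 2)) * cis (s * a) \<partial>lborel)
      = complex_of_real (exp (- a\<^sup>2 / 2))"
    by (simp add: char_std_normal_distribution)
  then have "complex_of_real (sqrt (2*pi)) * (complex_of_real (1 / sqrt (2*pi)) * (\<integral>s. complex_of_real (exp (- s\<^sup>2 / 2)) * cis (s * a) \<partial>lborel))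
      = complex_of_real (sqrt (2*pi)) * complex_of_real (exp (- a\<^sup>2 / 2))"
    by simp
  then show ?thesis
    by (simp flip: mult.assoc of_real_mult)
qed

lemma exp_norm_square_prod: "exp (- (norm (x::'a::euclidean_space))\<^sup>2 / 2) = (\<Prod>b\<in>Basis. exp (- (x \<bullet> b)\<^sup>2 / 2))"
  by (simp add: norm_square_Basis exp_sum[symmetric] sum_negf[symmetric] sum_divide_distrib)

lemma cis_inner_prod: "cis (x \<bullet> (\<xi>::'a::euclidean_space)) = (\<Prod>b\<in>Basis. cis ((x \<bullet> b) * (\<xi> \<bullet> b)))"
  by (simp add: euclidean_inner[of x \<xi>] cis_conv_exp exp_sum[symmetric] sum_distrib_left)

lemma integrable_gaussian: "integrable lborel (\<lambda>x::'a::euclidean_space. exp (- (norm x)\<^sup>2 / 2))"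
proof -
  have 1: "(\<integral>\<^sup>+s. ennreal (exp (- s\<^sup>2 / 2)) \<partial>lborel) < \<infinity>"
    using integrable_gaussian_real by (simp add: integrable_iff_bounded)
  have "(\<integral>\<^sup>+(x::'a). ennreal (exp (- (norm x)\<^sup>2 / 2)) \<partial>lborel) = (\<integral>\<^sup>+(x::'a). (\<Prod>b\<in>Basis. ennreal (exp (- (x \<bullet> b)\<^sup>2 / 2))) \<partial>lborel)"
    unfolding exp_norm_square_prod by (simp add: prod_ennreal)
  also have "\<dots> = (\<Prod>b\<in>(Basis::'a set). \<integral>\<^sup>+s. ennreal (exp (- s\<^sup>2 / 2)) \<partial>lborel)"
    by (rule nn_integral_prod_Basis) auto
  also have "\<dots> < \<infinity>"
    using 1 by (simp add: power_less_top_ennreal)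
  finally show ?thesis
    by (intro integrableI_bounded) auto
qed

lemma borel_measurable_cis [measurable]: "cis \<in> borel_measurable borel"
  by (intro borel_measurable_continuous_onI continuous_on_cis continuous_on_id)

text \<open>Both factors split over the coordinates, so the one-dimensional formula applies N times.
  The Gaussian will be the regularizer in the computation of the mass of the kernel.\<close>

lemma gaussian_fourier:
  "integral\<^sup>L lborel (\<lambda>x::'a::euclidean_space. exp (- (norm x)\<^sup>2 / 2) * cos (x \<bullet> \<xi>))
     = sqrt (2 * pi) ^ DIM('a) * exp (- (norm \<xi>)\<^sup>2 / 2)"
proof -
  have int: "integrable lborel (\<lambda>x::'a. complex_of_real (exp (- (norm x)\<^sup>2 / 2)) * cis (x \<bullet> \<xi>))"
    by (rule Bochner_Integration.integrable_bound[OF integrable_gaussian]) (auto simp: norm_mult)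
  have "(\<integral>(x::'a). complex_of_real (exp (- (norm x)\<^sup>2 / 2)) * cis (x \<bullet> \<xi>) \<partial>lborel)
     = (\<integral>(x::'a). (\<Prod>b\<in>Basis. complex_of_real (exp (- (x \<bullet> b)\<^sup>2 / 2)) * cis ((x \<bullet> b) * (\<xi> \<bullet> b))) \<partial>lborel)"
    unfolding exp_norm_square_prod cis_inner_prod by (simp add: prod.distrib)
  also have "\<dots> = (\<Prod>b\<in>(Basis::'a set). \<integral>s. complex_of_real (exp (- s\<^sup>2 / 2)) * cis (s * (\<xi> \<bullet> b)) \<partial>lborel)"
    by (rule integral_prod_Basis, rule Bochner_Integration.integrable_bound[OF integrable_gaussian_real])
      (auto simp: norm_mult)
  also have "\<dots> = complex_of_real (sqrt (2 * pi) ^ DIM('a) * exp (- (norm \<xi>)\<^sup>2 / 2))"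
    unfolding gaussian_fourier_real exp_norm_square_prod by (simp add: prod.distrib)
  finally have "Re (\<integral>(x::'a). complex_of_real (exp (- (norm x)\<^sup>2 / 2)) * cis (x \<bullet> \<xi>) \<partial>lborel)
     = sqrt (2 * pi) ^ DIM('a) * exp (- (norm \<xi>)\<^sup>2 / 2)"
    by simp
  then show ?thesis
    by (subst (asm) integral_Re[symmetric, OF int]) simp
qed

lemma nn_integral_cauchy_real: "(\<integral>\<^sup>+s. ennreal (1 / (1 + s\<^sup>2)) \<partial>lborel) < \<infinity>"
proof -
  \<comment> \<open>Only finiteness matters, so the point 0 may be counted in both
    half-lines.\<close>
  have "(\<integral>\<^sup>+s. ennreal (1 / (1 + s\<^sup>2)) \<partial>lborel) \<le> (\<integral>\<^sup>+s. ennreal (1 / (1 + s\<^sup>2)) * indicator {0..} s + ennreal (1 / (1 + s\<^sup>2)) * indicator {..0} s \<partial>lborel)"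
    by (intro nn_integral_mono) (auto split: split_indicator)
  also have "\<dots> = (\<integral>\<^sup>+s. ennreal (1 / (1 + s\<^sup>2)) * indicator {0..} s \<partial>lborel) + (\<integral>\<^sup>+s. ennreal (1 / (1 + s\<^sup>2)) * indicator {..0} s \<partial>lborel)"
    by (rule nn_integral_add) auto
  also have "(\<integral>\<^sup>+s. ennreal (1 / (1 + s\<^sup>2)) * indicator {..0} s \<partial>lborel) = (\<integral>\<^sup>+s. ennreal (1 / (1 + s\<^sup>2)) * indicator {0..} s \<partial>lborel)"
    by (subst nn_integral_lborel_reflect[of _ 0, symmetric]) (auto intro!: nn_integral_cong split: split_indicator)
  also have "(\<integral>\<^sup>+s. ennreal (1 / (1 + s\<^sup>2)) * indicator {0..} s \<partial>lborel) = ennreal (pi/2 - arctan 0)"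
  proof (rule nn_integral_FTC_atLeast)
    show "(arctan \<longlongrightarrow> pi/2) at_top" by (rule tendsto_arctan_at_top)
    show "(arctan has_real_derivative 1 / (1 + s\<^sup>2)) (at s)" for s
      by (auto intro!: derivative_eq_intros simp: field_simps)
  qed auto
  finally show ?thesis
    by (rule le_less_trans) (simp add: ennreal_add_eq_top less_top[symmetric])
qed

lemma nn_integral_cauchy_prod:
  "integral\<^sup>N lborel (\<lambda>x::'a::euclidean_space. ennreal (\<Prod>b\<in>Basis. 1 / (1 + (x \<bullet> b)\<^sup>2))) < \<infinity>"
proof -
  have "(\<integral>\<^sup>+(x::'a). ennreal (\<Prod>b\<in>Basis. 1 / (1 + (x \<bullet> b)\<^sup>2)) \<partial>lborel) = (\<integral>\<^sup>+(x::'a). (\<Prod>b\<in>Basis. ennreal (1 / (1 + (x \<bullet> b)\<^sup>2))) \<partial>lborel)"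
    by (simp add: prod_ennreal)
  also have "\<dots> = (\<Prod>b\<in>(Basis::'a set). \<integral>\<^sup>+s. ennreal (1 / (1 + s\<^sup>2)) \<partial>lborel)"
    by (rule nn_integral_prod_Basis) auto
  also have "\<dots> < \<infinity>"
    using nn_integral_cauchy_real by (simp add: power_less_top_ennreal)
  finally show ?thesis .
qed

section \<open>Decay of the polyharmonic kernel\<close>

text \<open>The type is general because the same differences act on the symbol on R^N and on its
  holomorphic extension in one complex variable.\<close>

primrec fdiff :: "'a::plus \<Rightarrow> ('a \<Rightarrow> 'b::minus) \<Rightarrow> nat \<Rightarrow> 'a \<Rightarrow> 'b" where
  "fdiff h g 0 = g"
| "fdiff h g (Suc j) = (\<lambda>\<xi>. fdiff h g j (\<xi> + h) - fdiff h g j \<xi>)"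

lemma integrable_fdiff:
  fixes g :: "'a::euclidean_space \<Rightarrow> real"
  assumes "integrable lborel g"
  shows "integrable lborel (fdiff h g j)"
proof (induction j)
  case (Suc j)
  have "integrable lborel (\<lambda>\<xi>. fdiff h g j (h + 1 *\<^sub>R \<xi>))"
    by (rule lborel_integrable_affine[OF Suc]) simp
  with Suc show ?case by (simp add: add.commute)
qed (simp add: assms)

text \<open>Each difference along a step \<open>h\<close> with \<open>x \<bullet> h = pi\<close> multiplies the cosine integral by \<open>-2\<close>;
  this replaces integration by parts.\<close>

lemma integral_fdiff_cos:
  fixes g :: "'a::euclidean_space \<Rightarrow> real"
  assumes g: "integrable lborel g" and h: "x \<bullet> h = pi"
  shows "(\<integral>\<xi>. fdiff h g j \<xi> * cos (x \<bullet> \<xi>) \<partial>lborel) = (-2) ^ j * (\<integral>\<xi>. g \<xi> * cos (x \<bullet> \<xi>) \<partial>lborel)"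
proof (induction j)
  case (Suc j)
  let ?G = "fdiff h g j"
  have G: "integrable lborel ?G" by (rule integrable_fdiff[OF g])
  have G': "integrable lborel (\<lambda>\<xi>. ?G (\<xi> + h))"
    using lborel_integrable_affine[OF G, of 1 h] by (simp add: add.commute)
  have [measurable]: "?G \<in> borel_measurable borel" using borel_measurable_integrable[OF G] by simp
  have i1: "integrable lborel (\<lambda>\<xi>. ?G \<xi> * cos (x \<bullet> \<xi>))"
    by (rule Bochner_Integration.integrable_bound[OF G]) (auto simp: abs_mult intro!: mult_left_le)
  have i2: "integrable lborel (\<lambda>\<xi>. ?G (\<xi> + h) * cos (x \<bullet> \<xi>))"
    by (rule Bochner_Integration.integrable_bound[OF G']) (auto simp: abs_mult intro!: mult_left_le)
  have "(\<integral>\<xi>. ?G \<xi> * cos (x \<bullet> \<xi>) \<partial>lborel) = (\<integral>\<xi>. ?G (h + 1 *\<^sub>R \<xi>) * cos (x \<bullet> (h + 1 *\<^sub>R \<xi>)) \<partial>lborel)"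
    by (subst lborel_integral_affine[of _ 1 h]) auto
  also have "\<dots> = - (\<integral>\<xi>. ?G (\<xi> + h) * cos (x \<bullet> \<xi>) \<partial>lborel)"
    using h by (simp add: inner_add_right add.commute[of pi] add.commute[of h] cos_add)
  finally have "(\<integral>\<xi>. ?G (\<xi> + h) * cos (x \<bullet> \<xi>) \<partial>lborel) = - (\<integral>\<xi>. ?G \<xi> * cos (x \<bullet> \<xi>) \<partial>lborel)"
    by simp
  then show ?case
    using i1 i2 Suc by (simp add: left_diff_distrib)
qed simp

text \<open>By Cauchy's inequality each difference gains a factor \<open>\<delta>\<close> and costs two units of radius.\<close>

lemma norm_fdiff_holomorphic_le:
  fixes \<phi> :: "complex \<Rightarrow> complex"
  assumes hol: "\<phi> holomorphic_on UNIV" and \<delta>: "0 < \<delta>" "\<delta> \<le> 1"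
    and M: "\<And>z. norm z \<le> R \<Longrightarrow> norm (\<phi> z) \<le> M"
    and z: "norm z \<le> R - 2 * real j"
  shows "norm (fdiff (of_real \<delta>) \<phi> j z) \<le> \<delta> ^ j * M"
  using z
proof (induction j arbitrary: z)
  case (Suc j)
  let ?F = "fdiff (of_real \<delta>) \<phi> j"
  have hF: "fdiff (of_real \<delta>) \<phi> i holomorphic_on UNIV" for i
  proof (induction i)
    case (Suc i)
    have "(\<lambda>z. fdiff (of_real \<delta>) \<phi> i (z + of_real \<delta>)) holomorphic_on UNIV"
    proof -
      have "(\<lambda>z. z + complex_of_real \<delta>) holomorphic_on UNIV" by (intro holomorphic_intros)
      from holomorphic_on_compose_gen[OF this Suc] show ?thesis by (simp add: o_def)
    qed
    with Suc show ?case by (auto intro!: holomorphic_intros)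
  qed (simp add: hol)
  \<comment> \<open>Cauchy's estimate on circles of radius 1 takes one unit of radius; the segment
    from z to z + \<delta> takes the other, as \<delta> \<le> 1. The next difference is then at most
    \<delta> times the bound on the derivative.\<close>
  have d: "norm (deriv ?F w) \<le> \<delta> ^ j * M" if w: "norm w \<le> R - 2 * real j - 1" for w
  proof -
    have "norm ((deriv ^^ 1) ?F w) \<le> fact 1 * (\<delta> ^ j * M) / 1 ^ 1"
    proof (rule Cauchy_inequality)
      show "?F holomorphic_on ball w 1" by (rule holomorphic_on_subset[OF hF]) simp
      show "continuous_on (cball w 1) ?F"
        by (rule holomorphic_on_imp_continuous_on, rule holomorphic_on_subset[OF hF]) simp
      fix y assume "norm (w - y) = 1"
      then have "norm y \<le> norm w + 1"
        by (metis norm_minus_commute norm_triangle_sub)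
      then show "norm (?F y) \<le> \<delta> ^ j * M" using w by (intro Suc.IH) simp
    qed simp
    then show ?thesis by simp
  qed
  have "norm (?F (z + of_real \<delta>) - ?F z) \<le> (\<delta> ^ j * M) * norm ((z + of_real \<delta>) - z)"
  proof (rule field_differentiable_bound[of "cball 0 (R - 2 * real j - 1)" ?F "deriv ?F"])
    show "(?F has_field_derivative deriv ?F w) (at w within cball 0 (R - 2 * real j - 1))"
      if "w \<in> cball 0 (R - 2 * real j - 1)" for w
      by (rule holomorphic_derivI[OF hF open_UNIV UNIV_I])
    show "z \<in> cball 0 (R - 2 * real j - 1)" using Suc.prems by simp
    have "norm (z + of_real \<delta>) \<le> norm z + 1"
      using \<delta> norm_triangle_ineq[of z "of_real \<delta>"] by simp
    then show "z + of_real \<delta> \<in> cball 0 (R - 2 * real j - 1)" using Suc.prems by simp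
  qed (auto simp: d)
  then show ?case using \<delta> by (simp add: mult_ac)
qed (use M in simp)

text \<open>On the line through \<xi> with direction e, a difference on R^N becomes a difference of
  a function of one complex variable, to which Cauchy's estimate applies.\<close>

lemma of_real_fdiff_line:
  fixes g :: "'a::real_vector \<Rightarrow> real" and \<phi> :: "complex \<Rightarrow> complex"
  assumes "\<And>s. \<phi> (of_real s) = of_real (g (\<xi> + s *\<^sub>R e))"
  shows "fdiff (of_real \<delta>) \<phi> j (of_real s) = of_real (fdiff (\<delta> *\<^sub>R e) g j (\<xi> + s *\<^sub>R e))"
proof (induction j arbitrary: s)
  case (Suc j)
  have "\<xi> + s *\<^sub>R e + \<delta> *\<^sub>R e = \<xi> + (s + \<delta>) *\<^sub>R e"
    by (simp add: scaleR_add_left)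
  then show ?case using Suc[of s] Suc[of "s + \<delta>"] by (simp only: fdiff.simps of_real_add of_real_diff)
qed (simp add: assms)

text \<open>The ratio of (r + R)^(2d) to r^(2d) tends to 1, so the left side is eventually below -
  r^(2d) / 2, hence below - r^2 / 2; M absorbs the bounded range of r. This is the exponent of a
  bound for the symbol on a complex disc, which thereby becomes Gaussian.\<close>

lemma polynomial_gap_bounded:
  fixes R :: real and d :: nat
  assumes R: "R \<ge> 0" and d: "d \<ge> 1"
  obtains M where "\<And>r. r \<ge> 0 \<Longrightarrow> (r + R) ^ (2 * d) - 2 * r ^ (2 * d) \<le> M - r\<^sup>2 / 2"
proof -
  have "((\<lambda>r. (1 + R / r) ^ (2 * d)) \<longlongrightarrow> (1 + 0) ^ (2 * d)) at_top"
    by (intro tendsto_power tendsto_add tendsto_const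
        tendsto_divide_0[OF tendsto_const filterlim_at_top_imp_at_infinity[OF filterlim_ident]])
  then have "eventually (\<lambda>r. (1 + R / r) ^ (2 * d) < 3/2) at_top"
    by (rule order_tendstoD) simp
  then obtain r0 where r0: "\<And>r. r \<ge> r0 \<Longrightarrow> (1 + R / r) ^ (2 * d) < 3/2"
    by (auto simp: eventually_at_top_linorder)
  let ?r = "max r0 1"
  have "(r + R) ^ (2 * d) - 2 * r ^ (2 * d) \<le> ((?r + R) ^ (2 * d) + ?r\<^sup>2 / 2) - r\<^sup>2 / 2" if r: "r \<ge> 0" for r
  proof (cases "r \<ge> ?r")
    case True
    then have r1: "r \<ge> 1" "r \<ge> r0" by auto
    have "(r + R) ^ (2 * d) = (1 + R / r) ^ (2 * d) * r ^ (2 * d)"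
      using r1 by (simp add: power_mult_distrib[symmetric] distrib_right)
    also have "\<dots> \<le> 3/2 * r ^ (2 * d)"
      using r0[OF r1(2)] r1 by (intro mult_right_mono) auto
    finally have 1: "(r + R) ^ (2 * d) \<le> 3/2 * r ^ (2 * d)" .
    have 2: "r\<^sup>2 \<le> r ^ (2 * d)" using r1 d by (intro power_increasing) auto
    have "0 \<le> (?r + R) ^ (2 * d) + ?r\<^sup>2 / 2" using R by (intro add_nonneg_nonneg zero_le_power) auto
    with 1 2 show ?thesis by linarith
  next
    case False
    have 1: "(r + R) ^ (2 * d) \<le> (?r + R) ^ (2 * d)" using False R r by (intro power_mono) auto
    have 2: "r\<^sup>2 \<le> ?r\<^sup>2" using False r by (intro power_mono) auto
    have "0 \<le> r ^ (2 * d)" using r by simp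
    with 1 2 show ?thesis by linarith
  qed
  then show ?thesis by (rule that)
qed

text \<open>The expansion of (a + b)^d - a^d in powers of a and b has nonnegative coefficients only,
  so passing to norms can only increase it.\<close>

lemma power_diff_bound:
  fixes a b :: "'a::{real_normed_algebra_1, comm_ring_1}"
  shows "norm ((a + b) ^ d - a ^ d) \<le> (norm a + norm b) ^ d - norm a ^ d"
proof (induction d)
  case (Suc d)
  have eq: "(a + b) ^ Suc d - a ^ Suc d = (a + b) * ((a + b) ^ d - a ^ d) + b * a ^ d"
    by (simp add: algebra_simps)
  have "norm ((a + b) ^ Suc d - a ^ Suc d) \<le> norm (a + b) * norm ((a + b) ^ d - a ^ d) + norm b * norm (a ^ d)"
    unfolding eq by (intro order.trans[OF norm_triangle_ineq] add_mono norm_mult_ineq)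
  also have "\<dots> \<le> (norm a + norm b) * ((norm a + norm b) ^ d - norm a ^ d) + norm b * norm a ^ d"
    by (intro add_mono mult_mono norm_triangle_ineq Suc norm_power_ineq) auto
  also have "\<dots> = (norm a + norm b) ^ Suc d - norm a ^ Suc d"
    by (simp add: algebra_simps)
  finally show ?case .
qed simp

text \<open>|xi|^(2d) \<ge> |xi|^2 - 1 on both sides of the unit sphere, so exp t times a Gaussian
  dominates.\<close>

lemma integrable_exp_power:
  assumes t: "t > 0" and d: "d \<ge> 1"
  shows "integrable lborel (\<lambda>\<xi>::'a::euclidean_space. exp (- t * norm \<xi> ^ (2 * d)))"
proof -
  have "integrable lborel (\<lambda>\<xi>::'a. exp t * exp (- (norm (0 + sqrt (2 * t) *\<^sub>R \<xi>))\<^sup>2 / 2))"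
    using t by (intro integrable_mult_right lborel_integrable_affine[OF integrable_gaussian]) simp
  then have i: "integrable lborel (\<lambda>\<xi>::'a. exp t * exp (- t * (norm \<xi>)\<^sup>2))"
    using t by (simp add: power_mult_distrib)
  have "(norm \<xi>)\<^sup>2 - 1 \<le> norm \<xi> ^ (2 * d)" for \<xi> :: 'a
  proof (cases "norm \<xi> \<ge> 1")
    case True
    then have "(norm \<xi>)\<^sup>2 \<le> norm \<xi> ^ (2 * d)" using d by (intro power_increasing) auto
    then show ?thesis by simp
  next
    case False
    then have "(norm \<xi>)\<^sup>2 \<le> 1" by (simp add: power_le_one)
    moreover have "0 \<le> norm \<xi> ^ (2 * d)" by simp
    ultimately show ?thesis by linarith
  qed
  then have "t * ((norm \<xi>)\<^sup>2 - 1) \<le> t * norm \<xi> ^ (2 * d)" for \<xi> :: 'a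
    using t by (intro mult_left_mono) auto
  then have "exp (- t * norm \<xi> ^ (2 * d)) \<le> exp t * exp (- t * (norm \<xi>)\<^sup>2)" for \<xi> :: 'a
    by (simp add: exp_add[symmetric] algebra_simps)
  then show ?thesis
    by (intro Bochner_Integration.integrable_bound[OF i]) auto
qed

lemma polyharm_kernel_eq_cos:
  assumes t: "t > 0" and d: "d \<ge> 1"
  shows "polyharm_kernel d t (x::'a::euclidean_space) = (2 * pi) powr (- real DIM('a)) *
           (\<integral>\<xi>. exp (- t * norm \<xi> ^ (2 * d)) * cos (x \<bullet> \<xi>) \<partial>lborel)"
proof -
  have int: "integrable lborel (\<lambda>\<xi>::'a. complex_of_real (exp (- t * norm \<xi> ^ (2 * d))) * cis (x \<bullet> \<xi>))"
    by (rule Bochner_Integration.integrable_bound[OF integrable_exp_power[OF assms]]) (auto simp: norm_mult)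
  have "Re (\<integral>\<xi>. complex_of_real (exp (- t * norm \<xi> ^ (2 * d))) * cis (x \<bullet> \<xi>) \<partial>lborel)
      = (\<integral>\<xi>. exp (- t * norm \<xi> ^ (2 * d)) * cos (x \<bullet> \<xi>) \<partial>lborel)"
    by (subst integral_Re[OF int, symmetric]) simp
  then show ?thesis
    unfolding polyharm_kernel_def by simp
qed

text \<open>Taking 2N differences along x / |x| with step pi / |x| multiplies the integral by 4^N,
  while the differenced symbol is at most (pi / |x|)^(2N) times a Gaussian. For |x| \<le> pi the
  integral of the symbol itself is a sufficient bound.\<close>

lemma fourier_exp_power_decay:
  fixes d :: nat
  assumes d: "d \<ge> 1"
  obtains C where "\<And>x::'a::euclidean_space.
    \<bar>(\<integral>\<xi>. exp (- (norm \<xi> ^ (2 * d))) * cos (x \<bullet> \<xi>) \<partial>lborel)\<bar> * (1 + (norm x)\<^sup>2) ^ DIM('a) \<le> C"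
proof -
  let ?N = "DIM('a)"
  let ?g = "\<lambda>\<xi>::'a. exp (- (norm \<xi> ^ (2 * d)))"
  \<comment> \<open>Room for 2N differences at two units of radius each.\<close>
  define R where "R = 4 * real ?N"
  obtain M where M: "\<And>r. r \<ge> 0 \<Longrightarrow> (r + R) ^ (2 * d) - 2 * r ^ (2 * d) \<le> M - r\<^sup>2 / 2"
    using polynomial_gap_bounded[of R d] d by (auto simp: R_def)
  have ig: "integrable lborel ?g"
    using integrable_exp_power[of 1 d] d by simp
  define J where "J = integral\<^sup>L lborel (\<lambda>\<xi>::'a. exp (- (norm \<xi>)\<^sup>2 / 2))"
  have J0: "J \<ge> 0" unfolding J_def by (intro integral_nonneg_AE) auto
  define I where "I x = (\<integral>\<xi>. ?g \<xi> * cos (x \<bullet> \<xi>) \<partial>lborel)" for x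
  have bnd: "\<bar>fdiff (\<delta> *\<^sub>R e) ?g (2 * ?N) \<xi>\<bar> \<le> \<delta> ^ (2 * ?N) * exp (M - (norm \<xi>)\<^sup>2 / 2)"
    if \<delta>: "0 < \<delta>" "\<delta> \<le> 1" and e: "norm e = 1" for \<delta> e and \<xi> :: 'a
  proof -
    \<comment> \<open>The symbol at \<xi> + s e with |e| = 1: there |\<xi> + s e|^2 is a quadratic
      polynomial in s, which extends to complex s.\<close>
    define \<phi> where "\<phi> z = exp (- ((of_real ((norm \<xi>)\<^sup>2) + (2 * z * of_real (\<xi> \<bullet> e) + z\<^sup>2)) ^ d))" for z :: complex
    have "\<phi> (of_real s) = of_real (?g (\<xi> + s *\<^sub>R e))" for s
    proof -
      have "norm (\<xi> + s *\<^sub>R e) ^ (2 * d) = ((norm \<xi>)\<^sup>2 + (2 * s * (\<xi> \<bullet> e) + s\<^sup>2)) ^ d"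
      proof -
        have "(norm (\<xi> + s *\<^sub>R e))\<^sup>2 = (norm \<xi>)\<^sup>2 + (2 * s * (\<xi> \<bullet> e) + s\<^sup>2)"
          using e unfolding power2_norm_eq_inner norm_eq_1
          by (simp add: inner_add_left inner_add_right inner_commute[of e \<xi>] algebra_simps power2_eq_square)
        then show ?thesis by (simp only: power_mult)
      qed
      then show ?thesis by (simp add: \<phi>_def exp_of_real[symmetric])
    qed
    then have eq: "fdiff (of_real \<delta>) \<phi> (2 * ?N) (of_real 0) = of_real (fdiff (\<delta> *\<^sub>R e) ?g (2 * ?N) (\<xi> + 0 *\<^sub>R e))"
      by (rule of_real_fdiff_line)
    have "norm (fdiff (of_real \<delta>) \<phi> (2 * ?N) (of_real 0)) \<le> \<delta> ^ (2 * ?N) * exp (M - (norm \<xi>)\<^sup>2 / 2)"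
    proof (rule norm_fdiff_holomorphic_le[OF _ \<delta>, of _ R])
      show "\<phi> holomorphic_on UNIV" unfolding \<phi>_def by (intro holomorphic_intros)
      show "norm (of_real 0 :: complex) \<le> R - 2 * real (2 * ?N)" by (simp add: R_def)
      fix z :: complex assume z: "norm z \<le> R"
      let ?r = "norm \<xi>" and ?b = "2 * z * of_real (\<xi> \<bullet> e) + z\<^sup>2"
      have "norm ?b \<le> norm (2 * z * of_real (\<xi> \<bullet> e)) + norm (z\<^sup>2)"
        by (rule norm_triangle_ineq)
      also have "\<dots> = 2 * (norm z * \<bar>\<xi> \<bullet> e\<bar>) + (norm z)\<^sup>2"
        by (simp add: norm_mult norm_power)
      also have "\<dots> \<le> 2 * (R * ?r) + R\<^sup>2"
        using z e Cauchy_Schwarz_ineq2[of \<xi> e] by (intro add_mono mult_mono mult_left_mono power_mono) (auto simp: R_def)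
      finally have b: "norm ?b \<le> 2 * (R * ?r) + R\<^sup>2" .
      \<comment> \<open>For complex s the d-th power may have negative real part. Comparison with
        r^(2d) shows that this real part is at least 2 r^(2d) - (r + R)^(2d), so \<phi> keeps a
        Gaussian bound in \<xi>, uniformly on the disc of radius R.\<close>
      have "norm ((of_real (?r\<^sup>2) + ?b) ^ d - of_real (?r\<^sup>2) ^ d)
          \<le> (norm (of_real (?r\<^sup>2) :: complex) + norm ?b) ^ d - norm (of_real (?r\<^sup>2) :: complex) ^ d"
        by (rule power_diff_bound)
      also have "\<dots> \<le> (?r + R) ^ (2 * d) - ?r ^ (2 * d)"
      proof -
        have "norm (of_real (?r\<^sup>2) :: complex) = ?r\<^sup>2"
          by (simp add: norm_power)
        moreover have "?r\<^sup>2 + norm ?b \<le> (?r + R)\<^sup>2"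
          using b by (simp add: power2_sum mult.commute)
        then have "(?r\<^sup>2 + norm ?b) ^ d \<le> (?r + R)\<^sup>2 ^ d"
          by (intro power_mono) auto
        ultimately show ?thesis
          by (simp only: power_mult)
      qed
      finally have "norm ((of_real (?r\<^sup>2) + ?b) ^ d - of_real (?r\<^sup>2) ^ d) \<le> (?r + R) ^ (2 * d) - ?r ^ (2 * d)" .
      then have "Re (of_real (?r\<^sup>2) ^ d - (of_real (?r\<^sup>2) + ?b) ^ d) \<le> (?r + R) ^ (2 * d) - ?r ^ (2 * d)"
        using complex_Re_le_cmod[of "of_real (?r\<^sup>2) ^ d - (of_real (?r\<^sup>2) + ?b) ^ d"] by (simp add: norm_minus_commute)
      moreover have "Re (of_real (?r\<^sup>2) ^ d) = ?r ^ (2 * d)"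
        by (simp add: power_mult of_real_power[symmetric] del: of_real_power)
      ultimately have "- Re ((of_real (?r\<^sup>2) + ?b) ^ d) \<le> (?r + R) ^ (2 * d) - 2 * ?r ^ (2 * d)"
        by simp
      also have "\<dots> \<le> M - ?r\<^sup>2 / 2" by (rule M) simp
      finally show "norm (\<phi> z) \<le> exp (M - ?r\<^sup>2 / 2)"
        unfolding \<phi>_def by simp
    qed
    then show ?thesis unfolding eq by simp
  qed
  have far: "\<bar>I x\<bar> * (1 + (norm x)\<^sup>2) ^ ?N \<le> (pi\<^sup>2 / 2) ^ ?N * exp M * J" if x: "norm x \<ge> pi" for x
  proof -
    let ?\<delta> = "pi / norm x" and ?e = "x /\<^sub>R norm x"
    have x0: "norm x > 0" "norm x \<ge> 1" using x pi_gt3 by linarith+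
    have \<delta>: "0 < ?\<delta>" "?\<delta> \<le> 1" using x x0 by auto
    have e: "norm ?e = 1" using x0 by simp
    have h: "x \<bullet> (?\<delta> *\<^sub>R ?e) = pi"
      using x0 by (simp add: power2_norm_eq_inner[symmetric] power2_eq_square)
    have "\<bar>(\<integral>\<xi>. fdiff (?\<delta> *\<^sub>R ?e) ?g (2 * ?N) \<xi> * cos (x \<bullet> \<xi>) \<partial>lborel)\<bar>
        \<le> (\<integral>\<xi>. (?\<delta> ^ (2 * ?N) * exp M) * exp (- (norm (\<xi>::'a))\<^sup>2 / 2) \<partial>lborel)"
    proof (rule Bochner_Integration.integral_abs_bound_integral)
      show "integrable lborel (\<lambda>\<xi>. fdiff (?\<delta> *\<^sub>R ?e) ?g (2 * ?N) \<xi> * cos (x \<bullet> \<xi>))"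
        using integrable_fdiff[OF ig, of "?\<delta> *\<^sub>R ?e" "2 * ?N"]
        by (rule Bochner_Integration.integrable_bound)
          (use borel_measurable_integrable[OF integrable_fdiff[OF ig, of "?\<delta> *\<^sub>R ?e" "2 * ?N"]] in
            \<open>auto simp: abs_mult intro!: mult_left_le\<close>)
      show "integrable lborel (\<lambda>\<xi>::'a. (?\<delta> ^ (2 * ?N) * exp M) * exp (- (norm \<xi>)\<^sup>2 / 2))"
        by (intro integrable_mult_right integrable_gaussian)
      fix \<xi> :: 'a
      have "\<bar>fdiff (?\<delta> *\<^sub>R ?e) ?g (2 * ?N) \<xi> * cos (x \<bullet> \<xi>)\<bar> \<le> \<bar>fdiff (?\<delta> *\<^sub>R ?e) ?g (2 * ?N) \<xi>\<bar>"
        by (simp add: abs_mult mult_left_le)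
      also have "\<dots> \<le> ?\<delta> ^ (2 * ?N) * exp (M - (norm \<xi>)\<^sup>2 / 2)"
        by (rule bnd[OF \<delta> e])
      finally show "\<bar>fdiff (?\<delta> *\<^sub>R ?e) ?g (2 * ?N) \<xi> * cos (x \<bullet> \<xi>)\<bar> \<le> (?\<delta> ^ (2 * ?N) * exp M) * exp (- (norm \<xi>)\<^sup>2 / 2)"
        by (simp add: exp_add[symmetric] mult.assoc)
    qed
    also have "\<dots> = ?\<delta> ^ (2 * ?N) * exp M * J" unfolding J_def by simp
    finally have *: "2 ^ (2 * ?N) * \<bar>I x\<bar> \<le> ?\<delta> ^ (2 * ?N) * exp M * J"
      unfolding integral_fdiff_cos[OF ig h] I_def by (simp add: abs_mult power_abs)
    have 1: "4 ^ ?N * \<bar>I x\<bar> * (norm x)\<^sup>2 ^ ?N \<le> pi\<^sup>2 ^ ?N * (exp M * J)"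
    proof -
      have "(2::real) ^ (2 * ?N) = 4 ^ ?N" "?\<delta> ^ (2 * ?N) = pi\<^sup>2 ^ ?N / (norm x)\<^sup>2 ^ ?N"
        by (simp_all add: power_mult power_divide)
      moreover have "(norm x)\<^sup>2 ^ ?N > 0" using x0 by simp
      ultimately show ?thesis using * by (simp add: pos_le_divide_eq)
    qed
    \<comment> \<open>Here |x| \<ge> pi > 1, so the weight is at most a power of 2 |x|^2.\<close>
    have "(1 + (norm x)\<^sup>2) ^ ?N \<le> (2 * (norm x)\<^sup>2) ^ ?N"
      using x0 by (intro power_mono) auto
    then have "\<bar>I x\<bar> * (1 + (norm x)\<^sup>2) ^ ?N \<le> \<bar>I x\<bar> * (2 * (norm x)\<^sup>2) ^ ?N"
      by (intro mult_left_mono) auto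
    also have "\<dots> = (4 ^ ?N * \<bar>I x\<bar> * (norm x)\<^sup>2 ^ ?N) / 2 ^ ?N"
      by (simp add: power_mult_distrib field_simps flip: power_mult_distrib[of 2 2])
    also have "\<dots> \<le> (pi\<^sup>2 ^ ?N * (exp M * J)) / 2 ^ ?N"
      using 1 by (intro divide_right_mono) auto
    finally show ?thesis by (simp add: power_divide)
  qed
  have near: "\<bar>I x\<bar> * (1 + (norm x)\<^sup>2) ^ ?N \<le> integral\<^sup>L lborel ?g * (1 + pi\<^sup>2) ^ ?N" if x: "norm x \<le> pi" for x
  proof (intro mult_mono power_mono add_left_mono)
    show "\<bar>I x\<bar> \<le> integral\<^sup>L lborel ?g" unfolding I_def
      by (rule Bochner_Integration.integral_abs_bound_integral)
        (auto simp: abs_mult ig intro!: Bochner_Integration.integrable_bound[OF ig])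
  qed (use x in auto)
  have "\<bar>I x\<bar> * (1 + (norm x)\<^sup>2) ^ ?N \<le> max ((pi\<^sup>2 / 2) ^ ?N * exp M * J) (integral\<^sup>L lborel ?g * (1 + pi\<^sup>2) ^ ?N)" for x
    using far[of x] near[of x] by (cases "norm x \<ge> pi") auto
  then show ?thesis unfolding I_def by (rule that)
qed

section \<open>Scaling, integrable majorant and total mass of the kernel\<close>

lemma borel_measurable_polyharm_kernel [measurable]:
  "(\<lambda>p::real \<times> 'a::euclidean_space. polyharm_kernel d (fst p) (snd p)) \<in> borel_measurable borel"
  unfolding polyharm_kernel_def borel_prod[symmetric] by measurable

lemma polyharm_kernel_scaling:
  assumes t: "t > 0" and d: "d \<ge> 1"
  shows "polyharm_kernel d t (x::'a::euclidean_space) =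
    t powr (- (real DIM('a) / (2 * real d))) * polyharm_kernel d 1 (x /\<^sub>R t powr (1 / (2 * real d)))"
proof -
  let ?N = "DIM('a)"
  define l where "l = t powr (1 / (2 * real d))"
  have l: "l > 0" and l2d: "l ^ (2 * d) = t"
    using t d by (simp_all add: l_def powr_power)
  have lN: "\<bar>inverse l\<bar> ^ ?N = t powr (- (real ?N / (2 * real d)))"
    using t l by (simp add: l_def powr_power power_inverse powr_minus)
  have "polyharm_kernel d t x = (2 * pi) powr (- real ?N) *
      (\<bar>inverse l\<bar> ^ ?N * (\<integral>\<xi>. exp (- t * norm (0 + inverse l *\<^sub>R \<xi>) ^ (2 * d)) * cos (x \<bullet> (0 + inverse l *\<^sub>R \<xi>)) \<partial>lborel))"
    unfolding polyharm_kernel_eq_cos[OF assms] using l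
    by (subst lborel_integral_affine[of _ "inverse l" 0]) auto
  also have "(\<lambda>\<xi>. exp (- t * norm (0 + inverse l *\<^sub>R \<xi>) ^ (2 * d)) * cos (x \<bullet> (0 + inverse l *\<^sub>R \<xi>)))
      = (\<lambda>\<xi>. exp (- 1 * norm \<xi> ^ (2 * d)) * cos ((x /\<^sub>R l) \<bullet> \<xi>))"
    using l t by (simp add: power_mult_distrib power_inverse l2d mult.assoc[symmetric])
  finally show ?thesis
    unfolding lN polyharm_kernel_eq_cos[OF zero_less_one d] l_def[symmetric] by simp
qed

text \<open>A product instead of a radial weight, because its integral factors into one-dimensional
  ones.\<close>

definition cauchy_prod :: "'a::euclidean_space \<Rightarrow> real" where
  "cauchy_prod x = (\<Prod>b\<in>Basis. 1 / (1 + (x \<bullet> b)\<^sup>2))"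

lemma borel_measurable_cauchy_prod [measurable]: "cauchy_prod \<in> borel_measurable borel"
  unfolding cauchy_prod_def[abs_def] by measurable

lemma cauchy_prod_pos: "cauchy_prod x > 0"
  unfolding cauchy_prod_def by (intro prod_pos) (simp add: add_pos_nonneg)

lemma abs_cauchy_prod [simp]: "\<bar>cauchy_prod x\<bar> = cauchy_prod x"
  using cauchy_prod_pos[of x] by simp

lemma cauchy_prod_le_1: "cauchy_prod x \<le> 1"
  unfolding cauchy_prod_def by (intro prod_le_1) (auto simp: add_pos_nonneg)

text \<open>Each of the N factors 1 + (x . b)^2 is at most 1 + |x|^2, so decay like the power -N of
  1 + |x|^2 implies decay like the product.\<close>

lemma cauchy_prod_ge: "1 \<le> cauchy_prod x * (1 + (norm (x::'a::euclidean_space))\<^sup>2) ^ DIM('a)"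
proof -
  have "(\<Prod>b\<in>(Basis::'a set). 1 + (x \<bullet> b)\<^sup>2) \<le> (\<Prod>b\<in>(Basis::'a set). 1 + (norm x)\<^sup>2)"
  proof (intro prod_mono conjI add_left_mono)
    fix b :: 'a assume "b \<in> Basis"
    then have "\<bar>x \<bullet> b\<bar> \<le> norm x" by (rule Basis_le_norm)
    then show "(x \<bullet> b)\<^sup>2 \<le> (norm x)\<^sup>2" by (metis abs_le_square_iff abs_norm_cancel)
  qed simp
  moreover have "0 < (\<Prod>b\<in>(Basis::'a set). 1 + (x \<bullet> b)\<^sup>2)"
    by (intro prod_pos) (simp add: add_pos_nonneg)
  ultimately show ?thesis
    unfolding cauchy_prod_def by (simp add: prod_dividef)
qed

lemma polyharm_kernel_bound:
  assumes d: "d \<ge> 1"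
  obtains C where "C > 0" "\<And>x::'a::euclidean_space. \<bar>polyharm_kernel d 1 x\<bar> \<le> C * cauchy_prod x"
proof -
  let ?N = "DIM('a)"
  obtain C where C: "\<And>x::'a. \<bar>(\<integral>\<xi>. exp (- (norm \<xi> ^ (2 * d))) * cos (x \<bullet> \<xi>) \<partial>lborel)\<bar> * (1 + (norm x)\<^sup>2) ^ ?N \<le> C"
    using fourier_exp_power_decay[OF d] by blast
  let ?c = "(2 * pi) powr (- real ?N)"
  \<comment> \<open>The added 1 keeps the constant positive even if C = 0.\<close>
  have "\<bar>polyharm_kernel d 1 x\<bar> \<le> (?c * \<bar>C\<bar> + 1) * cauchy_prod x" for x :: 'a
  proof -
    let ?I = "\<integral>\<xi>. exp (- (norm \<xi> ^ (2 * d))) * cos (x \<bullet> \<xi>) \<partial>lborel"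
    have "\<bar>?I\<bar> * 1 \<le> \<bar>?I\<bar> * (cauchy_prod x * (1 + (norm x)\<^sup>2) ^ ?N)"
      by (intro mult_left_mono cauchy_prod_ge) auto
    also have "\<dots> \<le> cauchy_prod x * \<bar>C\<bar>"
      using mult_left_mono[OF order.trans[OF C[of x] abs_ge_self], of "cauchy_prod x"] cauchy_prod_pos[of x]
      by (simp add: mult_ac)
    finally have "?c * \<bar>?I\<bar> \<le> ?c * (cauchy_prod x * \<bar>C\<bar>)" by (intro mult_left_mono) auto
    then have "\<bar>polyharm_kernel d 1 x\<bar> \<le> ?c * (cauchy_prod x * \<bar>C\<bar>)"
      unfolding polyharm_kernel_eq_cos[OF zero_less_one d] by (simp add: abs_mult)
    then show ?thesis using cauchy_prod_pos[of x] by (simp add: algebra_simps)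
  qed
  moreover have "?c * \<bar>C\<bar> + 1 > 0" by (intro add_nonneg_pos) auto
  ultimately show ?thesis using that by blast
qed

lemma integrable_polyharm_kernel:
  assumes d: "d \<ge> 1"
  shows "integrable lborel (polyharm_kernel d 1 :: 'a::euclidean_space \<Rightarrow> real)"
proof -
  obtain C where C: "C > 0" "\<And>x::'a. \<bar>polyharm_kernel d 1 x\<bar> \<le> C * cauchy_prod x"
    using polyharm_kernel_bound[OF d] by blast
  have i: "integrable lborel (\<lambda>x::'a. C * cauchy_prod x)"
    using nn_integral_cauchy_prod[where 'a='a] cauchy_prod_pos
    by (intro integrable_mult_right integrableI_bounded)
       (auto simp: abs_of_pos cauchy_prod_def[symmetric])
  have m: "(polyharm_kernel d 1 :: 'a \<Rightarrow> real) \<in> borel_measurable lborel"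
    using measurable_compose[OF _ borel_measurable_polyharm_kernel, of "\<lambda>x::'a. (1, x)" lborel d]
    by (simp add: borel_prod[symmetric])
  have "norm (polyharm_kernel d 1 x) \<le> norm (C * cauchy_prod x)" for x :: 'a
    using order.trans[OF C(2) abs_ge_self] by simp
  then show ?thesis
    by (intro Bochner_Integration.integrable_bound[OF i m] AE_I2)
qed

lemma integrable_tensor:
  fixes f :: "'a::euclidean_space \<Rightarrow> real" and g :: "'b::euclidean_space \<Rightarrow> real"
  assumes f: "integrable lborel f" and g: "integrable lborel g"
  shows "integrable (lborel \<Otimes>\<^sub>M lborel) (\<lambda>(x, y). f x * g y)"
proof -
  have [measurable]: "f \<in> borel_measurable borel" "g \<in> borel_measurable borel"
    using f g borel_measurable_integrable by force+
  show ?thesis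
  proof (rule lborel_pair.Fubini_integrable)
    show "integrable lborel (\<lambda>x. \<integral>y. norm (case (x, y) of (x, y) \<Rightarrow> f x * g y) \<partial>lborel)"
      using f by (simp add: abs_mult)
  qed (auto intro!: integrable_mult_right g)
qed

text \<open>Fourier inversion at frequency 0: the mass is the value 1 of the symbol there. As exp (-
  |xi|^(2d)) cos (x . xi) is not integrable in x and xi jointly, a Gaussian in x is inserted and its
  width sent to infinity.\<close>

lemma integral_polyharm_kernel_eq_1:
  assumes d: "d \<ge> 1"
  shows "integral\<^sup>L lborel (polyharm_kernel d 1 :: 'a::euclidean_space \<Rightarrow> real) = 1"
proof -
  let ?N = "DIM('a)"
  let ?E = "polyharm_kernel d 1 :: 'a \<Rightarrow> real"
  let ?g = "\<lambda>\<xi>::'a. exp (- 1 * norm \<xi> ^ (2 * d))"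
  let ?w = "\<lambda>x::'a. exp (- (norm x)\<^sup>2 / 2)"
  define e where "e n = inverse (real (Suc n))" for n
  have e: "e n > 0" for n by (simp add: e_def)
  have e_lim: "e \<longlonglongrightarrow> 0" unfolding e_def by (rule LIMSEQ_inverse_real_of_nat)
  have mult_cancel: "\<bar>e n\<bar> ^ ?N * \<bar>inverse (e n)\<bar> ^ ?N = 1" for n
    using e[of n] by (simp add: power_inverse)
  have iE: "integrable lborel ?E" by (rule integrable_polyharm_kernel[OF d])
  have [measurable]: "?E \<in> borel_measurable borel" using borel_measurable_integrable[OF iE] by simp
  have ig: "integrable lborel ?g" using d by (intro integrable_exp_power) auto
  define L where "L n = (\<integral>x. ?E x * ?w (e n *\<^sub>R x) \<partial>lborel)" for n
  have "L \<longlonglongrightarrow> (\<integral>x. ?E x * ?w (0 *\<^sub>R x) \<partial>lborel)"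
    unfolding L_def
  proof (rule integral_dominated_convergence[where w = "\<lambda>x. \<bar>?E x\<bar>"])
    show "AE x in lborel. (\<lambda>n. ?E x * ?w (e n *\<^sub>R x)) \<longlonglongrightarrow> ?E x * ?w (0 *\<^sub>R x)"
      by (intro AE_I2 tendsto_intros e_lim) simp
  qed (auto simp: abs_mult iE mult_left_le)
  then have L1: "L \<longlonglongrightarrow> integral\<^sup>L lborel ?E" by simp
  \<comment> \<open>Fubini, the Gaussian transform in x, then the substitution \<xi> = e n \<eta>:
    the powers of e n cancel and the dilation ends up in the symbol.\<close>
  have L_eq: "L n = (2 * pi) powr (- real ?N) * (sqrt (2 * pi) ^ ?N * (\<integral>\<eta>. ?g (e n *\<^sub>R \<eta>) * ?w \<eta> \<partial>lborel))" for n
  proof -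
    have iw: "integrable lborel (\<lambda>x::'a. ?w (e n *\<^sub>R x))"
      using lborel_integrable_affine[OF integrable_gaussian, of "e n" 0] e[of n] by simp
    have "integrable (lborel \<Otimes>\<^sub>M lborel) (\<lambda>(x::'a, \<xi>). ?w (e n *\<^sub>R x) * ?g \<xi>)"
      by (rule integrable_tensor[OF iw ig])
    then have i2: "integrable (lborel \<Otimes>\<^sub>M lborel) (\<lambda>(\<xi>::'a, x). ?g \<xi> * cos (x \<bullet> \<xi>) * ?w (e n *\<^sub>R x))"
    proof (subst lborel_pair.integrable_product_swap_iff[symmetric], rule Bochner_Integration.integrable_bound)
      have "\<bar>?g \<xi> * cos (x \<bullet> \<xi>) * ?w (e n *\<^sub>R x)\<bar> \<le> ?w (e n *\<^sub>R x) * ?g \<xi>" for x \<xi> :: 'a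
      proof -
        have "\<bar>?g \<xi> * cos (x \<bullet> \<xi>) * ?w (e n *\<^sub>R x)\<bar> = (?w (e n *\<^sub>R x) * ?g \<xi>) * \<bar>cos (x \<bullet> \<xi>)\<bar>"
          by (simp add: abs_mult)
        also have "\<dots> \<le> ?w (e n *\<^sub>R x) * ?g \<xi>" by (rule mult_left_le) auto
        finally show ?thesis .
      qed
      then show "AE z in lborel \<Otimes>\<^sub>M lborel. norm (case z of (x, y) \<Rightarrow> (case (y, x) of (\<xi>, x) \<Rightarrow> ?g \<xi> * cos (x \<bullet> \<xi>) * ?w (e n *\<^sub>R x)))
          \<le> norm (case z of (x::'a, \<xi>) \<Rightarrow> ?w (e n *\<^sub>R x) * ?g \<xi>)"
        by (intro AE_I2) (simp add: split_beta)
    qed auto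
    have inner: "(\<integral>x. cos (x \<bullet> \<xi>) * ?w (e n *\<^sub>R x) \<partial>lborel) = \<bar>inverse (e n)\<bar> ^ ?N * (sqrt (2 * pi) ^ ?N * ?w (\<xi> /\<^sub>R e n))" for \<xi> :: 'a
    proof -
      have "(\<integral>x. cos (x \<bullet> \<xi>) * ?w (e n *\<^sub>R x) \<partial>lborel) = \<bar>inverse (e n)\<bar> ^ ?N *
         (\<integral>x. cos ((0 + inverse (e n) *\<^sub>R x) \<bullet> \<xi>) * ?w (e n *\<^sub>R (0 + inverse (e n) *\<^sub>R x)) \<partial>lborel)"
        using e[of n] by (intro lborel_integral_affine) auto
      also have "(\<lambda>x. cos ((0 + inverse (e n) *\<^sub>R x) \<bullet> \<xi>) * ?w (e n *\<^sub>R (0 + inverse (e n) *\<^sub>R x)))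
          = (\<lambda>x. ?w x * cos (x \<bullet> (\<xi> /\<^sub>R e n)))"
        using e[of n] by (simp add: mult.commute)
      finally show ?thesis by (simp only: gaussian_fourier)
    qed
    have "L n = (\<integral>x. (2 * pi) powr (- real ?N) * (\<integral>\<xi>. ?g \<xi> * cos (x \<bullet> \<xi>) * ?w (e n *\<^sub>R x) \<partial>lborel) \<partial>lborel)"
      unfolding L_def polyharm_kernel_eq_cos[OF zero_less_one d]
      by (simp only: integral_mult_left_zero) (simp only: mult.assoc)
    also have "\<dots> = (2 * pi) powr (- real ?N) * (\<integral>\<xi>. (\<integral>x. ?g \<xi> * cos (x \<bullet> \<xi>) * ?w (e n *\<^sub>R x) \<partial>lborel) \<partial>lborel)"
      using lborel_pair.Fubini_integral[OF i2] by simp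
    also have "\<dots> = (2 * pi) powr (- real ?N) * (\<integral>\<xi>. ?g \<xi> * (\<bar>inverse (e n)\<bar> ^ ?N * (sqrt (2 * pi) ^ ?N * ?w (\<xi> /\<^sub>R e n))) \<partial>lborel)"
      by (simp only: mult.assoc integral_mult_right_zero inner)
    also have "(\<integral>\<xi>. ?g \<xi> * (\<bar>inverse (e n)\<bar> ^ ?N * (sqrt (2 * pi) ^ ?N * ?w (\<xi> /\<^sub>R e n))) \<partial>lborel)
        = \<bar>e n\<bar> ^ ?N * (\<integral>\<xi>. ?g (0 + e n *\<^sub>R \<xi>) * (\<bar>inverse (e n)\<bar> ^ ?N * (sqrt (2 * pi) ^ ?N * ?w ((0 + e n *\<^sub>R \<xi>) /\<^sub>R e n))) \<partial>lborel)"
      using e[of n] by (intro lborel_integral_affine) auto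
    also have "(\<lambda>\<xi>. ?g (0 + e n *\<^sub>R \<xi>) * (\<bar>inverse (e n)\<bar> ^ ?N * (sqrt (2 * pi) ^ ?N * ?w ((0 + e n *\<^sub>R \<xi>) /\<^sub>R e n))))
        = (\<lambda>\<xi>. (\<bar>inverse (e n)\<bar> ^ ?N * sqrt (2 * pi) ^ ?N) * (?g (e n *\<^sub>R \<xi>) * ?w \<xi>))"
      using e[of n] by (simp add: mult_ac)
    finally have **: "L n = (2 * pi) powr (- real ?N) * (\<bar>e n\<bar> ^ ?N * (\<integral>\<xi>. (\<bar>inverse (e n)\<bar> ^ ?N * sqrt (2 * pi) ^ ?N) * (?g (e n *\<^sub>R \<xi>) * ?w \<xi>) \<partial>lborel))" .
    show ?thesis
    proof -
      have "\<bar>e n\<bar> ^ ?N * ((\<bar>inverse (e n)\<bar> ^ ?N * sqrt (2 * pi) ^ ?N) * J) = sqrt (2 * pi) ^ ?N * J" for J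
      proof -
        have "\<bar>e n\<bar> ^ ?N * ((\<bar>inverse (e n)\<bar> ^ ?N * sqrt (2 * pi) ^ ?N) * J)
            = (\<bar>e n\<bar> ^ ?N * \<bar>inverse (e n)\<bar> ^ ?N) * (sqrt (2 * pi) ^ ?N * J)"
          by (simp only: mult.assoc)
        then show ?thesis by (simp only: mult_cancel mult_1)
      qed
      note cancel = this
      show ?thesis using ** unfolding integral_mult_right_zero cancel .
    qed
  qed
  have "(\<lambda>n. \<integral>\<eta>. ?g (e n *\<^sub>R \<eta>) * ?w \<eta> \<partial>lborel) \<longlonglongrightarrow> (\<integral>\<eta>. ?g (0 *\<^sub>R \<eta>) * ?w \<eta> \<partial>lborel)"
  proof (rule integral_dominated_convergence[where w = ?w])
    show "AE \<eta> in lborel. (\<lambda>n. ?g (e n *\<^sub>R \<eta>) * ?w \<eta>) \<longlonglongrightarrow> ?g (0 *\<^sub>R \<eta>) * ?w \<eta>"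
      by (intro AE_I2 tendsto_intros e_lim)
  qed (use integrable_gaussian in \<open>auto simp: abs_mult\<close>)
  then have "L \<longlonglongrightarrow> (2 * pi) powr (- real ?N) * (sqrt (2 * pi) ^ ?N * (\<integral>\<eta>. ?g (0 *\<^sub>R \<eta>) * ?w \<eta> \<partial>lborel))"
    unfolding L_eq by (intro tendsto_intros)
  also have "(\<integral>\<eta>. ?g (0 *\<^sub>R \<eta>) * ?w \<eta> \<partial>lborel) = sqrt (2 * pi) ^ ?N"
  proof -
    have "?g (0 *\<^sub>R \<eta>) * ?w \<eta> = ?w \<eta> * cos (\<eta> \<bullet> 0)" for \<eta> using d by simp
    then show ?thesis using gaussian_fourier[of "0::'a"] by (simp only:) simp
  qed
  also have "(2 * pi) powr (- real ?N) * (sqrt (2 * pi) ^ ?N * sqrt (2 * pi) ^ ?N) = 1"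
  proof -
    have "sqrt (2 * pi) ^ ?N * sqrt (2 * pi) ^ ?N = (2 * pi) ^ ?N"
      by (subst power_mult_distrib[symmetric]) simp
    moreover have "(2 * pi) powr (- real ?N) = inverse ((2 * pi) ^ ?N)"
      by (simp only: powr_minus powr_realpow[OF mult_pos_pos[OF zero_less_numeral pi_gt_zero]])
    ultimately show ?thesis by (simp only:) (rule left_inverse, simp)
  qed
  finally show ?thesis using L1 LIMSEQ_unique by blast
qed

text \<open>Writing the variable as x - l y with l = t^(1 / (2d)) freezes the kernel at time 1 and
  moves the dilation into G; dominated convergence and mass 1 conclude.\<close>

lemma polyharm_convolution_tendsto:
  fixes G :: "'a::euclidean_space \<Rightarrow> real"
  assumes d: "d \<ge> 1" and G: "continuous_on UNIV G" and b: "\<And>x. \<bar>G x\<bar> \<le> b"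
  shows "((\<lambda>t. \<integral>y. polyharm_kernel d t (x - y) * G y \<partial>lborel) \<longlongrightarrow> G x) (at_right 0)"
proof -
  let ?E = "polyharm_kernel d 1 :: 'a \<Rightarrow> real"
  have iE: "integrable lborel ?E" by (rule integrable_polyharm_kernel[OF d])
  have [measurable]: "?E \<in> borel_measurable borel" using borel_measurable_integrable[OF iE] by simp
  have [measurable]: "G \<in> borel_measurable borel" by (rule borel_measurable_continuous_onI[OF G])
  let ?l = "\<lambda>t::real. t powr (1 / (2 * real d))"
  have eq: "(\<integral>y. polyharm_kernel d t (x - y) * G y \<partial>lborel) = (\<integral>y. ?E y * G (x - ?l t *\<^sub>R y) \<partial>lborel)" if t: "t > 0" for t
  proof -
    have m: "(\<lambda>y. polyharm_kernel d t (x - y)) \<in> borel_measurable borel"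
      unfolding polyharm_kernel_scaling[OF t d] by measurable
    have "(\<integral>y. polyharm_kernel d t (x - y) * G y \<partial>lborel) =
       \<bar>- ?l t\<bar> ^ DIM('a) * (\<integral>y. polyharm_kernel d t (x - (x + (- ?l t) *\<^sub>R y)) * G (x + (- ?l t) *\<^sub>R y) \<partial>lborel)"
      using t m by (intro lborel_integral_affine) auto
    also have "(\<lambda>y. polyharm_kernel d t (x - (x + (- ?l t) *\<^sub>R y)) * G (x + (- ?l t) *\<^sub>R y))
       = (\<lambda>y. t powr (- (real DIM('a) / (2 * real d))) * (?E y * G (x - ?l t *\<^sub>R y)))"
      unfolding polyharm_kernel_scaling[OF t d] using t by (simp add: mult.assoc)
    finally show ?thesis
      using t by (simp add: powr_power powr_minus)
  qed
  show ?thesis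
    unfolding tendsto_at_iff_sequentially
  proof (intro allI impI)
    fix X :: "nat \<Rightarrow> real" assume X: "\<forall>i. X i \<in> {0<..} - {0}" "X \<longlonglongrightarrow> 0"
    have l: "(\<lambda>i. ?l (X i)) \<longlonglongrightarrow> 0"
      by (rule tendsto_zero_powrI[OF X(2) tendsto_const]) (use X(1) d in \<open>auto simp: less_imp_le\<close>)
    have "(\<lambda>i. \<integral>y. ?E y * G (x - ?l (X i) *\<^sub>R y) \<partial>lborel) \<longlonglongrightarrow> (\<integral>y. ?E y * G (x - 0 *\<^sub>R y) \<partial>lborel)"
    proof (rule integral_dominated_convergence[where w = "\<lambda>y. \<bar>?E y\<bar> * b"])
      show "integrable lborel (\<lambda>y. \<bar>?E y\<bar> * b)" using iE by simp
      show "AE y in lborel. (\<lambda>i. ?E y * G (x - ?l (X i) *\<^sub>R y)) \<longlonglongrightarrow> ?E y * G (x - 0 *\<^sub>R y)"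
        by (intro AE_I2 tendsto_mult tendsto_const continuous_on_tendsto_compose[OF G] tendsto_intros l) auto
      show "AE y in lborel. norm (?E y * G (x - ?l (X i) *\<^sub>R y)) \<le> \<bar>?E y\<bar> * b" for i
        using b by (intro AE_I2) (auto simp: abs_mult intro!: mult_left_mono)
    qed auto
    also have "(\<integral>y. ?E y * G (x - 0 *\<^sub>R y) \<partial>lborel) = G x"
      using integral_polyharm_kernel_eq_1[OF d, where 'a='a] by simp
    finally show "((\<lambda>t. \<integral>y. polyharm_kernel d t (x - y) * G y \<partial>lborel) \<circ> X) \<longlonglongrightarrow> G x"
      unfolding o_def using X(1) by (subst eq) auto
  qed
qed

section \<open>Jensen's inequality and convolution with a nonnegative kernel\<close>

text \<open>The tangent of a convex function. The boundary values z = 0 and y = 0 lie outside the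
  open half-line on which convexity is applied and are checked directly.\<close>

lemma powr_above_tangent:
  fixes y z r :: real
  assumes r: "r \<ge> 1" and y: "y \<ge> 0" and z: "z \<ge> 0"
  shows "z powr r + r * z powr (r - 1) * (y - z) \<le> y powr r"
proof (cases "z = 0 \<or> y = 0")
  case True
  have "z powr r \<le> r * (z powr (r - 1) * z)" if "y = 0" "z > 0"
  proof -
    have "z powr (r - 1) * z = z powr r" using that by (simp add: powr_diff)
    then show ?thesis using r mult_right_mono[of 1 r "z powr r"] by simp
  qed
  with True z show ?thesis using r by (cases "z = 0") (auto simp: algebra_simps)
next
  case False
  then have yz: "y > 0" "z > 0" using y z by auto
  have "((\<lambda>x. x powr r) has_real_derivative r * z powr (r - 1)) (at z within {0<..})"
    by (rule has_field_derivative_at_within[OF has_real_derivative_powr[OF yz(2)]])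
  from convex_on_imp_above_tangent[OF powr_convex[OF r] _ _ _ this, of y]
  have "r * z powr (r - 1) * (y - z) \<le> y powr r - z powr r"
    using yz by (simp add: interior_open connected_Ioi)
  then show ?thesis by simp
qed

text \<open>The tangent inequality for c y^2, followed by exp a \<ge> 1 + a at a = c y^2 - c
  z^2.\<close>

lemma exp_square_above_tangent:
  fixes y z c :: real
  assumes c: "c \<ge> 0" and z: "z \<ge> 0"
  shows "exp (c * z\<^sup>2) + 2 * c * z * exp (c * z\<^sup>2) * (y - z) \<le> exp (c * y\<^sup>2)"
proof -
  have "0 \<le> c * (y - z)\<^sup>2" using c by simp
  then have 1: "2 * c * z * (y - z) \<le> c * y\<^sup>2 - c * z\<^sup>2"
    by (simp add: power2_eq_square algebra_simps)
  then have "exp (c * z\<^sup>2) * (1 + 2 * c * z * (y - z)) \<le> exp (c * z\<^sup>2) * exp (c * y\<^sup>2 - c * z\<^sup>2)"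
    using 1 exp_ge_add_one_self[of "c * y\<^sup>2 - c * z\<^sup>2"] by (intro mult_left_mono) (linarith, simp)
  then show ?thesis by (simp add: exp_diff algebra_simps)
qed

text \<open>Integrate the supporting line at the weighted mean. Its slope is nonnegative, so the
  negative term can be moved to the other side and the computation stays in
  \<open>ennreal\<close>.\<close>

lemma nn_integral_Jensen:
  fixes w h :: "'b \<Rightarrow> real" and \<phi> :: "real \<Rightarrow> real"
  assumes [measurable]: "w \<in> borel_measurable M" "h \<in> borel_measurable M" "\<phi> \<in> borel_measurable borel"
    and w: "\<And>x. w x \<ge> 0" and h: "\<And>x. h x \<ge> 0"
    and mass: "(\<integral>\<^sup>+x. ennreal (w x) \<partial>M) = ennreal \<kappa>" and \<kappa>: "\<kappa> > 0"
    and \<phi>0: "\<phi> 0 = 0"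
    and tangent: "\<And>z. z \<ge> 0 \<Longrightarrow> \<exists>c\<ge>0. \<forall>y\<ge>0. \<phi> z + c * (y - z) \<le> \<phi> y"
  shows "ennreal (\<kappa> * \<phi> (enn2real (\<integral>\<^sup>+x. ennreal (w x * h x) \<partial>M) / \<kappa>)) \<le> (\<integral>\<^sup>+x. ennreal (w x * \<phi> (h x)) \<partial>M)"
proof (cases "(\<integral>\<^sup>+x. ennreal (w x * h x) \<partial>M) = \<infinity>")
  \<comment> \<open>\<open>enn2real\<close> of an infinite integral is 0, so the left side is
    \<kappa> * \<phi> 0 = 0.\<close>
  case True
  then show ?thesis by (simp add: \<phi>0)
next
  case False
  define I where "I = enn2real (\<integral>\<^sup>+x. ennreal (w x * h x) \<partial>M)"
  have I: "(\<integral>\<^sup>+x. ennreal (w x * h x) \<partial>M) = ennreal I" and I0: "I \<ge> 0"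
    using False by (auto simp: I_def less_top)
  have \<phi>_nonneg: "\<phi> y \<ge> 0" if "y \<ge> 0" for y
  proof -
    obtain c where "c \<ge> 0" "\<forall>y\<ge>0. \<phi> 0 + c * (y - 0) \<le> \<phi> y" using tangent[of 0] by auto
    with that have "c * y \<le> \<phi> y" by (auto simp: \<phi>0)
    then show ?thesis using \<open>c \<ge> 0\<close> that by (meson mult_nonneg_nonneg order_trans)
  qed
  define z where "z = I / \<kappa>"
  have z: "z \<ge> 0" using I0 \<kappa> by (simp add: z_def)
  obtain c where c: "c \<ge> 0" "\<And>y. y \<ge> 0 \<Longrightarrow> \<phi> z + c * (y - z) \<le> \<phi> y" using tangent[OF z] by auto
  have "ennreal (\<kappa> * \<phi> z) + ennreal (c * I) = (\<integral>\<^sup>+x. ennreal (\<phi> z) * ennreal (w x) + ennreal c * ennreal (w x * h x) \<partial>M)"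
    using \<phi>_nonneg[OF z] c(1) \<kappa> I0
    by (simp add: nn_integral_add nn_integral_cmult mass I) (simp add: ennreal_mult mult.commute)
  also have "\<dots> \<le> (\<integral>\<^sup>+x. ennreal (w x * \<phi> (h x)) + ennreal (c * z) * ennreal (w x) \<partial>M)"
  proof (rule nn_integral_mono)
    fix x
    have "w x * (\<phi> z + c * h x) \<le> w x * (\<phi> (h x) + c * z)"
      using c(2)[OF h[of x]] by (intro mult_left_mono w) (simp add: algebra_simps)
    then show "ennreal (\<phi> z) * ennreal (w x) + ennreal c * ennreal (w x * h x)
        \<le> ennreal (w x * \<phi> (h x)) + ennreal (c * z) * ennreal (w x)"
      using w[of x] h[of x] c(1) z \<phi>_nonneg[OF z] \<phi>_nonneg[OF h[of x]]
      by (simp add: ennreal_mult[symmetric] ennreal_plus[symmetric] algebra_simps del: ennreal_plus)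
  qed
  also have "\<dots> = (\<integral>\<^sup>+x. ennreal (w x * \<phi> (h x)) \<partial>M) + ennreal (c * z) * ennreal \<kappa>"
    by (simp add: nn_integral_add nn_integral_cmult mass)
  also have "ennreal (c * z) * ennreal \<kappa> = ennreal (c * I)"
    using \<kappa> c(1) I0 by (subst ennreal_mult[symmetric]) (auto simp: z_def)
  finally have "ennreal (\<kappa> * \<phi> z) + ennreal (c * I) \<le> (\<integral>\<^sup>+x. ennreal (w x * \<phi> (h x)) \<partial>M) + ennreal (c * I)" .
  then show ?thesis unfolding z_def I_def[symmetric] by (simp add: ennreal_add_left_cancel_le add.commute)
qed

text \<open>Jensen for the r-th power, that is, Hoelder's inequality with weight w.\<close>

lemma nn_integral_weighted_power_mean:
  fixes w h :: "'b \<Rightarrow> real"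
  assumes [measurable]: "w \<in> borel_measurable M" "h \<in> borel_measurable M"
    and w: "\<And>x. w x \<ge> 0" and h: "\<And>x. h x \<ge> 0"
    and mass: "(\<integral>\<^sup>+x. ennreal (w x) \<partial>M) = ennreal \<kappa>" and \<kappa>: "\<kappa> > 0"
    and r: "r \<ge> 1" and B: "(\<integral>\<^sup>+x. ennreal (w x * h x powr r) \<partial>M) \<le> ennreal B" "B \<ge> 0"
  shows "(\<integral>\<^sup>+x. ennreal (w x * h x) \<partial>M) \<le> ennreal ((\<kappa> powr (r - 1) * B) powr (1 / r))"
proof -
  define I where "I = enn2real (\<integral>\<^sup>+x. ennreal (w x * h x) \<partial>M)"
  \<comment> \<open>Finiteness of the mean has to come first: for an infinite mean
    \<open>nn_integral_Jensen\<close> says nothing, because of \<open>enn2real\<close>.\<close>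
  have "h x \<le> 1 + h x powr r" for x
  proof (cases "h x \<le> 1")
    case False
    then have "h x powr 1 \<le> h x powr r" using r by (intro powr_mono) auto
    then show ?thesis using False by simp
  qed (simp add: add_increasing2)
  then have "ennreal (w x * h x) \<le> ennreal (w x) + ennreal (w x * h x powr r)" for x
    using mult_left_mono[OF _ w[of x], of "h x" "1 + h x powr r"] w[of x]
    by (simp add: ennreal_plus[symmetric] algebra_simps del: ennreal_plus)
  then have "(\<integral>\<^sup>+x. ennreal (w x * h x) \<partial>M) \<le> (\<integral>\<^sup>+x. ennreal (w x) + ennreal (w x * h x powr r) \<partial>M)"
    by (intro nn_integral_mono)
  also have "\<dots> \<le> ennreal \<kappa> + ennreal B"
    using B by (simp add: nn_integral_add mass)
  also have "\<dots> < \<infinity>" by simp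
  finally have I: "(\<integral>\<^sup>+x. ennreal (w x * h x) \<partial>M) = ennreal I" and I0: "I \<ge> 0"
    by (auto simp: I_def)
  have "ennreal (\<kappa> * (I / \<kappa>) powr r) \<le> (\<integral>\<^sup>+x. ennreal (w x * h x powr r) \<partial>M)"
    unfolding I_def
  proof (rule nn_integral_Jensen[where \<phi> = "\<lambda>y. y powr r"])
    fix z :: real assume z: "z \<ge> 0"
    show "\<exists>c\<ge>0. \<forall>y\<ge>0. z powr r + c * (y - z) \<le> y powr r"
      using powr_above_tangent[OF r _ z] r by (intro exI[of _ "r * z powr (r - 1)"]) auto
  qed (use assms in auto)
  from order.trans[OF this B(1)] have "ennreal (\<kappa> * (I / \<kappa>) powr r) \<le> ennreal B" .
  then have "\<kappa> * (I / \<kappa>) powr r \<le> B" using B by simp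
  moreover have "\<kappa> * (I / \<kappa>) powr r = I powr r / \<kappa> powr (r - 1)"
    using \<kappa> I0 by (simp add: powr_divide powr_diff)
  ultimately have "I powr r \<le> \<kappa> powr (r - 1) * B"
    using \<kappa> by (simp add: pos_divide_le_eq mult.commute)
  then have "(I powr r) powr (1 / r) \<le> (\<kappa> powr (r - 1) * B) powr (1 / r)"
    using r by (intro powr_mono2) auto
  then show ?thesis using I I0 r by (simp add: powr_powr ennreal_leI)
qed

text \<open>Kernels live on space-time and vanish for nonpositive times, so that the Duhamel term of a source
  supported in positive times is a convolution over all of space-time.\<close>

locale heat_majorant =
  fixes K :: "real \<times> 'a::euclidean_space \<Rightarrow> real" and A kap g :: real
  assumes K_measurable [measurable]: "K \<in> borel_measurable borel"
    and K_nonneg: "K z \<ge> 0"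
    and K_past: "t \<le> 0 \<Longrightarrow> K (t, x) = 0"
    and K_le: "t > 0 \<Longrightarrow> K (t, x) \<le> A * t powr (- g)"
    and K_mass: "t > 0 \<Longrightarrow> (\<integral>\<^sup>+x. ennreal (K (t, x)) \<partial>lborel) = ennreal kap"
    and A_pos: "A > 0" and kap_pos: "kap > 0" and g_pos: "g > 0"
begin

lemma K_shift_measurable [measurable]: "(\<lambda>y. K (t, x - y)) \<in> borel_measurable borel"
  by measurable

lemma K_mass_shift: "t > 0 \<Longrightarrow> (\<integral>\<^sup>+y. ennreal (K (t, x - y)) \<partial>lborel) = ennreal kap"
  using nn_integral_lborel_reflect[of "\<lambda>y. ennreal (K (t, y))" x] by (simp add: K_mass)

text \<open>Smoothing from L^r to the supremum: in the r-th moment the kernel is replaced by its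
  supremum A t^(-g), and the power mean inequality uses its mass kap.\<close>

lemma K_conv_sup:
  assumes t: "t > 0" and h[measurable]: "h \<in> borel_measurable borel" and h0: "\<And>y. h y \<ge> 0"
    and r: "r \<ge> 1" and B: "(\<integral>\<^sup>+y. ennreal (h y powr r) \<partial>lborel) \<le> ennreal B" "B \<ge> 0"
  shows "(\<integral>\<^sup>+y. ennreal (K (t, x - y) * h y) \<partial>lborel)
       \<le> ennreal ((kap powr (r - 1) * A) powr (1 / r) * t powr (- g / r) * B powr (1 / r))"
proof -
  have "(\<integral>\<^sup>+y. ennreal (K (t, x - y) * h y powr r) \<partial>lborel) \<le> (\<integral>\<^sup>+y. ennreal (A * t powr (- g)) * ennreal (h y powr r) \<partial>lborel)"
    by (intro nn_integral_mono) (auto simp: ennreal_mult[symmetric] A_pos less_imp_le K_le t intro!: ennreal_leI mult_right_mono)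
  also have "\<dots> = ennreal (A * t powr (- g)) * (\<integral>\<^sup>+y. ennreal (h y powr r) \<partial>lborel)"
    by (rule nn_integral_cmult) measurable
  also have "\<dots> \<le> ennreal (A * t powr (- g)) * ennreal B"
    by (intro mult_left_mono B) simp
  also have "\<dots> = ennreal (A * t powr (- g) * B)"
    using A_pos B by (simp add: ennreal_mult)
  finally have "(\<integral>\<^sup>+y. ennreal (K (t, x - y) * h y) \<partial>lborel) \<le> ennreal ((kap powr (r - 1) * (A * t powr (- g) * B)) powr (1 / r))"
    by (intro nn_integral_weighted_power_mean) (use A_pos B r kap_pos h0 K_nonneg K_mass_shift[OF t] in auto)
  also have "(kap powr (r - 1) * (A * t powr (- g) * B)) powr (1 / r) = (kap powr (r - 1) * A) powr (1 / r) * t powr (- g / r) * B powr (1 / r)"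
    using A_pos B by (simp add: powr_mult powr_powr)
  finally show ?thesis .
qed

lemma K_conv_mass:
  assumes t: "t > 0" and h[measurable]: "h \<in> borel_measurable borel"
  shows "(\<integral>\<^sup>+x. \<integral>\<^sup>+y. ennreal (K (t, x - y)) * h y \<partial>lborel \<partial>lborel) = ennreal kap * (\<integral>\<^sup>+y. h y \<partial>lborel)"
proof -
  have "(\<integral>\<^sup>+x. \<integral>\<^sup>+y. ennreal (K (t, x - y)) * h y \<partial>lborel \<partial>lborel) = (\<integral>\<^sup>+y. \<integral>\<^sup>+x. ennreal (K (t, x - y)) * h y \<partial>lborel \<partial>lborel)"
    by (rule lborel_pair.Fubini') measurable
  also have "\<dots> = (\<integral>\<^sup>+y. ennreal kap * h y \<partial>lborel)"
    using nn_integral_lborel_shift[of "\<lambda>x. ennreal (K (t, x))"] K_mass[OF t]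
    by (intro nn_integral_cong) (simp add: nn_integral_multc)
  finally show ?thesis by (simp add: nn_integral_cmult)
qed

text \<open>Valued in \<open>ennreal\<close>, so that Tonelli and additivity apply before finiteness
  is known.\<close>

definition duh :: "(real \<times> 'a \<Rightarrow> real) \<Rightarrow> real \<times> 'a \<Rightarrow> ennreal" where
  "duh h z = (\<integral>\<^sup>+w. ennreal (K (z - w) * h w) \<partial>lborel)"

lemma duh_measurable [measurable]:
  assumes [measurable]: "h \<in> borel_measurable borel"
  shows "duh h \<in> borel_measurable borel"
  unfolding duh_def[abs_def] by measurable

lemma duh_iterated:
  assumes [measurable]: "h \<in> borel_measurable borel"
  shows "duh h (t, x) = (\<integral>\<^sup>+s. \<integral>\<^sup>+y. ennreal (K (t - s, x - y) * h (s, y)) \<partial>lborel \<partial>lborel)"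
proof -
  have "(\<lambda>w. ennreal (K ((t, x) - w) * h w)) \<in> borel_measurable (lborel \<Otimes>\<^sub>M lborel)"
    unfolding lborel_prod by measurable
  from lborel.nn_integral_fst[OF this] show ?thesis
    unfolding duh_def lborel_prod by simp
qed

lemma duh_mono: "(\<And>w. h w \<le> h' w) \<Longrightarrow> duh h z \<le> duh h' z"
  unfolding duh_def by (intro nn_integral_mono ennreal_leI mult_left_mono) (auto simp: K_nonneg)

lemma duh_add:
  assumes [measurable]: "h \<in> borel_measurable borel" "h' \<in> borel_measurable borel"
    and "\<And>w. h w \<ge> 0" "\<And>w. h' w \<ge> 0"
  shows "duh (\<lambda>w. h w + h' w) z = duh h z + duh h' z"
  unfolding duh_def
  by (subst nn_integral_add[symmetric]) (auto simp: distrib_left K_nonneg assms)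

lemma duh_L1:
  assumes [measurable]: "h \<in> borel_measurable borel"
    and h0: "\<And>w. h w \<ge> 0"
  shows "(\<integral>\<^sup>+x. duh h (t, x) \<partial>lborel) = (\<integral>\<^sup>+s\<in>{..<t}. (ennreal kap * (\<integral>\<^sup>+y. ennreal (h (s, y)) \<partial>lborel)) \<partial>lborel)"
proof -
  have "(\<integral>\<^sup>+x. duh h (t, x) \<partial>lborel) = (\<integral>\<^sup>+s. \<integral>\<^sup>+x. \<integral>\<^sup>+y. ennreal (K (t - s, x - y) * h (s, y)) \<partial>lborel \<partial>lborel \<partial>lborel)"
    unfolding duh_iterated[OF assms(1)] by (rule lborel_pair.Fubini') measurable
  also have "\<dots> = (\<integral>\<^sup>+s\<in>{..<t}. (ennreal kap * (\<integral>\<^sup>+y. ennreal (h (s, y)) \<partial>lborel)) \<partial>lborel)"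
  proof (rule nn_integral_cong)
    fix s
    show "(\<integral>\<^sup>+x. \<integral>\<^sup>+y. ennreal (K (t - s, x - y) * h (s, y)) \<partial>lborel \<partial>lborel)
        = (ennreal kap * (\<integral>\<^sup>+y. ennreal (h (s, y)) \<partial>lborel)) * indicator {..<t} s"
    proof (cases "s < t")
      case True
      then show ?thesis
        using K_conv_mass[of "t - s" "\<lambda>y. ennreal (h (s, y))"] by (simp add: ennreal_mult K_nonneg h0)
    qed (simp add: K_past)
  qed
  finally show ?thesis .
qed

end

section \<open>Bounds for the Duhamel term\<close>

lemma nn_integral_powr_singular:
  assumes "\<theta> < 1" "t > 0"
  shows "(\<integral>\<^sup>+s\<in>{0<..<t}. ennreal ((t - s) powr (- \<theta>)) \<partial>lborel) = ennreal (t powr (1 - \<theta>) / (1 - \<theta>))"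
proof -
  have "((\<lambda>s. s powr (- \<theta>)) has_integral (t powr (- \<theta> + 1) / (- \<theta> + 1))) {0..t}"
    by (rule has_integral_powr_from_0) (use assms in auto)
  then have "((\<lambda>s. if s \<in> {0..t} then s powr (- \<theta>) else 0) has_integral (t powr (- \<theta> + 1) / (- \<theta> + 1))) UNIV"
    by (simp only: has_integral_restrict_UNIV)
  then have "(\<integral>\<^sup>+s. ennreal (if s \<in> {0..t} then s powr (- \<theta>) else 0) \<partial>lborel) = ennreal (t powr (- \<theta> + 1) / (- \<theta> + 1))"
    by (intro nn_integral_has_integral_lborel) auto
  also have "(\<integral>\<^sup>+s. ennreal (if s \<in> {0..t} then s powr (- \<theta>) else 0) \<partial>lborel)
      = (\<integral>\<^sup>+s. ennreal (if t - s \<in> {0..t} then (t - s) powr (- \<theta>) else 0) \<partial>lborel)"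
    by (rule nn_integral_lborel_reflect[symmetric]) measurable
  also have "\<dots> = (\<integral>\<^sup>+s\<in>{0<..<t}. ennreal ((t - s) powr (- \<theta>)) \<partial>lborel)"
  proof (rule nn_integral_cong_AE)
    have "AE s in lborel. s \<noteq> 0" "AE s in lborel. s \<noteq> t" by (rule AE_lborel_singleton)+
    then show "AE s in lborel. ennreal (if t - s \<in> {0..t} then (t - s) powr (- \<theta>) else 0) = ennreal ((t - s) powr (- \<theta>)) * indicator {0<..<t} s"
      by eventually_elim (auto split: split_indicator)
  qed
  finally show ?thesis by (simp add: add.commute)
qed

lemma nn_integral_powr_shifted_le:
  assumes a: "a > 0" and t: "t \<ge> 0"
  shows "(\<integral>\<^sup>+s\<in>{0..t}. ennreal ((1 + s) powr (a - 1)) \<partial>lborel) \<le> ennreal ((1 + t) powr a / a)"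
proof -
  have "(\<integral>\<^sup>+s. ennreal ((1 + s) powr (a - 1)) * indicator {0..t} s \<partial>lborel) = (1 + t) powr a / a - (1 + 0) powr a / a"
  proof (rule nn_integral_FTC_Icc)
    fix s assume "s \<in> {0..t}"
    then show "((\<lambda>s. (1 + s) powr a / a) has_real_derivative (1 + s) powr (a - 1)) (at s)"
      using a by (auto intro!: derivative_eq_intros)
  qed (use t in auto)
  then show ?thesis using a by (simp add: ennreal_leI)
qed

lemma divide_powr_minus: "(x::real) \<ge> 0 \<Longrightarrow> c > 0 \<Longrightarrow> (x / c) powr (- b) = x powr (- b) * c powr b"
  by (simp add: powr_divide powr_minus field_simps)

context heat_majorant
begin

text \<open>The exponents are those of \<open>F (V + W)\<close>, whose \<open>L\<^sup>r\<close> norm decays with power \<open>g m / 2 - g / r \<ge> 1 + g / 2 - g / r\<close>.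
  The early part of the Duhamel integral needs \<open>r = 1\<close>; the late part needs \<open>r = 2\<close> for the \<open>L\<^sup>2\<close> norm and
  some \<open>r > g\<close> for the supremum, which makes the singularity \<open>(t - s)\<close> to the power \<open>- g / r\<close> integrable.\<close>

definition source :: "real \<Rightarrow> (real \<times> 'a \<Rightarrow> real) \<Rightarrow> bool" where
  "source D h \<longleftrightarrow> h \<in> borel_measurable borel \<and> (\<forall>w. h w \<ge> 0) \<and> (\<forall>s y. s \<le> 0 \<longrightarrow> h (s, y) = 0) \<and>
     (\<forall>r\<in>{1, 2, g + 1}. \<forall>s>0. (\<integral>\<^sup>+y. ennreal (h (s, y) powr r) \<partial>lborel)
         \<le> ennreal ((D * (1 + s) powr (- (1 + g / 2 - g / r))) powr r))"

lemma source_bound: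
  assumes "source D h" "r \<in> {1, 2, g + 1}" "s > 0"
  shows "(\<integral>\<^sup>+y. ennreal (h (s, y) powr r) \<partial>lborel)
         \<le> ennreal ((D * (1 + s) powr (- (1 + g / 2 - g / r))) powr r)"
  using assms unfolding source_def by blast

text \<open>For t > 1 the early part stays at distance at least t / 2 from the singularity of the
  kernel; for t \<le> 1 there is no early part. In both cases a late time s > 0 satisfies 1 + s
  \<ge> (1 + t) / 2, so the decay of the source in s is decay in t.\<close>

definition split_time :: "real \<Rightarrow> real" where
  "split_time t = (if t \<le> 1 then 0 else t / 2)"

definition early :: "real \<Rightarrow> (real \<times> 'a \<Rightarrow> real) \<Rightarrow> real \<times> 'a \<Rightarrow> real" where
  "early t h w = (if fst w \<le> split_time t then h w else 0)"

definition late :: "real \<Rightarrow> (real \<times> 'a \<Rightarrow> real) \<Rightarrow> real \<times> 'a \<Rightarrow> real" where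
  "late t h w = (if fst w \<le> split_time t then 0 else h w)"

lemma early_late_measurable:
  assumes [measurable]: "h \<in> borel_measurable borel"
  shows "early t h \<in> borel_measurable borel" "late t h \<in> borel_measurable borel"
proof -
  have [measurable]: "fst \<in> borel_measurable (borel :: (real \<times> 'a) measure)"
    by (simp add: borel_prod[symmetric])
  show "early t h \<in> borel_measurable borel" "late t h \<in> borel_measurable borel"
    unfolding early_def[abs_def] late_def[abs_def] by measurable
qed

lemma duh_split:
  assumes "source D h"
  shows "duh h z = duh (early t h) z + duh (late t h) z"
proof -
  have "h = (\<lambda>w. early t h w + late t h w)" by (auto simp: early_def late_def)
  then have "duh h z = duh (\<lambda>w. early t h w + late t h w) z" by simp
  also have "\<dots> = duh (early t h) z + duh (late t h) z"
    using assms unfolding source_def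
    by (intro duh_add early_late_measurable) (auto simp: early_def late_def)
  finally show ?thesis .
qed

text \<open>\<open>K_conv_sup\<close> with r = g + 1 leaves the integrable singularity of order g /
  (g + 1) at s = t, whose integral is (g + 1) t^(1 / (g + 1)).\<close>

lemma late_sup:
  assumes h: "source D h" and D: "D \<ge> 0" and t: "t > 0"
  shows "duh (late t h) (t, x) \<le> ennreal ((kap powr g * A) powr (1 / (g + 1)) * 2 powr (1 + g / 2 - g / (g + 1)) * (g + 1)
           * D * min 1 t powr (1 / (g + 1)) * (1 + t) powr (- g / 2))"
proof -
  let ?\<theta> = "g / (g + 1)"
  let ?\<beta> = "1 + g / 2 - ?\<theta>"
  let ?c = "(kap powr g * A) powr (1 / (g + 1))"
  have \<theta>: "0 \<le> ?\<theta>" "?\<theta> < 1" "1 - ?\<theta> = 1 / (g + 1)" using g_pos by (auto simp: field_simps)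
  have \<beta>: "?\<beta> \<ge> 0" "?\<beta> = 1 / (g + 1) + g / 2" using \<theta> g_pos by linarith+
  have hm[measurable]: "h \<in> borel_measurable borel" and h0: "\<And>w. h w \<ge> 0" and hp: "\<And>s y. s \<le> 0 \<Longrightarrow> h (s, y) = 0"
    using h by (auto simp: source_def)
  note [measurable] = early_late_measurable[OF hm]
  let ?M = "?c * (D * ((1 + t) / 2) powr (- ?\<beta>))"
  have M0: "?M \<ge> 0" using D by simp
  have "duh (late t h) (t, x) = (\<integral>\<^sup>+s. \<integral>\<^sup>+y. ennreal (K (t - s, x - y) * late t h (s, y)) \<partial>lborel \<partial>lborel)"
    by (rule duh_iterated) measurable
  also have "\<dots> \<le> (\<integral>\<^sup>+s. ennreal ?M * (ennreal ((t - s) powr (- ?\<theta>)) * indicator {0<..<t} s) \<partial>lborel)"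
  proof (rule nn_integral_mono)
    fix s
    show "(\<integral>\<^sup>+y. ennreal (K (t - s, x - y) * late t h (s, y)) \<partial>lborel) \<le> ennreal ?M * (ennreal ((t - s) powr (- ?\<theta>)) * indicator {0<..<t} s)"
    proof (cases "split_time t < s \<and> s < t")
      case True
      then have s: "0 < s" "s < t" "(1 + t) / 2 \<le> 1 + s"
        using t by (auto simp: split_time_def split: if_splits)
      have "(\<integral>\<^sup>+y. ennreal (K (t - s, x - y) * late t h (s, y)) \<partial>lborel) = (\<integral>\<^sup>+y. ennreal (K (t - s, x - y) * h (s, y)) \<partial>lborel)"
        using True by (simp add: late_def)
      also have "\<dots> \<le> ennreal ((kap powr ((g + 1) - 1) * A) powr (1 / (g + 1)) * (t - s) powr (- g / (g + 1))
            * ((D * (1 + s) powr (- ?\<beta>)) powr (g + 1)) powr (1 / (g + 1)))"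
        using s source_bound[OF h, of "g + 1" s] h0 g_pos by (intro K_conv_sup) auto
      also have "\<dots> = ennreal (?c * (D * (1 + s) powr (- ?\<beta>)) * (t - s) powr (- ?\<theta>))"
        using D g_pos by (simp add: powr_powr mult_ac)
      also have "\<dots> \<le> ennreal (?M * (t - s) powr (- ?\<theta>))"
        using s t D \<beta> by (intro ennreal_leI mult_right_mono mult_left_mono powr_mono2') auto
      finally show ?thesis using s M0 by (simp add: ennreal_mult)
    next
      case False
      then have "K (t - s, x - y) * late t h (s, y) = 0" for y
        by (auto simp: late_def K_past not_less)
      then have "(\<integral>\<^sup>+y. ennreal (K (t - s, x - y) * late t h (s, y)) \<partial>lborel) = (\<integral>\<^sup>+(y::'a). 0 \<partial>lborel)"
        by (intro nn_integral_cong) (metis ennreal_0)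
      then show ?thesis by simp
    qed
  qed
  also have "\<dots> = ennreal ?M * ennreal (t powr (1 - ?\<theta>) / (1 - ?\<theta>))"
    by (subst nn_integral_cmult) (use nn_integral_powr_singular[OF \<theta>(2) t] in auto)
  also have "\<dots> = ennreal (?M * ((g + 1) * t powr (1 / (g + 1))))"
    using M0 g_pos unfolding \<theta>(3) by (subst ennreal_mult[symmetric]) (auto simp: mult.commute)
  \<comment> \<open>The power of t is split by t \<le> min 1 t * (1 + t) into smallness at time 0
    and growth at infinity. The growth is exactly the amount by which the decay of the source
    exceeds g / 2.\<close>
  also have "?M * ((g + 1) * t powr (1 / (g + 1))) \<le> ?M * ((g + 1) * (min 1 t powr (1 / (g + 1)) * (1 + t) powr (1 / (g + 1))))"
  proof -
    have "t \<le> min 1 t * (1 + t)" using t by (auto simp: min_def algebra_simps)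
    then have "t powr (1 / (g + 1)) \<le> (min 1 t * (1 + t)) powr (1 / (g + 1))"
      using t g_pos by (intro powr_mono2) auto
    also have "\<dots> = min 1 t powr (1 / (g + 1)) * (1 + t) powr (1 / (g + 1))"
      using t by (simp add: powr_mult)
    finally show ?thesis using M0 g_pos by (intro mult_left_mono) auto
  qed
  also have "((1 + t) / 2) powr (- ?\<beta>) = (1 + t) powr (- ?\<beta>) * 2 powr ?\<beta>"
    using t by (intro divide_powr_minus) auto
  also have "?c * (D * ((1 + t) powr (- ?\<beta>) * 2 powr ?\<beta>)) * ((g + 1) * (min 1 t powr (1 / (g + 1)) * (1 + t) powr (1 / (g + 1))))
     = ?c * 2 powr ?\<beta> * (g + 1) * D * min 1 t powr (1 / (g + 1)) * ((1 + t) powr (- ?\<beta>) * (1 + t) powr (1 / (g + 1)))"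
    by (simp only: mult_ac)
  also have "(1 + t) powr (- ?\<beta>) * (1 + t) powr (1 / (g + 1)) = (1 + t) powr (- g / 2)"
    unfolding \<beta>(2) using t by (simp add: powr_add[symmetric])
  finally show ?thesis by (simp add: ennreal_leI)
qed

text \<open>Cauchy-Schwarz in space-time with weight K: the square of K * h is at most (K * 1) (K *
  h^2), where K * 1 over times 0 to t is kap t. One more integration in time gives a second factor
  t.\<close>

lemma late_L2:
  assumes h: "source D h" and D: "D \<ge> 0" and t: "t > 0"
  shows "(\<integral>\<^sup>+x. (duh (late t h) (t, x))\<^sup>2 \<partial>lborel) \<le> ennreal ((2 * kap * D * min 1 t)\<^sup>2)"
proof -
  have hm[measurable]: "h \<in> borel_measurable borel" and h0: "\<And>w. h w \<ge> 0" and hp: "\<And>s y. s \<le> 0 \<Longrightarrow> h (s, y) = 0"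
    using h by (auto simp: source_def)
  note [measurable] = early_late_measurable[OF hm]
  have [measurable]: "fst \<in> borel_measurable (borel :: (real \<times> 'a) measure)"
    by (simp add: borel_prod[symmetric])
  \<comment> \<open>The constant 1 cut to positive times, which keeps its Duhamel integral finite;
    nothing is lost since h vanishes for s \<le> 0.\<close>
  define one where "one = (\<lambda>w::real \<times> 'a. if fst w \<le> 0 then 0 else 1 :: real)"
  have [measurable]: "one \<in> borel_measurable borel" unfolding one_def by measurable
  have one0: "one w \<ge> 0" for w by (simp add: one_def)
  let ?h2 = "\<lambda>w. (late t h w)\<^sup>2"
  have l0: "late t h w \<ge> 0" for w by (simp add: late_def h0)
  have one_mass: "duh one (t, x) = ennreal (kap * t)" for x
  proof -
    have "duh one (t, x) = (\<integral>\<^sup>+s. \<integral>\<^sup>+y. ennreal (K (t - s, x - y) * one (s, y)) \<partial>lborel \<partial>lborel)"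
      by (rule duh_iterated) measurable
    also have "\<dots> = (\<integral>\<^sup>+s. ennreal kap * indicator {0<..<t} s \<partial>lborel)"
    proof (rule nn_integral_cong)
      fix s show "(\<integral>\<^sup>+y. ennreal (K (t - s, x - y) * one (s, y)) \<partial>lborel) = ennreal kap * indicator {0<..<t} s"
        using K_mass_shift[of "t - s" x] by (cases "0 < s \<and> s < t") (auto simp: one_def K_past not_less)
    qed
    also have "\<dots> = ennreal (kap * t)" using t kap_pos by (simp add: nn_integral_cmult ennreal_mult)
    finally show ?thesis .
  qed
  have cs: "(duh (late t h) (t, x))\<^sup>2 \<le> ennreal (kap * t) * duh ?h2 (t, x)" for x
  proof -
    have "(\<integral>\<^sup>+w. ennreal (sqrt (K ((t, x) - w) * one w)) * ennreal (sqrt (K ((t, x) - w)) * late t h w) \<partial>lborel)\<^sup>2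
      \<le> (\<integral>\<^sup>+w. (ennreal (sqrt (K ((t, x) - w) * one w)))\<^sup>2 \<partial>lborel) * (\<integral>\<^sup>+w. (ennreal (sqrt (K ((t, x) - w)) * late t h w))\<^sup>2 \<partial>lborel)"
      by (rule Cauchy_Schwarz_nn_integral) measurable
    moreover have "ennreal (sqrt (K ((t, x) - w) * one w)) * ennreal (sqrt (K ((t, x) - w)) * late t h w) = ennreal (K ((t, x) - w) * late t h w)" for w
    proof (cases "fst w \<le> 0")
      case True
      then have "late t h w = 0" using hp[of "fst w" "snd w"] by (simp add: late_def)
      then show ?thesis by simp
    next
      case False
      then show ?thesis using K_nonneg[of "(t, x) - w"] l0[of w]
        by (simp add: one_def ennreal_mult[symmetric] mult.assoc[symmetric])
    qed
    moreover have "(ennreal (sqrt (K ((t, x) - w) * one w)))\<^sup>2 = ennreal (K ((t, x) - w) * one w)" for w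
      using K_nonneg[of "(t, x) - w"] one0[of w] by (simp add: ennreal_power)
    moreover have "(ennreal (sqrt (K ((t, x) - w)) * late t h w))\<^sup>2 = ennreal (K ((t, x) - w) * (late t h w)\<^sup>2)" for w
      using K_nonneg[of "(t, x) - w"] l0[of w] by (simp add: ennreal_power power_mult_distrib)
    ultimately show ?thesis using one_mass[of x] by (simp add: duh_def)
  qed
  have "(\<integral>\<^sup>+x. (duh (late t h) (t, x))\<^sup>2 \<partial>lborel) \<le> (\<integral>\<^sup>+x. ennreal (kap * t) * duh ?h2 (t, x) \<partial>lborel)"
    by (intro nn_integral_mono cs)
  also have "\<dots> = ennreal (kap * t) * (\<integral>\<^sup>+x. duh ?h2 (t, x) \<partial>lborel)"
    by (rule nn_integral_cmult) measurable
  also have "(\<integral>\<^sup>+x. duh ?h2 (t, x) \<partial>lborel) = (\<integral>\<^sup>+s\<in>{..<t}. (ennreal kap * (\<integral>\<^sup>+y. ennreal (?h2 (s, y)) \<partial>lborel)) \<partial>lborel)"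
    by (rule duh_L1) auto
  also have "\<dots> \<le> (\<integral>\<^sup>+s. ennreal (kap * (D * ((1 + t) / 2) powr (- 1))\<^sup>2) * indicator {0<..<t} s \<partial>lborel)"
  proof (rule nn_integral_mono)
    fix s
    show "(ennreal kap * (\<integral>\<^sup>+y. ennreal (?h2 (s, y)) \<partial>lborel)) * indicator {..<t} s \<le> ennreal (kap * (D * ((1 + t) / 2) powr (- 1))\<^sup>2) * indicator {0<..<t} s"
    proof (cases "split_time t < s \<and> s < t")
      case True
      then have s: "0 < s" "s < t" "(1 + t) / 2 \<le> 1 + s"
        using t by (auto simp: split_time_def split: if_splits)
      have "(\<integral>\<^sup>+y. ennreal (?h2 (s, y)) \<partial>lborel) = (\<integral>\<^sup>+y. ennreal (h (s, y) powr 2) \<partial>lborel)"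
        using True h0 by (simp add: late_def)
      also have "\<dots> \<le> ennreal ((D * (1 + s) powr (- (1 + g / 2 - g / 2))) powr 2)"
        by (rule source_bound[OF h]) (use s in auto)
      also have "\<dots> = ennreal ((D * (1 + s) powr (- 1))\<^sup>2)"
        using D by simp
      also have "\<dots> \<le> ennreal ((D * ((1 + t) / 2) powr (- 1))\<^sup>2)"
        using s t D by (intro ennreal_leI power_mono mult_left_mono powr_mono2') auto
      finally have "ennreal kap * (\<integral>\<^sup>+y. ennreal (?h2 (s, y)) \<partial>lborel) \<le> ennreal kap * ennreal ((D * ((1 + t) / 2) powr (- 1))\<^sup>2)"
        by (intro mult_left_mono) auto
      then show ?thesis using s kap_pos by (simp add: ennreal_mult)
    next
      case False
      have "?h2 (s, y) = 0" if "\<not> split_time t < s" for y using that by (simp add: late_def)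
      with False show ?thesis by (cases "s < t") auto
    qed
  qed
  also have "\<dots> = ennreal (kap * (D * ((1 + t) / 2) powr (- 1))\<^sup>2) * ennreal t"
    using t by (simp add: nn_integral_cmult)
  also have "ennreal (kap * t) * (ennreal (kap * (D * ((1 + t) / 2) powr (- 1))\<^sup>2) * ennreal t)
      = ennreal ((2 * kap * D * (t / (1 + t)))\<^sup>2)"
  proof -
    define Y where "Y = (D * ((1 + t) / 2) powr (- 1))\<^sup>2"
    have "Y \<ge> 0" by (simp add: Y_def)
    then have "ennreal (kap * t) * (ennreal (kap * Y) * ennreal t) = ennreal (kap * t * (kap * Y * t))"
      using t kap_pos by (simp add: ennreal_mult)
    also have "kap * t * (kap * Y * t) = (2 * kap * D * (t / (1 + t)))\<^sup>2"
      using t by (simp add: Y_def powr_minus_divide power2_eq_square field_simps)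
    finally show ?thesis by (simp add: Y_def)
  qed
  also have "\<dots> \<le> ennreal ((2 * kap * D * min 1 t)\<^sup>2)"
    using t kap_pos D by (intro ennreal_leI power_mono mult_left_mono) (auto simp: field_simps)
  finally show ?thesis by (simp add: mult_left_mono)
qed

text \<open>The L^1 norm of the source, at most D (1 + s)^(g / 2 - 1), integrates to order (1 +
  t)^(g / 2), and the kernel contributes (1 + t)^(-g) to the supremum. The product of the two bounds
  does not grow in t, which gives the L^2 bound of the early part.\<close>

lemma early_bounds:
  assumes h: "source D h" and D: "D \<ge> 0" and t: "t > 1"
  shows "duh (early t h) (t, x) \<le> ennreal (A * 4 powr g * (2 / g) * D * (1 + t) powr (- g / 2))" (is "?P x")
    and "(\<integral>\<^sup>+x. duh (early t h) (t, x) \<partial>lborel) \<le> ennreal (kap * (2 / g) * D * (1 + t) powr (g / 2))" (is ?Q)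
proof -
  have hm[measurable]: "h \<in> borel_measurable borel" and h0: "\<And>w. h w \<ge> 0" and hp: "\<And>s y. s \<le> 0 \<Longrightarrow> h (s, y) = 0"
    using h by (auto simp: source_def)
  note [measurable] = early_late_measurable[OF hm]
  let ?Q = "(2 / g) * D * (1 + t) powr (g / 2)"
  have e0: "early t h w \<ge> 0" for w by (simp add: early_def h0)
  have L1s: "(\<integral>\<^sup>+y. ennreal (early t h (s, y)) \<partial>lborel) \<le> ennreal D * (ennreal ((1 + s) powr (g / 2 - 1)) * indicator {0..t} s)" for s
  proof (cases "0 < s \<and> s \<le> t / 2")
    case True
    have "(\<integral>\<^sup>+y. ennreal (early t h (s, y)) \<partial>lborel) = (\<integral>\<^sup>+y. ennreal (h (s, y) powr 1) \<partial>lborel)"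
      using True t h0 by (simp add: early_def split_time_def)
    also have "\<dots> \<le> ennreal ((D * (1 + s) powr (- (1 + g / 2 - g / 1))) powr 1)"
      by (rule source_bound[OF h]) (use True in auto)
    finally show ?thesis using True t D by (simp add: ennreal_mult[symmetric])
  next
    case False
    then have "early t h (s, y) = 0" for y
      using t hp[of s y] by (auto simp: early_def split_time_def not_less)
    then show ?thesis by simp
  qed
  have L1: "(\<integral>\<^sup>+s. \<integral>\<^sup>+y. ennreal (early t h (s, y)) \<partial>lborel \<partial>lborel) \<le> ennreal ?Q"
  proof -
    have "(\<integral>\<^sup>+s. \<integral>\<^sup>+y. ennreal (early t h (s, y)) \<partial>lborel \<partial>lborel) \<le> (\<integral>\<^sup>+s. ennreal D * (ennreal ((1 + s) powr (g / 2 - 1)) * indicator {0..t} s) \<partial>lborel)"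
      by (intro nn_integral_mono L1s)
    also have "\<dots> = ennreal D * (\<integral>\<^sup>+s\<in>{0..t}. ennreal ((1 + s) powr (g / 2 - 1)) \<partial>lborel)"
      by (rule nn_integral_cmult) measurable
    also have "\<dots> \<le> ennreal D * ennreal ((1 + t) powr (g / 2) / (g / 2))"
      by (intro mult_left_mono nn_integral_powr_shifted_le) (use g_pos t in auto)
    also have "\<dots> = ennreal ?Q"
      using D g_pos by (subst ennreal_mult[symmetric]) (auto simp: field_simps)
    finally show ?thesis .
  qed
  have Q0: "?Q \<ge> 0" using D g_pos by simp
  show "?P x"
  proof -
    have "duh (early t h) (t, x) = (\<integral>\<^sup>+s. \<integral>\<^sup>+y. ennreal (K (t - s, x - y) * early t h (s, y)) \<partial>lborel \<partial>lborel)"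
      by (rule duh_iterated) measurable
    also have "\<dots> \<le> (\<integral>\<^sup>+s. \<integral>\<^sup>+y. ennreal (A * (t / 2) powr (- g)) * ennreal (early t h (s, y)) \<partial>lborel \<partial>lborel)"
    proof (intro nn_integral_mono)
      fix s y
      show "ennreal (K (t - s, x - y) * early t h (s, y)) \<le> ennreal (A * (t / 2) powr (- g)) * ennreal (early t h (s, y))"
      proof (cases "s \<le> t / 2")
        case True
        have "K (t - s, x - y) \<le> A * (t - s) powr (- g)" using True t by (intro K_le) auto
        also have "\<dots> \<le> A * (t / 2) powr (- g)"
          using True t A_pos g_pos by (intro mult_left_mono powr_mono2') auto
        finally show ?thesis
          using A_pos e0 by (subst ennreal_mult[symmetric]) (auto intro!: ennreal_leI mult_right_mono)
      qed (use t in \<open>simp add: early_def split_time_def\<close>)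
    qed
    also have "\<dots> = ennreal (A * (t / 2) powr (- g)) * (\<integral>\<^sup>+s. \<integral>\<^sup>+y. ennreal (early t h (s, y)) \<partial>lborel \<partial>lborel)"
      by (subst nn_integral_cmult, measurable)+
    \<comment> \<open>t / 2 \<ge> (1 + t) / 4 because t > 1.\<close>
    also have "\<dots> \<le> ennreal (A * ((1 + t) / 4) powr (- g)) * ennreal ?Q"
      using L1 t A_pos g_pos by (intro mult_mono ennreal_leI mult_left_mono powr_mono2') auto
    also have "\<dots> = ennreal (A * ((1 + t) / 4) powr (- g) * ?Q)"
      using A_pos Q0 by (subst ennreal_mult[symmetric]) auto
    also have "((1 + t) / 4) powr (- g) = (1 + t) powr (- g) * 4 powr g"
      using t by (intro divide_powr_minus) auto
    also have "A * ((1 + t) powr (- g) * 4 powr g) * ?Q = A * 4 powr g * (2 / g) * D * ((1 + t) powr (- g) * (1 + t) powr (g / 2))"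
      by (simp only: mult_ac)
    also have "(1 + t) powr (- g) * (1 + t) powr (g / 2) = (1 + t) powr (- g / 2)"
      using t by (simp add: powr_add[symmetric])
    finally show ?thesis .
  qed
  show "(\<integral>\<^sup>+x. duh (early t h) (t, x) \<partial>lborel) \<le> ennreal (kap * (2 / g) * D * (1 + t) powr (g / 2))"
  proof -
    have "(\<integral>\<^sup>+x. duh (early t h) (t, x) \<partial>lborel) = (\<integral>\<^sup>+s\<in>{..<t}. (ennreal kap * (\<integral>\<^sup>+y. ennreal (early t h (s, y)) \<partial>lborel)) \<partial>lborel)"
      by (rule duh_L1) (auto simp: e0)
    also have "\<dots> \<le> (\<integral>\<^sup>+s. ennreal kap * (\<integral>\<^sup>+y. ennreal (early t h (s, y)) \<partial>lborel) \<partial>lborel)"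
      by (intro nn_integral_mono) (auto split: split_indicator)
    also have "\<dots> = ennreal kap * (\<integral>\<^sup>+s. \<integral>\<^sup>+y. ennreal (early t h (s, y)) \<partial>lborel \<partial>lborel)"
      by (rule nn_integral_cmult) measurable
    also have "\<dots> \<le> ennreal kap * ennreal ?Q" by (intro mult_left_mono L1) simp
    also have "\<dots> = ennreal (kap * ?Q)" using Q0 kap_pos by (subst ennreal_mult) auto
    finally show ?thesis by (simp add: mult.assoc)
  qed
qed

lemma ennreal_square_add_le: "(a + b)\<^sup>2 \<le> 2 * a\<^sup>2 + 2 * (b::ennreal)\<^sup>2"
proof (cases "a = \<infinity> \<or> b = \<infinity>")
  case True
  then show ?thesis by (auto simp: power2_eq_square ennreal_mult_top)
next
  case False
  then obtain x y where xy: "a = ennreal x" "x \<ge> 0" "b = ennreal y" "y \<ge> 0"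
    by (cases a; cases b) auto
  have "(x + y)\<^sup>2 \<le> 2 * x\<^sup>2 + 2 * y\<^sup>2" using sum_squares_bound[of x y] by (simp add: power2_sum)
  then show ?thesis
    using xy by (simp add: ennreal_power ennreal_plus[symmetric] ennreal_mult[symmetric] ennreal_numeral[symmetric] del: ennreal_plus ennreal_numeral)
qed

lemma duh_bounds:
  obtains C where "C > 0"
    "\<And>D h t x. source D h \<Longrightarrow> D \<ge> 0 \<Longrightarrow> t > 0 \<Longrightarrow>
       duh h (t, x) \<le> ennreal (C * D * min 1 t powr (1 / (g + 1)) * (1 + t) powr (- g / 2))"
    "\<And>D h t. source D h \<Longrightarrow> D \<ge> 0 \<Longrightarrow> t > 0 \<Longrightarrow>
       (\<integral>\<^sup>+x. (duh h (t, x))\<^sup>2 \<partial>lborel) \<le> ennreal ((C * D * min 1 t)\<^sup>2)"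
proof -
  define c1 where "c1 = (kap powr g * A) powr (1 / (g + 1)) * 2 powr (1 + g / 2 - g / (g + 1)) * (g + 1)"
  define c2 where "c2 = A * 4 powr g * (2 / g)"
  define c3 where "c3 = kap * (2 / g)"
  \<comment> \<open>The 1 ensures C \<le> C^2, so that one constant serves linearly in the sup bound
    and quadratically in the L^2 bound.\<close>
  define C where "C = 1 + c1 + c2 + 2 * (c2 * c3) + 2 * (2 * kap)\<^sup>2"
  have pos: "c1 \<ge> 0" "c2 \<ge> 0" "c3 \<ge> 0" using A_pos kap_pos g_pos by (auto simp: c1_def c2_def c3_def)
  have C: "C \<ge> c1 + c2" "C \<ge> 2 * (c2 * c3) + 2 * (2 * kap)\<^sup>2" "C \<ge> 1"
    using pos by (auto simp: C_def add_nonneg_nonneg)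
  have "1 * C \<le> C * C" using C(3) by (intro mult_right_mono) auto
  then have C2: "2 * (c2 * c3) + 2 * (2 * kap)\<^sup>2 \<le> C\<^sup>2" using C(2) by (simp add: power2_eq_square)
  have early0: "duh (early t h) (t, x) = 0" if "source D h" "t \<le> 1" for D h t x
  proof -
    have "early t h w = 0" for w
      using that by (cases w) (auto simp: early_def split_time_def source_def)
    then show ?thesis by (simp add: duh_def)
  qed
  show ?thesis
  proof
    show "C > 0" using C by simp
    fix D h and t :: real and x assume h: "source D h" and D: "D \<ge> 0" and t: "t > 0"
    let ?X = "D * min 1 t powr (1 / (g + 1)) * (1 + t) powr (- g / 2)"
    have e: "duh (early t h) (t, x) \<le> ennreal (c2 * ?X)"
    proof (cases "t \<le> 1")
      case False
      then show ?thesis using early_bounds(1)[OF h D, of t x] by (simp add: c2_def mult.assoc)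
    qed (simp add: early0[OF h])
    have "duh h (t, x) \<le> ennreal (c2 * ?X) + ennreal (c1 * ?X)"
      unfolding duh_split[OF h, of _ t]
      using e late_sup[OF h D t, of x] by (intro add_mono) (auto simp: c1_def mult.assoc)
    also have "\<dots> = ennreal ((c1 + c2) * ?X)"
      using pos D by (subst ennreal_plus[symmetric]) (auto simp: algebra_simps)
    also have "\<dots> \<le> ennreal (C * ?X)"
      using C D by (intro ennreal_leI mult_right_mono) auto
    finally show "duh h (t, x) \<le> ennreal (C * D * min 1 t powr (1 / (g + 1)) * (1 + t) powr (- g / 2))"
      by (simp add: mult.assoc)
  next
    fix D h and t :: real assume h: "source D h" and D: "D \<ge> 0" and t: "t > 0"
    have hm: "h \<in> borel_measurable borel" using h by (simp add: source_def)
    note [measurable] = hm early_late_measurable[OF hm]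
    have e: "(\<integral>\<^sup>+x. (duh (early t h) (t, x))\<^sup>2 \<partial>lborel) \<le> ennreal ((c2 * c3) * (D * min 1 t)\<^sup>2)"
    proof (cases "t \<le> 1")
      case False
      let ?S = "A * 4 powr g * (2 / g) * D * (1 + t) powr (- g / 2)"
      have S0: "?S \<ge> 0" using A_pos g_pos D by simp
      have "(\<integral>\<^sup>+x. (duh (early t h) (t, x))\<^sup>2 \<partial>lborel) \<le> (\<integral>\<^sup>+x. ennreal ?S * duh (early t h) (t, x) \<partial>lborel)"
        unfolding power2_eq_square using early_bounds(1)[OF h D, of t] False
        by (intro nn_integral_mono mult_right_mono) auto
      also have "\<dots> = ennreal ?S * (\<integral>\<^sup>+x. duh (early t h) (t, x) \<partial>lborel)"
        by (rule nn_integral_cmult) measurable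
      also have "\<dots> \<le> ennreal ?S * ennreal (kap * (2 / g) * D * (1 + t) powr (g / 2))"
        using early_bounds(2)[OF h D, of t] False by (intro mult_left_mono) auto
      also have "\<dots> = ennreal (?S * (kap * (2 / g) * D * (1 + t) powr (g / 2)))"
        using S0 kap_pos g_pos D by (subst ennreal_mult) auto
      also have "?S * (kap * (2 / g) * D * (1 + t) powr (g / 2)) = c2 * c3 * (D * D) * ((1 + t) powr (- g / 2) * (1 + t) powr (g / 2))"
        unfolding c2_def c3_def by (simp only: mult_ac)
      also have "(1 + t) powr (- g / 2) * (1 + t) powr (g / 2) = 1"
        using t by (simp add: powr_add[symmetric])
      finally show ?thesis using False by (simp add: power2_eq_square)
    qed (simp add: early0[OF h])
    have "(\<integral>\<^sup>+x. (duh h (t, x))\<^sup>2 \<partial>lborel) \<le> (\<integral>\<^sup>+x. 2 * (duh (early t h) (t, x))\<^sup>2 + 2 * (duh (late t h) (t, x))\<^sup>2 \<partial>lborel)"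
      unfolding duh_split[OF h, of _ t] by (intro nn_integral_mono ennreal_square_add_le)
    also have "\<dots> = 2 * (\<integral>\<^sup>+x. (duh (early t h) (t, x))\<^sup>2 \<partial>lborel) + 2 * (\<integral>\<^sup>+x. (duh (late t h) (t, x))\<^sup>2 \<partial>lborel)"
      by (simp add: nn_integral_add nn_integral_cmult)
    also have "\<dots> \<le> 2 * ennreal ((c2 * c3) * (D * min 1 t)\<^sup>2) + 2 * ennreal ((2 * kap * D * min 1 t)\<^sup>2)"
      by (intro add_mono mult_left_mono e late_L2[OF h D t]) auto
    also have "\<dots> = ennreal ((2 * (c2 * c3) + 2 * (2 * kap)\<^sup>2) * (D * min 1 t)\<^sup>2)"
      using pos by (simp add: ennreal_plus[symmetric] ennreal_mult[symmetric] ennreal_numeral[symmetric] algebra_simps power_mult_distrib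
        del: ennreal_plus ennreal_numeral)
    also have "\<dots> \<le> ennreal (C\<^sup>2 * (D * min 1 t)\<^sup>2)"
      by (intro ennreal_leI mult_right_mono C2) auto
    finally show "(\<integral>\<^sup>+x. (duh h (t, x))\<^sup>2 \<partial>lborel) \<le> ennreal ((C * D * min 1 t)\<^sup>2)"
      by (simp add: power_mult_distrib mult.assoc)
  qed
qed

end

section \<open>Exponential moments\<close>

text \<open>Two bounds share the exponential: z^a is at most a constant times exp (z / 4), and z exp
  (z / 2) \<le> exp z - 1. The factor z makes the left side vanish at 0 like the right side.\<close>

lemma powr_exp_le_expm1:
  assumes a: "(a::real) \<ge> 0"
  obtains C where "C > 0" "\<And>z. z \<ge> 0 \<Longrightarrow> z powr a * (z * exp (z / 4)) \<le> C * (exp z - 1)"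
proof -
  obtain n :: nat where n: "a \<le> real n" "n \<ge> 1"
    using real_arch_simple[of "max a 1"] by force
  have "z powr a * (z * exp (z / 4)) \<le> (4 * real n) ^ n * (exp z - 1)" if z: "z \<ge> 0" for z
  proof -
    have "z powr a \<le> (1 + z) powr a" using z a by (intro powr_mono2) auto
    also have "\<dots> \<le> (1 + z) powr real n" using z n by (intro powr_mono) auto
    also have "\<dots> = (1 + z) ^ n" using z by (simp add: powr_realpow)
    also have "\<dots> \<le> (4 * real n * exp (z / (4 * real n))) ^ n"
    proof (rule power_mono)
      have "1 + z \<le> 4 * real n * (1 + z / (4 * real n))" using n z by (simp add: field_simps)
      also have "\<dots> \<le> 4 * real n * exp (z / (4 * real n))" by (intro mult_left_mono exp_ge_add_one_self) auto
      finally show "1 + z \<le> 4 * real n * exp (z / (4 * real n))" .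
    qed (use z in auto)
    also have "\<dots> = (4 * real n) ^ n * exp (z / 4)"
      using n by (simp add: power_mult_distrib exp_of_nat_mult[symmetric])
    finally have 1: "z powr a \<le> (4 * real n) ^ n * exp (z / 4)" .
    \<comment> \<open>This is z / 2 \<le> sinh (z / 2); the derivative of the difference is
      controlled by cosh \<ge> 1.\<close>
    have "z \<le> exp (z / 2) - exp (- z / 2)"
    proof -
      have "((\<lambda>z. exp (z / 2) - exp (- z / 2) - z) 0) \<le> ((\<lambda>z. exp (z / 2) - exp (- z / 2) - z) z)"
      proof (rule DERIV_nonneg_imp_nondecreasing[OF z])
        fix x :: real
        have "1 * 2 \<le> exp (x / 2) + exp (- x / 2)"
          using cosh_real_ge_1[of "x / 2"] by (simp add: cosh_field_def)
        then show "\<exists>y. ((\<lambda>z. exp (z / 2) - exp (- z / 2) - z) has_real_derivative y) (at x) \<and> 0 \<le> y"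
          by (intro exI[of _ "exp (x / 2) / 2 + exp (- x / 2) / 2 - 1"]) (auto intro!: derivative_eq_intros)
      qed
      then show ?thesis by simp
    qed
    then have "z * exp (z / 2) \<le> (exp (z / 2) - exp (- z / 2)) * exp (z / 2)" by (intro mult_right_mono) auto
    also have "\<dots> = exp z - 1" by (simp add: left_diff_distrib exp_add[symmetric])
    finally have 2: "z * exp (z / 2) \<le> exp z - 1" .
    have "z powr a * (z * exp (z / 4)) \<le> ((4 * real n) ^ n * exp (z / 4)) * (z * exp (z / 4))"
      using z by (intro mult_right_mono 1) auto
    also have "\<dots> = (4 * real n) ^ n * (z * exp (z / 2))" by (simp add: exp_add[symmetric])
    also have "\<dots> \<le> (4 * real n) ^ n * (exp z - 1)" by (intro mult_left_mono 2) auto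
    finally show ?thesis .
  qed
  moreover have "(4 * real n) ^ n > 0" using n by simp
  ultimately show ?thesis using that by blast
qed

lemma powr_split_square: "q \<ge> 2 \<Longrightarrow> (v::real) \<ge> 0 \<Longrightarrow> v powr q = v powr (q - 2) * v\<^sup>2"
  by (cases "v = 0") (simp_all add: powr_diff)

lemma powr_as_square: "\<rho> > 0 \<Longrightarrow> v \<ge> 0 \<Longrightarrow> (v::real) powr (q - 2) = \<rho> powr (q - 2) * ((v / \<rho>)\<^sup>2) powr (q / 2 - 1)"
proof -
  assume a: "\<rho> > 0" "v \<ge> 0"
  have "((v / \<rho>)\<^sup>2) powr (q / 2 - 1) = (v / \<rho>) powr (q - 2)"
  proof -
    have "(v / \<rho>)\<^sup>2 = (v / \<rho>) powr 2" using a by simp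
    then have "((v / \<rho>)\<^sup>2) powr (q / 2 - 1) = (v / \<rho>) powr (2 * (q / 2 - 1))"
      by (simp only: powr_powr)
    then show ?thesis by (simp add: right_diff_distrib)
  qed
  then show ?thesis using a by (simp add: powr_divide)
qed

text \<open>v + w is at most twice the larger summand, whence the factor 4 in the exponents.\<close>

lemma powr_exp_add_le:
  fixes v w :: real
  assumes "v \<ge> 0" "w \<ge> 0" "q \<ge> 0" "\<mu> \<ge> 0"
  shows "(v + w) powr q * exp (\<mu> * (v + w)\<^sup>2) \<le> 2 powr q * (v powr q * exp (4 * \<mu> * v\<^sup>2)) + 2 powr q * (w powr q * exp (4 * \<mu> * w\<^sup>2))"
proof -
  have *: "(v + w) powr q * exp (\<mu> * (v + w)\<^sup>2) \<le> 2 powr q * (b powr q * exp (4 * \<mu> * b\<^sup>2))" if "v \<le> b" "w \<le> b" for b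
  proof -
    have "(v + w) powr q \<le> (2 * b) powr q" using that assms by (intro powr_mono2) auto
    moreover have "(v + w)\<^sup>2 \<le> (2 * b)\<^sup>2" using that assms by (intro power_mono) auto
    then have "\<mu> * (v + w)\<^sup>2 \<le> \<mu> * (2 * b)\<^sup>2" using assms by (intro mult_left_mono) auto
    ultimately have "(v + w) powr q * exp (\<mu> * (v + w)\<^sup>2) \<le> (2 * b) powr q * exp (\<mu> * (2 * b)\<^sup>2)"
      by (intro mult_mono) auto
    also have "\<dots> = 2 powr q * (b powr q * exp (4 * \<mu> * b\<^sup>2))"
      using that assms by (simp add: powr_mult power_mult_distrib mult_ac)
    finally show ?thesis .
  qed
  show ?thesis
    using *[of v] *[of w] by (cases "w \<le> v") (auto intro: add_increasing add_increasing2)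
qed

text \<open>For \<open>s \<le> 1\<close> the supremum bound on \<open>v\<close> is useless and only its exponential moment enters;
  for \<open>s \<ge> 1\<close> the factor \<open>v\<close> to the power \<open>q - 2\<close> supplies the decay.\<close>

lemma exponential_moment:
  fixes q g B :: real
  assumes q: "q \<ge> 2" and g: "g > 0" and B: "B > 0"
  obtains C where "C > 0"
    "\<And>\<rho> \<mu> s (v :: 'a::euclidean_space \<Rightarrow> real) w. \<lbrakk>\<rho> > 0; \<mu> \<ge> 0; 16 * \<mu> * \<rho>\<^sup>2 \<le> 1; s > 0;
        v \<in> borel_measurable borel; w \<in> borel_measurable borel; \<And>x. v x \<ge> 0; \<And>x. w x \<ge> 0;
        \<And>x. w x \<le> \<rho> * (1 + s) powr (- g / 2);
        (\<integral>\<^sup>+x. ennreal ((w x)\<^sup>2) \<partial>lborel) \<le> ennreal (\<rho>\<^sup>2);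
        \<And>x. v x \<le> B * \<rho> * s powr (- g / 2);
        (\<integral>\<^sup>+x. ennreal (exp ((v x / \<rho>)\<^sup>2) - 1) \<partial>lborel) \<le> 1\<rbrakk> \<Longrightarrow>
      (\<integral>\<^sup>+x. ennreal ((v x + w x) powr q * exp (\<mu> * (v x + w x)\<^sup>2)) \<partial>lborel)
        \<le> ennreal (C * \<rho> powr q * (1 + s) powr (- (g * (q / 2 - 1))))"
proof -
  define a where "a = q / 2 - 1"
  have a: "a \<ge> 0" "q - 2 = 2 * a" using q by (auto simp: a_def)
  obtain Ca where Ca: "Ca > 0" "\<And>z. z \<ge> 0 \<Longrightarrow> z powr a * (z * exp (z / 4)) \<le> Ca * (exp z - 1)"
    using powr_exp_le_expm1[OF a(1)] by blast
  obtain C1 where C1: "C1 > 0" "\<And>z::real. z \<ge> 0 \<Longrightarrow> z powr 0 * (z * exp (z / 4)) \<le> C1 * (exp z - 1)"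
    by (rule powr_exp_le_expm1[OF order_refl]) blast
  have C1': "z * exp (z / 4) \<le> C1 * (exp z - 1)" if "z \<ge> 0" for z :: real
    using C1(2)[OF that] that by (cases "z = 0") auto
  \<comment> \<open>The two summands serve s \<le> 1 and s \<ge> 1; the factor 2^(g a) pays for
    writing the decay in terms of 1 + s.\<close>
  define Cv where "Cv = 2 powr (g * a) * (Ca + B powr (2 * a) * C1)"
  have Cv: "Cv > 0" using Ca C1 B by (auto simp: Cv_def intro!: mult_pos_pos add_pos_nonneg)
  define C where "C = 2 powr q * (exp 1 + Cv)"
  show ?thesis
  proof
    show "C > 0" using Cv by (simp add: C_def add_pos_pos)
    fix \<rho> \<mu> s :: real and v w :: "'a \<Rightarrow> real"
    assume \<rho>: "\<rho> > 0" and \<mu>: "\<mu> \<ge> 0" "16 * \<mu> * \<rho>\<^sup>2 \<le> 1" and s: "s > 0"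
      and [measurable]: "v \<in> borel_measurable borel" "w \<in> borel_measurable borel"
      and v0: "\<And>x. v x \<ge> 0" and w0: "\<And>x. w x \<ge> 0"
      and wle: "\<And>x. w x \<le> \<rho> * (1 + s) powr (- g / 2)"
      and w2: "(\<integral>\<^sup>+x. ennreal ((w x)\<^sup>2) \<partial>lborel) \<le> ennreal (\<rho>\<^sup>2)"
      and vle: "\<And>x. v x \<le> B * \<rho> * s powr (- g / 2)"
      and vexp: "(\<integral>\<^sup>+x. ennreal (exp ((v x / \<rho>)\<^sup>2) - 1) \<partial>lborel) \<le> 1"
    let ?P = "\<rho> powr (2 * a) * (1 + s) powr (- (g * a))"
    \<comment> \<open>Of the power q of w, the sup bound takes q - 2, which carries the decay, and
      the L^2 norm the remaining 2.\<close>
    have W: "w x powr q * exp (4 * \<mu> * (w x)\<^sup>2) \<le> ?P * (exp 1 * (w x)\<^sup>2)" for x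
    proof -
      have "w x powr (2 * a) \<le> (\<rho> * (1 + s) powr (- g / 2)) powr (2 * a)"
        using a w0 wle by (intro powr_mono2) auto
      also have "\<dots> = ?P" using \<rho> s by (simp add: powr_mult powr_powr)
      finally have 1: "w x powr (2 * a) \<le> ?P" .
      have "(1 + s) powr (- g / 2) \<le> 1"
        using s g by (simp add: powr_minus divide_inverse[symmetric] ge_one_powr_ge_zero field_simps)
      then have "w x \<le> \<rho>" using wle[of x] \<rho> mult_left_le[of "(1 + s) powr (- g / 2)" \<rho>] by linarith
      then have "(w x)\<^sup>2 \<le> \<rho>\<^sup>2" using w0 by (intro power_mono) auto
      then have "\<mu> * (w x)\<^sup>2 \<le> \<mu> * \<rho>\<^sup>2" using \<mu> by (intro mult_left_mono) auto
      then have 2: "exp (4 * \<mu> * (w x)\<^sup>2) \<le> exp 1" using \<mu> by simp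
      have "w x powr q * exp (4 * \<mu> * (w x)\<^sup>2) = w x powr (2 * a) * (exp (4 * \<mu> * (w x)\<^sup>2) * (w x)\<^sup>2)"
        using powr_split_square[OF q w0[of x]] a by simp
      also have "\<dots> \<le> ?P * (exp 1 * (w x)\<^sup>2)"
        using \<rho> by (intro mult_mono mult_right_mono 1 2) auto
      finally show ?thesis .
    qed
    have V: "v x powr q * exp (4 * \<mu> * (v x)\<^sup>2) \<le> ?P * (Cv * \<rho>\<^sup>2 * (exp ((v x / \<rho>)\<^sup>2) - 1))" for x
    proof -
      let ?z = "(v x / \<rho>)\<^sup>2"
      have z0: "?z \<ge> 0" by simp
      have vz: "(v x)\<^sup>2 = \<rho>\<^sup>2 * ?z" using \<rho> by (simp add: power_divide)
      \<comment> \<open>Smallness of \<mu> \<rho>^2 reduces the exponent to a quarter of (v /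
        \<rho>)^2, which \<open>powr_exp_le_expm1\<close> can absorb together with the power of
        v.\<close>
      have "4 * \<mu> * (v x)\<^sup>2 = (16 * \<mu> * \<rho>\<^sup>2) * (?z / 4)" unfolding vz by simp
      also have "\<dots> \<le> 1 * (?z / 4)" using \<mu> by (intro mult_right_mono) auto
      finally have e: "exp (4 * \<mu> * (v x)\<^sup>2) \<le> exp (?z / 4)" by simp
      have eq: "v x powr q * exp (4 * \<mu> * (v x)\<^sup>2) = v x powr (2 * a) * (\<rho>\<^sup>2 * (?z * exp (4 * \<mu> * (v x)\<^sup>2)))"
        using powr_split_square[OF q v0[of x]] a vz by (simp add: mult_ac)
      also have "\<dots> \<le> v x powr (2 * a) * (\<rho>\<^sup>2 * (?z * exp (?z / 4)))"
        using e by (intro mult_left_mono) auto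
      also have "\<dots> \<le> ?P * (Cv * \<rho>\<^sup>2 * (exp ?z - 1))"
      proof (cases "s \<le> 1")
        case True
        have va: "v x powr (2 * a) = \<rho> powr (2 * a) * ?z powr a"
          using powr_as_square[OF \<rho> v0[of x], of q] by (simp add: a)  (simp add: a_def)
        have "1 \<le> 2 powr (g * a) * (1 + s) powr (- (g * a))"
        proof -
          have "(1 + s) powr (g * a) \<le> 2 powr (g * a)" using True s g a by (intro powr_mono2) auto
          then show ?thesis using s by (simp add: powr_minus field_simps)
        qed
        then have Ca': "Ca \<le> (1 + s) powr (- (g * a)) * Cv"
        proof -
          have "Ca * 1 \<le> Ca * (2 powr (g * a) * (1 + s) powr (- (g * a)))"
            using \<open>1 \<le> _\<close> Ca by (intro mult_left_mono) auto
          also have "\<dots> = (1 + s) powr (- (g * a)) * (2 powr (g * a) * Ca)" by simp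
          also have "\<dots> \<le> (1 + s) powr (- (g * a)) * Cv"
            unfolding Cv_def using C1 B by (intro mult_left_mono) auto
          finally show ?thesis by simp
        qed
        have "v x powr (2 * a) * (\<rho>\<^sup>2 * (?z * exp (?z / 4))) = (\<rho> powr (2 * a) * \<rho>\<^sup>2) * (?z powr a * (?z * exp (?z / 4)))"
          unfolding va by (simp only: mult_ac)
        also have "\<dots> \<le> (\<rho> powr (2 * a) * \<rho>\<^sup>2) * (Ca * (exp ?z - 1))"
          using Ca(2)[OF z0] by (intro mult_left_mono) auto
        also have "\<dots> \<le> (\<rho> powr (2 * a) * \<rho>\<^sup>2) * (((1 + s) powr (- (g * a)) * Cv) * (exp ?z - 1))"
          using Ca' by (intro mult_left_mono mult_right_mono) auto
        finally show ?thesis by (simp only: mult_ac)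
      next
        case False
        have "v x powr (2 * a) \<le> (B * \<rho> * s powr (- g / 2)) powr (2 * a)"
          using a v0 vle by (intro powr_mono2) auto
        also have "\<dots> = B powr (2 * a) * \<rho> powr (2 * a) * s powr (- (g * a))"
          using \<rho> s B by (simp add: powr_mult powr_powr)
        also have "\<dots> \<le> B powr (2 * a) * \<rho> powr (2 * a) * ((1 + s) / 2) powr (- (g * a))"
          using False g a by (intro mult_left_mono powr_mono2') auto
        also have "((1 + s) / 2) powr (- (g * a)) = (1 + s) powr (- (g * a)) * 2 powr (g * a)"
          using s by (intro divide_powr_minus) auto
        finally have va: "v x powr (2 * a) \<le> B powr (2 * a) * \<rho> powr (2 * a) * ((1 + s) powr (- (g * a)) * 2 powr (g * a))" .
        have "v x powr (2 * a) * (\<rho>\<^sup>2 * (?z * exp (?z / 4))) \<le>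
          (B powr (2 * a) * \<rho> powr (2 * a) * ((1 + s) powr (- (g * a)) * 2 powr (g * a))) * (\<rho>\<^sup>2 * (C1 * (exp ?z - 1)))"
          by (rule mult_mono[OF va mult_left_mono[OF C1'[OF z0]]]) (use B in auto)
        also have "\<dots> = ?P * (2 powr (g * a) * (B powr (2 * a) * C1)) * \<rho>\<^sup>2 * (exp ?z - 1)"
          by (simp only: mult_ac)
        also have "\<dots> \<le> ?P * Cv * \<rho>\<^sup>2 * (exp ?z - 1)"
          unfolding Cv_def using Ca by (intro mult_right_mono mult_left_mono) auto
        finally show ?thesis by (simp only: mult_ac)
      qed
      finally show ?thesis .
    qed
    have "(\<integral>\<^sup>+x. ennreal ((v x + w x) powr q * exp (\<mu> * (v x + w x)\<^sup>2)) \<partial>lborel)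
       \<le> (\<integral>\<^sup>+x. ennreal (2 powr q * ?P * exp 1) * ennreal ((w x)\<^sup>2) + ennreal (2 powr q * ?P * Cv * \<rho>\<^sup>2) * ennreal (exp ((v x / \<rho>)\<^sup>2) - 1) \<partial>lborel)"
    proof (rule nn_integral_mono)
      fix x
      have "(v x + w x) powr q * exp (\<mu> * (v x + w x)\<^sup>2) \<le> 2 powr q * (v x powr q * exp (4 * \<mu> * (v x)\<^sup>2)) + 2 powr q * (w x powr q * exp (4 * \<mu> * (w x)\<^sup>2))"
        by (rule powr_exp_add_le) (use v0 w0 q \<mu> in auto)
      also have "\<dots> \<le> 2 powr q * (?P * (Cv * \<rho>\<^sup>2 * (exp ((v x / \<rho>)\<^sup>2) - 1))) + 2 powr q * (?P * (exp 1 * (w x)\<^sup>2))"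
        by (intro add_mono mult_left_mono V W) auto
      finally have "ennreal ((v x + w x) powr q * exp (\<mu> * (v x + w x)\<^sup>2))
         \<le> ennreal (2 powr q * ?P * exp 1 * (w x)\<^sup>2 + 2 powr q * ?P * Cv * \<rho>\<^sup>2 * (exp ((v x / \<rho>)\<^sup>2) - 1))"
        by (intro ennreal_leI) (simp only: mult_ac add.commute)
      also have "\<dots> = ennreal (2 powr q * ?P * exp 1) * ennreal ((w x)\<^sup>2) + ennreal (2 powr q * ?P * Cv * \<rho>\<^sup>2) * ennreal (exp ((v x / \<rho>)\<^sup>2) - 1)"
        using Cv by (subst ennreal_plus) (auto simp: ennreal_mult)
      finally show "ennreal ((v x + w x) powr q * exp (\<mu> * (v x + w x)\<^sup>2)) \<le> \<dots>" .
    qed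
    also have "\<dots> = ennreal (2 powr q * ?P * exp 1) * (\<integral>\<^sup>+x. ennreal ((w x)\<^sup>2) \<partial>lborel)
        + ennreal (2 powr q * ?P * Cv * \<rho>\<^sup>2) * (\<integral>\<^sup>+x. ennreal (exp ((v x / \<rho>)\<^sup>2) - 1) \<partial>lborel)"
      by (subst nn_integral_add) (auto simp: nn_integral_cmult)
    also have "\<dots> \<le> ennreal (2 powr q * ?P * exp 1) * ennreal (\<rho>\<^sup>2) + ennreal (2 powr q * ?P * Cv * \<rho>\<^sup>2) * ennreal 1"
      using vexp by (intro add_mono mult_left_mono w2) auto
    also have "\<dots> = ennreal (2 powr q * ?P * exp 1 * \<rho>\<^sup>2 + 2 powr q * ?P * Cv * \<rho>\<^sup>2)"
      using Cv by (subst ennreal_plus) (auto simp: ennreal_mult)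
    also have "2 powr q * ?P * exp 1 * \<rho>\<^sup>2 + 2 powr q * ?P * Cv * \<rho>\<^sup>2 = C * (\<rho> powr (q - 2) * \<rho>\<^sup>2) * (1 + s) powr (- (g * a))"
      unfolding C_def a(2) by (simp only: distrib_left distrib_right mult_ac)
    also have "\<rho> powr (q - 2) * \<rho>\<^sup>2 = \<rho> powr q"
      using powr_split_square[OF q, of \<rho>] \<rho> by simp
    finally show "(\<integral>\<^sup>+x. ennreal ((v x + w x) powr q * exp (\<mu> * (v x + w x)\<^sup>2)) \<partial>lborel)
        \<le> ennreal (C * \<rho> powr q * (1 + s) powr (- (g * (q / 2 - 1))))"
      by (simp add: a_def)
  qed
qed

section \<open>The majorant iteration\<close>

locale majorant_problem = heat_majorant K A kap g
  for K :: "real \<times> 'a::euclidean_space \<Rightarrow> real" and A kap g :: real +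
  fixes m C0 lam :: real
  assumes m_ge: "m \<ge> 2" and g_m: "g * (m - 1) \<ge> 2" and C0_pos: "C0 > 0" and lam_pos: "lam > 0"
begin

text \<open>r times the growth factor r^(m - 1) exp (lam r^2). The 2 arises because both terms of
  the growth condition are bounded by the one at the larger argument.\<close>

definition F :: "real \<Rightarrow> real" where
  "F r = 2 * C0 * (r powr m * exp (lam * r\<^sup>2))"

lemma F_measurable [measurable]: "F \<in> borel_measurable borel"
  unfolding F_def[abs_def] by measurable

lemma F_nonneg: "F r \<ge> 0"
  using C0_pos by (simp add: F_def)

lemma F_mono: "0 \<le> a \<Longrightarrow> a \<le> b \<Longrightarrow> F a \<le> F b"
  unfolding F_def using C0_pos m_ge lam_pos
  by (intro mult_left_mono mult_mono powr_mono2) (auto intro!: mult_left_mono power_mono)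

text \<open>The modular of u0 at scale \<rho> / kap is at most 1. Dividing by the kernel mass makes
  \<rho> itself the scale of \<open>heatV u0\<close>.\<close>

definition small_data :: "real \<Rightarrow> ('a \<Rightarrow> real) \<Rightarrow> bool" where
  "small_data \<rho> u0 \<longleftrightarrow> u0 \<in> borel_measurable borel \<and>
     (\<integral>\<^sup>+x. ennreal (exp ((kap * u0 x / \<rho>)\<^sup>2) - 1) \<partial>lborel) \<le> 1"

definition heatV :: "('a \<Rightarrow> real) \<Rightarrow> real \<times> 'a \<Rightarrow> real" where
  "heatV u0 z = enn2real (\<integral>\<^sup>+y. ennreal (K (fst z, snd z - y) * \<bar>u0 y\<bar>) \<partial>lborel)"

lemma heatV_nonneg: "heatV u0 z \<ge> 0"
  by (simp add: heatV_def)

lemma heatV_measurable [measurable]: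
  assumes [measurable]: "u0 \<in> borel_measurable borel"
  shows "heatV u0 \<in> borel_measurable borel"
proof -
  have [measurable]: "fst \<in> borel_measurable (borel :: (real \<times> 'a) measure)"
    "snd \<in> borel_measurable (borel :: (real \<times> 'a) measure)"
    by (simp_all add: borel_prod[symmetric])
  show ?thesis unfolding heatV_def[abs_def] by measurable
qed

text \<open>exp L^2 embeds into L^q for q \<ge> 2. With q = g (m - 1) this yields the decay rate of
  the supremum of the solution.\<close>

lemma small_data_moment:
  assumes q: "q \<ge> 2" and \<rho>: "\<rho> > 0" and u0: "small_data \<rho> u0"
  obtains B where "B \<ge> 0" "(\<integral>\<^sup>+y. ennreal (\<bar>u0 y\<bar> powr q) \<partial>lborel) \<le> ennreal B"
proof -
  have [measurable]: "u0 \<in> borel_measurable borel" using u0 by (simp add: small_data_def)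
  obtain C where C: "C > 0" "\<And>z. z \<ge> 0 \<Longrightarrow> z powr (q / 2 - 1) * (z * exp (z / 4)) \<le> C * (exp z - 1)"
    using powr_exp_le_expm1[of "q / 2 - 1"] q by auto
  define k where "k = \<rho> / kap"
  have k: "k > 0" using \<rho> kap_pos by (simp add: k_def)
  have le: "\<bar>u0 y\<bar> powr q \<le> (k powr (q - 2) * k\<^sup>2 * C) * (exp ((kap * u0 y / \<rho>)\<^sup>2) - 1)" for y
  proof -
    let ?z = "(\<bar>u0 y\<bar> / k)\<^sup>2"
    have z: "?z = (kap * u0 y / \<rho>)\<^sup>2" using kap_pos \<rho> by (simp add: k_def power_divide power_mult_distrib)
    have "\<bar>u0 y\<bar> powr q = (k powr (q - 2) * ?z powr (q / 2 - 1)) * (k\<^sup>2 * ?z)"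
      unfolding powr_split_square[OF q abs_ge_zero] powr_as_square[OF k abs_ge_zero]
      using k by (simp add: power_divide)
    also have "\<dots> = (k powr (q - 2) * k\<^sup>2) * (?z powr (q / 2 - 1) * (?z * 1))" by simp
    also have "\<dots> \<le> (k powr (q - 2) * k\<^sup>2) * (?z powr (q / 2 - 1) * (?z * exp (?z / 4)))"
      by (intro mult_left_mono) auto
    also have "\<dots> \<le> (k powr (q - 2) * k\<^sup>2) * (C * (exp ?z - 1))"
      by (intro mult_left_mono C) auto
    finally show ?thesis unfolding z by (simp add: mult.assoc)
  qed
  have "(\<integral>\<^sup>+y. ennreal (\<bar>u0 y\<bar> powr q) \<partial>lborel) \<le> (\<integral>\<^sup>+y. ennreal (k powr (q - 2) * k\<^sup>2 * C) * ennreal (exp ((kap * u0 y / \<rho>)\<^sup>2) - 1) \<partial>lborel)"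
    using C(1) le by (intro nn_integral_mono) (subst ennreal_mult[symmetric], auto intro!: ennreal_leI)
  also have "\<dots> = ennreal (k powr (q - 2) * k\<^sup>2 * C) * (\<integral>\<^sup>+y. ennreal (exp ((kap * u0 y / \<rho>)\<^sup>2) - 1) \<partial>lborel)"
    by (rule nn_integral_cmult) measurable
  also have "\<dots> \<le> ennreal (k powr (q - 2) * k\<^sup>2 * C) * 1"
    using u0 by (intro mult_left_mono) (auto simp: small_data_def)
  finally show ?thesis
    using C(1) by (intro that[of "k powr (q - 2) * k\<^sup>2 * C"]) auto
qed

lemma heatV_conv_bound:
  assumes q: "q \<ge> 2" and u0: "u0 \<in> borel_measurable borel"
    and B: "B \<ge> 0" "(\<integral>\<^sup>+y. ennreal (\<bar>u0 y\<bar> powr q) \<partial>lborel) \<le> ennreal B" and t: "t > 0"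
  shows "(\<integral>\<^sup>+y. ennreal (K (t, x - y) * \<bar>u0 y\<bar>) \<partial>lborel) = ennreal (heatV u0 (t, x))"
    "heatV u0 (t, x) \<le> (kap powr (q - 1) * A) powr (1 / q) * t powr (- g / q) * B powr (1 / q)"
proof -
  have le: "(\<integral>\<^sup>+y. ennreal (K (t, x - y) * \<bar>u0 y\<bar>) \<partial>lborel) \<le> ennreal ((kap powr (q - 1) * A) powr (1 / q) * t powr (- g / q) * B powr (1 / q))"
    using q u0 B by (intro K_conv_sup[OF t]) auto
  then show eq: "(\<integral>\<^sup>+y. ennreal (K (t, x - y) * \<bar>u0 y\<bar>) \<partial>lborel) = ennreal (heatV u0 (t, x))"
    unfolding heatV_def using le_less_trans[OF le ennreal_less_top] by (auto simp: less_top[symmetric])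
  show "heatV u0 (t, x) \<le> (kap powr (q - 1) * A) powr (1 / q) * t powr (- g / q) * B powr (1 / q)"
    using le unfolding eq by (subst (asm) ennreal_le_iff) auto
qed

lemma small_data_L2:
  assumes \<rho>: "\<rho> > 0" and u0: "small_data \<rho> u0"
  shows "(\<integral>\<^sup>+y. ennreal (\<bar>u0 y\<bar> powr 2) \<partial>lborel) \<le> ennreal ((\<rho> / kap)\<^sup>2)"
proof -
  have [measurable]: "u0 \<in> borel_measurable borel" using u0 by (simp add: small_data_def)
  have "\<bar>u0 y\<bar> powr 2 \<le> (\<rho> / kap)\<^sup>2 * (exp ((kap * u0 y / \<rho>)\<^sup>2) - 1)" for y
  proof -
    have "\<bar>u0 y\<bar> powr 2 = (\<rho> / kap)\<^sup>2 * (kap * u0 y / \<rho>)\<^sup>2"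
      using \<rho> kap_pos by (simp add: power_divide power_mult_distrib)
    also have "\<dots> \<le> (\<rho> / kap)\<^sup>2 * (exp ((kap * u0 y / \<rho>)\<^sup>2) - 1)"
      using exp_ge_add_one_self[of "(kap * u0 y / \<rho>)\<^sup>2"] by (intro mult_left_mono) (linarith, simp)
    finally show ?thesis .
  qed
  then have "(\<integral>\<^sup>+y. ennreal (\<bar>u0 y\<bar> powr 2) \<partial>lborel) \<le> (\<integral>\<^sup>+y. ennreal ((\<rho> / kap)\<^sup>2) * ennreal (exp ((kap * u0 y / \<rho>)\<^sup>2) - 1) \<partial>lborel)"
    by (intro nn_integral_mono) (subst ennreal_mult[symmetric], auto intro!: ennreal_leI)
  also have "\<dots> = ennreal ((\<rho> / kap)\<^sup>2) * (\<integral>\<^sup>+y. ennreal (exp ((kap * u0 y / \<rho>)\<^sup>2) - 1) \<partial>lborel)"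
    by (rule nn_integral_cmult) measurable
  also have "\<dots> \<le> ennreal ((\<rho> / kap)\<^sup>2) * 1"
    using u0 by (intro mult_left_mono) (auto simp: small_data_def)
  finally show ?thesis by simp
qed

definition B0 :: real where "B0 = (kap * A) powr (1 / 2) / kap"

lemma B0_pos: "B0 > 0"
  using A_pos kap_pos by (simp add: B0_def)

lemma heatV_eq_nn:
  assumes \<rho>: "\<rho> > 0" and u0: "small_data \<rho> u0" and t: "t > 0"
  shows "(\<integral>\<^sup>+y. ennreal (K (t, x - y) * \<bar>u0 y\<bar>) \<partial>lborel) = ennreal (heatV u0 (t, x))"
  using u0 by (intro heatV_conv_bound(1)[OF _ _ _ small_data_L2[OF \<rho> u0] t]) (auto simp: small_data_def)

lemma heatV_sup:
  assumes \<rho>: "\<rho> > 0" and u0: "small_data \<rho> u0" and t: "t > 0"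
  shows "heatV u0 (t, x) \<le> B0 * \<rho> * t powr (- g / 2)"
proof -
  have "heatV u0 (t, x) \<le> (kap powr (2 - 1) * A) powr (1 / 2) * t powr (- g / 2) * ((\<rho> / kap)\<^sup>2) powr (1 / 2)"
    using u0 by (intro heatV_conv_bound(2)[OF _ _ _ small_data_L2[OF \<rho> u0] t]) (auto simp: small_data_def)
  also have "((\<rho> / kap)\<^sup>2) powr (1 / 2) = \<rho> / kap"
    using \<rho> kap_pos by (simp add: powr_half_sqrt)
  finally show ?thesis using kap_pos by (simp add: B0_def mult_ac)
qed

text \<open>Jensen for the density K / kap and the function exp (c y^2) - 1, then Tonelli in x. The
  factor kap in \<open>small_data\<close> makes the bound again 1.\<close>

lemma heatV_exp:
  assumes \<rho>: "\<rho> > 0" and u0: "small_data \<rho> u0" and t: "t > 0"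
  shows "(\<integral>\<^sup>+x. ennreal (exp ((heatV u0 (t, x) / \<rho>)\<^sup>2) - 1) \<partial>lborel) \<le> 1"
proof -
  have um[measurable]: "u0 \<in> borel_measurable borel" using u0 by (simp add: small_data_def)
  define c where "c = (kap / \<rho>)\<^sup>2"
  have c: "c \<ge> 0" by (simp add: c_def)
  define \<phi> where "\<phi> y = exp (c * y\<^sup>2) - 1" for y :: real
  have [measurable]: "\<phi> \<in> borel_measurable borel" unfolding \<phi>_def[abs_def] by measurable
  have \<phi>0: "\<phi> y \<ge> 0" for y using c by (simp add: \<phi>_def)
  have \<phi>V: "\<phi> (heatV u0 (t, x) / kap) = exp ((heatV u0 (t, x) / \<rho>)\<^sup>2) - 1" for x
    using kap_pos by (simp add: \<phi>_def c_def power_divide)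
  have \<phi>u: "\<phi> \<bar>u0 y\<bar> = exp ((kap * u0 y / \<rho>)\<^sup>2) - 1" for y
    by (simp add: \<phi>_def c_def power_divide power_mult_distrib)
  have J: "ennreal kap * ennreal (\<phi> (heatV u0 (t, x) / kap)) \<le> (\<integral>\<^sup>+y. ennreal (K (t, x - y)) * ennreal (\<phi> \<bar>u0 y\<bar>) \<partial>lborel)" for x
  proof -
    have "ennreal (kap * \<phi> (enn2real (\<integral>\<^sup>+y. ennreal (K (t, x - y) * \<bar>u0 y\<bar>) \<partial>lborel) / kap)) \<le> (\<integral>\<^sup>+y. ennreal (K (t, x - y) * \<phi> \<bar>u0 y\<bar>) \<partial>lborel)"
    proof (rule nn_integral_Jensen[OF _ _ _ _ _ K_mass_shift[OF t] kap_pos])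
      fix z :: real assume z: "z \<ge> 0"
      show "\<exists>a\<ge>0. \<forall>y\<ge>0. \<phi> z + a * (y - z) \<le> \<phi> y"
      proof (intro exI[of _ "2 * c * z * exp (c * z\<^sup>2)"] conjI allI impI)
        fix y :: real
        show "\<phi> z + 2 * c * z * exp (c * z\<^sup>2) * (y - z) \<le> \<phi> y"
          using exp_square_above_tangent[OF c z, of y] by (simp add: \<phi>_def)
      qed (use c z in auto)
    qed (auto simp: K_nonneg \<phi>_def)
    then show ?thesis using kap_pos \<phi>0 K_nonneg by (simp add: heatV_def ennreal_mult)
  qed
  have m1[measurable]: "(\<lambda>x. heatV u0 (t, x)) \<in> borel_measurable borel" by measurable
  have "ennreal kap * (\<integral>\<^sup>+x. ennreal (\<phi> (heatV u0 (t, x) / kap)) \<partial>lborel) = (\<integral>\<^sup>+x. ennreal kap * ennreal (\<phi> (heatV u0 (t, x) / kap)) \<partial>lborel)"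
    by (rule nn_integral_cmult[symmetric]) measurable
  also have "\<dots> \<le> (\<integral>\<^sup>+x. \<integral>\<^sup>+y. ennreal (K (t, x - y)) * ennreal (\<phi> \<bar>u0 y\<bar>) \<partial>lborel \<partial>lborel)"
    by (intro nn_integral_mono J)
  also have "\<dots> = ennreal kap * (\<integral>\<^sup>+y. ennreal (\<phi> \<bar>u0 y\<bar>) \<partial>lborel)"
    by (rule K_conv_mass[OF t]) measurable
  also have "\<dots> \<le> ennreal kap * 1"
    unfolding \<phi>u using u0 by (intro mult_left_mono) (auto simp: small_data_def)
  finally show ?thesis
    unfolding \<phi>V using kap_pos by (subst (asm) ennreal_mult_le_mult_iff) auto
qed

text \<open>The factors \<open>min 1 t\<close> are only needed for the behaviour at time 0.\<close>

definition admissible :: "real \<Rightarrow> (real \<times> 'a \<Rightarrow> real) \<Rightarrow> bool" where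
  "admissible \<rho> W \<longleftrightarrow> W \<in> borel_measurable borel \<and> (\<forall>z. W z \<ge> 0) \<and> (\<forall>t x. t \<le> 0 \<longrightarrow> W (t, x) = 0) \<and>
     (\<forall>t>0. \<forall>x. W (t, x) \<le> \<rho> * min 1 t powr (1 / (g + 1)) * (1 + t) powr (- g / 2)) \<and>
     (\<forall>t>0. (\<integral>\<^sup>+x. ennreal ((W (t, x))\<^sup>2) \<partial>lborel) \<le> ennreal ((\<rho> * min 1 t)\<^sup>2))"

lemma admissible_sup: "\<rho> \<ge> 0 \<Longrightarrow> admissible \<rho> W \<Longrightarrow> t > 0 \<Longrightarrow> W (t, x) \<le> \<rho> * (1 + t) powr (- g / 2)"
proof -
  assume a: "\<rho> \<ge> 0" "admissible \<rho> W" "t > 0"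
  have "min 1 t powr (1 / (g + 1)) \<le> 1 powr (1 / (g + 1))"
    using a g_pos by (intro powr_mono2) auto
  then have "\<rho> * min 1 t powr (1 / (g + 1)) * (1 + t) powr (- g / 2) \<le> \<rho> * 1 * (1 + t) powr (- g / 2)"
    using a by (intro mult_right_mono mult_left_mono) auto
  moreover have "W (t, x) \<le> \<rho> * min 1 t powr (1 / (g + 1)) * (1 + t) powr (- g / 2)"
    using a unfolding admissible_def by blast
  ultimately show ?thesis by simp
qed

lemma admissible_L2: "\<rho> \<ge> 0 \<Longrightarrow> admissible \<rho> W \<Longrightarrow> t > 0 \<Longrightarrow> (\<integral>\<^sup>+x. ennreal ((W (t, x))\<^sup>2) \<partial>lborel) \<le> ennreal (\<rho>\<^sup>2)"
proof -
  assume a: "\<rho> \<ge> 0" "admissible \<rho> W" "t > 0"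
  have "(\<rho> * min 1 t)\<^sup>2 \<le> \<rho>\<^sup>2" using a by (intro power_mono mult_left_le) auto
  with a show ?thesis unfolding admissible_def by (meson ennreal_leI order_trans)
qed

definition src :: "('a \<Rightarrow> real) \<Rightarrow> (real \<times> 'a \<Rightarrow> real) \<Rightarrow> real \<times> 'a \<Rightarrow> real" where
  "src u0 W w = (if fst w > 0 then F (heatV u0 w + W w) else 0)"

lemma src_measurable [measurable]:
  assumes [measurable]: "u0 \<in> borel_measurable borel" "W \<in> borel_measurable borel"
  shows "src u0 W \<in> borel_measurable borel"
proof -
  have [measurable]: "fst \<in> borel_measurable (borel :: (real \<times> 'a) measure)"
    by (simp add: borel_prod[symmetric])
  show ?thesis unfolding src_def[abs_def] by measurable
qed

lemma src_nonneg: "src u0 W w \<ge> 0"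
  by (simp add: src_def F_nonneg)

text \<open>The parameter \<mu> has two uses: \<mu> = r lam for the r-th powers of the source, and
  \<mu> = 0 for the L^q norms of the solution.\<close>

lemma total_moment:
  assumes q: "q \<ge> 2"
  obtains C where "C > 0"
    "\<And>\<rho> \<mu> t u0 W. \<lbrakk>\<rho> > 0; \<mu> \<ge> 0; 16 * \<mu> * \<rho>\<^sup>2 \<le> 1; t > 0; small_data \<rho> u0; admissible \<rho> W\<rbrakk> \<Longrightarrow>
      (\<integral>\<^sup>+x. ennreal ((heatV u0 (t, x) + W (t, x)) powr q * exp (\<mu> * (heatV u0 (t, x) + W (t, x))\<^sup>2)) \<partial>lborel)
        \<le> ennreal (C * \<rho> powr q * (1 + t) powr (- (g * (q / 2 - 1))))"
proof -
  obtain C where C: "C > 0" and H: "\<And>\<rho> \<mu> s (v :: 'a \<Rightarrow> real) w. \<lbrakk>\<rho> > 0; \<mu> \<ge> 0; 16 * \<mu> * \<rho>\<^sup>2 \<le> 1; s > 0;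
        v \<in> borel_measurable borel; w \<in> borel_measurable borel; \<And>x. v x \<ge> 0; \<And>x. w x \<ge> 0;
        \<And>x. w x \<le> \<rho> * (1 + s) powr (- g / 2);
        (\<integral>\<^sup>+x. ennreal ((w x)\<^sup>2) \<partial>lborel) \<le> ennreal (\<rho>\<^sup>2);
        \<And>x. v x \<le> B0 * \<rho> * s powr (- g / 2);
        (\<integral>\<^sup>+x. ennreal (exp ((v x / \<rho>)\<^sup>2) - 1) \<partial>lborel) \<le> 1\<rbrakk> \<Longrightarrow>
      (\<integral>\<^sup>+x. ennreal ((v x + w x) powr q * exp (\<mu> * (v x + w x)\<^sup>2)) \<partial>lborel)
        \<le> ennreal (C * \<rho> powr q * (1 + s) powr (- (g * (q / 2 - 1))))"
    using exponential_moment[OF q g_pos B0_pos, where 'a='a] by blast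
  show ?thesis
  proof (rule that[OF C])
    fix \<rho> \<mu> t :: real and u0 W assume a: "\<rho> > 0" "\<mu> \<ge> 0" "16 * \<mu> * \<rho>\<^sup>2 \<le> 1" "t > 0" "small_data \<rho> u0" "admissible \<rho> W"
    have [measurable]: "u0 \<in> borel_measurable borel" "W \<in> borel_measurable borel"
      using a by (auto simp: small_data_def admissible_def)
    show "(\<integral>\<^sup>+x. ennreal ((heatV u0 (t, x) + W (t, x)) powr q * exp (\<mu> * (heatV u0 (t, x) + W (t, x))\<^sup>2)) \<partial>lborel)
        \<le> ennreal (C * \<rho> powr q * (1 + t) powr (- (g * (q / 2 - 1))))"
    proof (rule H[OF a(1-4)])
      show "(\<integral>\<^sup>+x. ennreal (exp ((heatV u0 (t, x) / \<rho>)\<^sup>2) - 1) \<partial>lborel) \<le> 1" by (rule heatV_exp[OF a(1,5,4)])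
      show "heatV u0 (t, x) \<le> B0 * \<rho> * t powr (- g / 2)" for x by (rule heatV_sup[OF a(1,5,4)])
      show "W (t, x) \<le> \<rho> * (1 + t) powr (- g / 2)" for x using a by (intro admissible_sup) auto
      show "(\<integral>\<^sup>+x. ennreal ((W (t, x))\<^sup>2) \<partial>lborel) \<le> ennreal (\<rho>\<^sup>2)" using a by (intro admissible_L2) auto
      show "W (t, x) \<ge> 0" for x using a(6) by (auto simp: admissible_def)
    qed (auto simp: heatV_nonneg)
  qed
qed

text \<open>The r-th power of F U is a constant times U^(r m) exp (r lam U^2), so
  \<open>total_moment\<close> applies with q = r m. As g + 2 exceeds all three exponents r, one
  smallness condition on \<rho> covers them.\<close>

lemma src_source:
  obtains C where "C > 0"
    "\<And>\<rho> u0 W. \<lbrakk>\<rho> > 0; 16 * ((g + 2) * lam) * \<rho>\<^sup>2 \<le> 1; small_data \<rho> u0; admissible \<rho> W\<rbrakk> \<Longrightarrow>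
       source (C * \<rho> powr m) (src u0 W)"
proof -
  have rm: "r * m \<ge> 2" "r \<ge> 1" "r \<le> g + 2" if "r \<in> {1, 2, g + 1}" for r
  proof -
    show r: "r \<ge> 1" "r \<le> g + 2" using that g_pos by auto
    show "r * m \<ge> 2" using mult_mono[OF r(1) m_ge] r m_ge by auto
  qed
  define moment_bound where "moment_bound r C \<longleftrightarrow> C > 0 \<and> (\<forall>\<rho> \<mu> t u0 W. \<rho> > 0 \<longrightarrow> \<mu> \<ge> 0 \<longrightarrow> 16 * \<mu> * \<rho>\<^sup>2 \<le> 1 \<longrightarrow> t > 0 \<longrightarrow>
      small_data \<rho> u0 \<longrightarrow> admissible \<rho> W \<longrightarrow>
      (\<integral>\<^sup>+x. ennreal ((heatV u0 (t, x) + W (t, x)) powr (r * m) * exp (\<mu> * (heatV u0 (t, x) + W (t, x))\<^sup>2)) \<partial>lborel)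
        \<le> ennreal (C * \<rho> powr (r * m) * (1 + t) powr (- (g * (r * m / 2 - 1)))))" for r C
  have "\<exists>C. moment_bound r C" if "r \<in> {1, 2, g + 1}" for r
    unfolding moment_bound_def by (rule total_moment[OF rm(1)[OF that]]) blast
  then obtain Cr where Cr': "\<forall>r\<in>{1, 2, g + 1}. moment_bound r (Cr r)"
    using bchoice[of "{1, 2, g + 1}" moment_bound] by blast
  then have Cr: "Cr r > 0" if "r \<in> {1, 2, g + 1}" for r
    using that unfolding moment_bound_def by blast
  have H: "(\<integral>\<^sup>+x. ennreal ((heatV u0 (t, x) + W (t, x)) powr (r * m) * exp (\<mu> * (heatV u0 (t, x) + W (t, x))\<^sup>2)) \<partial>lborel)
        \<le> ennreal (Cr r * \<rho> powr (r * m) * (1 + t) powr (- (g * (r * m / 2 - 1))))"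
    if "r \<in> {1, 2, g + 1}" "\<rho> > 0" "\<mu> \<ge> 0" "16 * \<mu> * \<rho>\<^sup>2 \<le> 1" "t > 0" "small_data \<rho> u0" "admissible \<rho> W" for r \<rho> \<mu> t u0 W
    using bspec[OF Cr' that(1)] that(2-) unfolding moment_bound_def by blast
  \<comment> \<open>The sum dominates the constant for each of the three exponents.\<close>
  define S where "S = (\<Sum>r\<in>{1, 2, g + 1}. Cr r powr (1 / r))"
  have S: "Cr r powr (1 / r) \<le> S" if "r \<in> {1, 2, g + 1}" for r
    unfolding S_def by (rule member_le_sum) (use that in auto)
  have S0: "S > 0" using S[of 1] Cr[of 1] by simp
  show ?thesis
  proof
    show "2 * C0 * S > 0" using S0 C0_pos by simp
    fix \<rho> :: real and u0 W assume \<rho>: "\<rho> > 0" "16 * ((g + 2) * lam) * \<rho>\<^sup>2 \<le> 1" and u0: "small_data \<rho> u0" and W: "admissible \<rho> W"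
    have [measurable]: "u0 \<in> borel_measurable borel" "W \<in> borel_measurable borel"
      using u0 W by (auto simp: small_data_def admissible_def)
    show "source (2 * C0 * S * \<rho> powr m) (src u0 W)"
      unfolding source_def
    proof (intro conjI allI impI ballI)
      fix r s :: real assume r: "r \<in> {1, 2, g + 1}" and s: "s > 0"
      note rr = rm[OF r]
      let ?U = "\<lambda>y. heatV u0 (s, y) + W (s, y)"
      have src: "src u0 W (s, y) powr r = (2 * C0) powr r * (?U y powr (r * m) * exp ((r * lam) * (?U y)\<^sup>2))" for y
        using s C0_pos by (simp add: src_def F_def powr_mult powr_powr exp_powr_real mult_ac)
      have \<mu>: "16 * (r * lam) * \<rho>\<^sup>2 \<le> 1"
      proof -
        have "16 * (r * lam) * \<rho>\<^sup>2 \<le> 16 * ((g + 2) * lam) * \<rho>\<^sup>2"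
          using rr lam_pos by (intro mult_right_mono mult_left_mono) auto
        with \<rho> show ?thesis by linarith
      qed
      have "(\<integral>\<^sup>+y. ennreal (src u0 W (s, y) powr r) \<partial>lborel) = ennreal ((2 * C0) powr r) * (\<integral>\<^sup>+y. ennreal (?U y powr (r * m) * exp ((r * lam) * (?U y)\<^sup>2)) \<partial>lborel)"
        unfolding src by (simp add: ennreal_mult nn_integral_cmult)
      also have "\<dots> \<le> ennreal ((2 * C0) powr r) * ennreal (Cr r * \<rho> powr (r * m) * (1 + s) powr (- (g * (r * m / 2 - 1))))"
        using H[OF r \<rho>(1) _ \<mu> s u0 W] rr lam_pos by (intro mult_left_mono) auto
      also have "\<dots> = ennreal ((2 * C0) powr r * (Cr r * \<rho> powr (r * m) * (1 + s) powr (- (g * (r * m / 2 - 1)))))"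
        using Cr[OF r] by (subst ennreal_mult) auto
      also have "\<dots> \<le> ennreal ((2 * C0 * S * \<rho> powr m * (1 + s) powr (- (1 + g / 2 - g / r))) powr r)"
      proof (rule ennreal_leI)
        have "Cr r = (Cr r powr (1 / r)) powr r" using Cr[OF r] rr by (simp add: powr_powr)
        also have "\<dots> \<le> S powr r" using S[OF r] rr by (intro powr_mono2) auto
        finally have 1: "Cr r \<le> S powr r" .
        \<comment> \<open>The hypothesis g (m - 1) \<ge> 2, read as g m / 2 \<ge> 1 + g / 2, makes
          the moments decay at least as fast as \<open>source\<close> demands.\<close>
        have "r * (1 + g / 2 - g / r) = r * (1 + g / 2) - g" using rr by (simp add: right_diff_distrib)
        also have "\<dots> \<le> r * (g * m / 2) - g"
          using g_m rr by (intro diff_right_mono mult_left_mono) (auto simp: algebra_simps)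
        also have "\<dots> = g * (r * m / 2 - 1)" by (simp add: algebra_simps)
        finally have "- (g * (r * m / 2 - 1)) \<le> - (r * (1 + g / 2 - g / r))"
          by (simp only: neg_le_iff_le)
        also have "\<dots> = - (1 + g / 2 - g / r) * r"
          by (simp only: mult_minus_left mult.commute)
        finally have "(1 + s) powr (- (g * (r * m / 2 - 1))) \<le> (1 + s) powr (- (1 + g / 2 - g / r) * r)"
          using s by (intro powr_mono) auto
        then have "(2 * C0) powr r * (Cr r * \<rho> powr (r * m) * (1 + s) powr (- (g * (r * m / 2 - 1))))
           \<le> (2 * C0) powr r * (S powr r * \<rho> powr (r * m) * (1 + s) powr (- (1 + g / 2 - g / r) * r))"
          using 1 Cr[OF r] by (intro mult_left_mono mult_mono) auto
        also have "\<dots> = (2 * C0 * S * \<rho> powr m * (1 + s) powr (- (1 + g / 2 - g / r))) powr r"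
          using C0_pos S0 s \<rho> by (simp add: powr_mult powr_powr mult_ac)
        finally show "(2 * C0) powr r * (Cr r * \<rho> powr (r * m) * (1 + s) powr (- (g * (r * m / 2 - 1))))
           \<le> (2 * C0 * S * \<rho> powr m * (1 + s) powr (- (1 + g / 2 - g / r))) powr r" .
      qed
      finally show "(\<integral>\<^sup>+y. ennreal (src u0 W (s, y) powr r) \<partial>lborel)
         \<le> ennreal ((2 * C0 * S * \<rho> powr m * (1 + s) powr (- (1 + g / 2 - g / r))) powr r)" .
    qed (auto simp: src_nonneg, auto simp: src_def)
  qed
qed

lemma duh_past:
  assumes "source D h" "t \<le> 0"
  shows "duh h (t, x) = 0"
proof -
  have "K ((t, x) - w) * h w = 0" for w
    using assms by (cases w; cases "fst w \<le> 0") (auto simp: source_def K_past)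
  then have "ennreal (K ((t, x) - w) * h w) = 0" for w by (metis ennreal_0)
  then show ?thesis by (simp only: duh_def nn_integral_0_iff_AE) simp
qed

lemma admissible_step:
  obtains \<rho> where "\<rho> > 0"
    "\<And>u0 W z. small_data \<rho> u0 \<Longrightarrow> admissible \<rho> W \<Longrightarrow> duh (src u0 W) z < \<infinity>"
    "\<And>u0 W. small_data \<rho> u0 \<Longrightarrow> admissible \<rho> W \<Longrightarrow> admissible \<rho> (\<lambda>z. enn2real (duh (src u0 W) z))"
proof -
  obtain C where C: "C > 0"
    and sup: "\<And>D h t x. source D h \<Longrightarrow> D \<ge> 0 \<Longrightarrow> t > 0 \<Longrightarrow>
       duh h (t, x) \<le> ennreal (C * D * min 1 t powr (1 / (g + 1)) * (1 + t) powr (- g / 2))"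
    and L2: "\<And>D h t. source D h \<Longrightarrow> D \<ge> 0 \<Longrightarrow> t > 0 \<Longrightarrow>
       (\<integral>\<^sup>+x. (duh h (t, x))\<^sup>2 \<partial>lborel) \<le> ennreal ((C * D * min 1 t)\<^sup>2)"
    using duh_bounds by blast
  obtain Cs where Cs: "Cs > 0"
    and so: "\<And>\<rho> u0 W. \<lbrakk>\<rho> > 0; 16 * ((g + 2) * lam) * \<rho>\<^sup>2 \<le> 1; small_data \<rho> u0; admissible \<rho> W\<rbrakk> \<Longrightarrow>
       source (Cs * \<rho> powr m) (src u0 W)"
    using src_source by blast
  \<comment> \<open>The bound 1 gives \<rho>^m \<le> \<rho>^2 \<le> \<rho>, the bound 1 / (C Cs)
    lets this quadratic gain beat the constants, and the last one secures the exponential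
    moments.\<close>
  define \<rho> where "\<rho> = min 1 (min (1 / (C * Cs)) (1 / (16 * ((g + 2) * lam))))"
  have \<rho>: "\<rho> > 0" "\<rho> \<le> 1" "\<rho> \<le> 1 / (C * Cs)" "\<rho> \<le> 1 / (16 * ((g + 2) * lam))"
    using C Cs g_pos lam_pos by (auto simp: \<rho>_def)
  have "\<rho>\<^sup>2 \<le> \<rho>" using \<rho> by (simp add: power2_eq_square mult_left_le)
  then have "\<rho>\<^sup>2 \<le> 1 / (16 * ((g + 2) * lam))" using \<rho> by linarith
  then have \<rho>': "16 * ((g + 2) * lam) * \<rho>\<^sup>2 \<le> 1"
    using g_pos lam_pos by (subst (asm) pos_le_divide_eq) (auto simp: mult_ac)
  have "\<rho> powr m \<le> \<rho> powr 2" using \<rho> m_ge by (intro powr_mono') auto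
  then have "C * (Cs * \<rho> powr m) \<le> C * (Cs * (\<rho> * \<rho>))"
    using \<rho> C Cs by (intro mult_left_mono) (auto simp: power2_eq_square)
  also have "\<dots> = (C * Cs * \<rho>) * \<rho>" by simp
  also have "\<dots> \<le> 1 * \<rho>"
    using \<rho> C Cs by (intro mult_right_mono) (auto simp: pos_le_divide_eq mult_ac)
  finally have CD: "C * (Cs * \<rho> powr m) \<le> \<rho>" by simp
  have D0: "0 \<le> Cs * \<rho> powr m" "0 \<le> C * (Cs * \<rho> powr m)" using C Cs by auto
  have fin: "duh (src u0 W) z < \<infinity>" if "small_data \<rho> u0" "admissible \<rho> W" for u0 W z
  proof (cases z)
    case (Pair t x)
    show ?thesis
    proof (cases "t > 0")
      case True
      then show ?thesis unfolding Pair
        using le_less_trans[OF sup[OF so[OF \<rho>(1) \<rho>' that] D0(1)] ennreal_less_top] by simp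
    next
      case False
      then show ?thesis unfolding Pair using duh_past[OF so[OF \<rho>(1) \<rho>' that], of t x] by simp
    qed
  qed
  show ?thesis
  proof
    show "\<rho> > 0" by (rule \<rho>)
    show "duh (src u0 W) z < \<infinity>" if "small_data \<rho> u0" "admissible \<rho> W" for u0 W z
      by (rule fin[OF that])
    fix u0 W assume u0: "small_data \<rho> u0" and W: "admissible \<rho> W"
    have [measurable]: "u0 \<in> borel_measurable borel" "W \<in> borel_measurable borel"
      using u0 W by (auto simp: small_data_def admissible_def)
    note s = so[OF \<rho>(1) \<rho>' u0 W]
    have eq: "ennreal (enn2real (duh (src u0 W) z)) = duh (src u0 W) z" for z
      using fin[OF u0 W, of z] by simp
    show "admissible \<rho> (\<lambda>z. enn2real (duh (src u0 W) z))"
      unfolding admissible_def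
    proof (intro conjI allI impI)
      fix t :: real and x assume t: "t > 0"
      have "ennreal (enn2real (duh (src u0 W) (t, x))) \<le> ennreal (C * (Cs * \<rho> powr m) * min 1 t powr (1 / (g + 1)) * (1 + t) powr (- g / 2))"
        unfolding eq by (rule sup[OF s D0(1) t])
      also have "\<dots> \<le> ennreal (\<rho> * min 1 t powr (1 / (g + 1)) * (1 + t) powr (- g / 2))"
        by (intro ennreal_leI mult_right_mono CD) auto
      finally show "enn2real (duh (src u0 W) (t, x)) \<le> \<rho> * min 1 t powr (1 / (g + 1)) * (1 + t) powr (- g / 2)"
        using \<rho> by (subst (asm) ennreal_le_iff) auto
    next
      fix t :: real assume t: "t > 0"
      have "(\<integral>\<^sup>+x. ennreal ((enn2real (duh (src u0 W) (t, x)))\<^sup>2) \<partial>lborel) = (\<integral>\<^sup>+x. (duh (src u0 W) (t, x))\<^sup>2 \<partial>lborel)"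
        by (simp add: ennreal_power[symmetric] eq)
      also have "\<dots> \<le> ennreal ((C * (Cs * \<rho> powr m) * min 1 t)\<^sup>2)"
        by (rule L2[OF s D0(1) t])
      also have "\<dots> \<le> ennreal ((\<rho> * min 1 t)\<^sup>2)"
        using D0 t by (intro ennreal_leI power_mono mult_right_mono CD) auto
      finally show "(\<integral>\<^sup>+x. ennreal ((enn2real (duh (src u0 W) (t, x)))\<^sup>2) \<partial>lborel) \<le> ennreal ((\<rho> * min 1 t)\<^sup>2)" .
    qed (auto simp: duh_past[OF s])
  qed
qed

end

section \<open>Existence of a mild solution\<close>

locale semilinear = majorant_problem K A kap g m C0 lam
  for K :: "real \<times> 'a::euclidean_space \<Rightarrow> real" and A kap g m C0 lam :: real +
  fixes E :: "real \<times> 'a \<Rightarrow> real" and f :: "real \<Rightarrow> real"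
  assumes E_measurable [measurable]: "E \<in> borel_measurable borel"
    and E_le: "\<bar>E z\<bar> \<le> K z"
    and f_0: "f 0 = 0"
    and f_growth: "\<And>u v. \<bar>f u - f v\<bar> \<le> C0 * \<bar>u - v\<bar> *
                 (\<bar>u\<bar> powr (m - 1) * exp (lam * u\<^sup>2) + \<bar>v\<bar> powr (m - 1) * exp (lam * v\<^sup>2))"
begin

lemma growth_mono: "\<bar>u\<bar> \<le> R \<Longrightarrow> \<bar>u\<bar> powr (m - 1) * exp (lam * u\<^sup>2) \<le> R powr (m - 1) * exp (lam * R\<^sup>2)"
proof -
  assume u: "\<bar>u\<bar> \<le> R"
  then have "u\<^sup>2 \<le> R\<^sup>2" by (metis abs_le_square_iff abs_of_nonneg abs_ge_zero order_trans)
  with u show ?thesis using m_ge lam_pos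
    by (intro mult_mono powr_mono2) (auto intro!: mult_left_mono)
qed

lemma f_lipschitz:
  assumes "\<bar>u\<bar> \<le> R" "\<bar>v\<bar> \<le> R"
  shows "\<bar>f u - f v\<bar> \<le> 2 * C0 * (R powr (m - 1) * exp (lam * R\<^sup>2)) * \<bar>u - v\<bar>"
proof -
  have "\<bar>f u - f v\<bar> \<le> C0 * \<bar>u - v\<bar> * (R powr (m - 1) * exp (lam * R\<^sup>2) + R powr (m - 1) * exp (lam * R\<^sup>2))"
    using C0_pos by (intro order.trans[OF f_growth] mult_left_mono add_mono growth_mono assms) auto
  then show ?thesis by (simp add: mult_ac)
qed

text \<open>Continuity makes f measurable and lets f pass to the limit along the Picard
  iterates.\<close>

lemma f_isCont: "isCont f v"
proof -
  let ?R = "\<bar>v\<bar> + 1"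
  let ?M = "2 * C0 * (?R powr (m - 1) * exp (lam * ?R\<^sup>2))"
  have "((\<lambda>u. f u - f v) \<longlongrightarrow> 0) (at v)"
  proof (rule Lim_null_comparison)
    have "eventually (\<lambda>u. dist u v < 1) (at v)"
      by (rule eventually_at_ball'[THEN eventually_mono, of 1]) (auto simp: dist_commute)
    then show "\<forall>\<^sub>F u in at v. norm (f u - f v) \<le> ?M * \<bar>u - v\<bar>"
      by eventually_elim (auto simp: dist_real_def intro!: f_lipschitz)
    have "((\<lambda>u. ?M * \<bar>u - v\<bar>) \<longlongrightarrow> ?M * \<bar>v - v\<bar>) (at v)"
      by (intro tendsto_intros)
    then show "((\<lambda>u. ?M * \<bar>u - v\<bar>) \<longlongrightarrow> 0) (at v)" by simp
  qed
  then show ?thesis unfolding isCont_def by (rule Lim_null[THEN iffD2])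
qed

lemma f_measurable [measurable]: "f \<in> borel_measurable borel"
  by (intro borel_measurable_continuous_onI continuous_at_imp_continuous_on ballI f_isCont)

text \<open>With G r = r^(m - 1) exp (lam r^2) increasing, (b - a) G b \<le> b G b - a G a. The
  conclusion has the same form as the hypothesis on |u - v|, which is why the comparison survives
  iteration.\<close>

lemma f_diff_le:
  assumes "\<bar>u\<bar> \<le> b" "\<bar>v\<bar> \<le> a" "\<bar>u - v\<bar> \<le> b - a"
  shows "\<bar>f u - f v\<bar> \<le> F b - F a"
proof -
  let ?G = "\<lambda>r. r powr (m - 1) * exp (lam * r\<^sup>2)"
  have a: "0 \<le> a" "a \<le> b" using assms by auto
  have FG: "F r = 2 * C0 * (r * ?G r)" if "r \<ge> 0" for r
    using that m_ge by (cases "r = 0") (auto simp: F_def powr_diff)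
  have Gab: "?G a \<le> ?G b" using growth_mono[of a b] a by simp
  have "\<bar>f u - f v\<bar> \<le> C0 * (b - a) * (?G b + ?G a)"
    using C0_pos assms a by (intro order.trans[OF f_growth] mult_mono add_mono growth_mono) auto
  also have "\<dots> \<le> C0 * (b - a) * (2 * ?G b)"
    using C0_pos a Gab by (intro mult_left_mono) auto
  also have "\<dots> = 2 * C0 * (b * ?G b - a * ?G b)" by (simp add: algebra_simps)
  also have "\<dots> \<le> 2 * C0 * (b * ?G b - a * ?G a)"
    using C0_pos a Gab by (intro mult_left_mono diff_left_mono) auto
  also have "\<dots> = F b - F a" using a by (simp add: FG right_diff_distrib)
  finally show ?thesis .
qed

lemma f_le: "\<bar>u\<bar> \<le> b \<Longrightarrow> \<bar>f u\<bar> \<le> F b"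
  using f_diff_le[of u b 0 0] by (simp add: f_0 F_def)

definition heatE :: "('a \<Rightarrow> real) \<Rightarrow> real \<times> 'a \<Rightarrow> real" where
  "heatE u0 z = (\<integral>y. E (fst z, snd z - y) * u0 y \<partial>lborel)"

definition fsrc :: "(real \<times> 'a \<Rightarrow> real) \<Rightarrow> real \<times> 'a \<Rightarrow> real" where
  "fsrc u w = (if fst w > 0 then f (u w) else 0)"

lemma heatE_measurable [measurable]:
  assumes [measurable]: "u0 \<in> borel_measurable borel"
  shows "heatE u0 \<in> borel_measurable borel"
proof -
  have [measurable]: "fst \<in> borel_measurable (borel :: (real \<times> 'a) measure)"
    "snd \<in> borel_measurable (borel :: (real \<times> 'a) measure)"
    by (simp_all add: borel_prod[symmetric])
  show ?thesis unfolding heatE_def[abs_def] by measurable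
qed

lemma fsrc_measurable [measurable]:
  assumes [measurable]: "u \<in> borel_measurable borel"
  shows "fsrc u \<in> borel_measurable borel"
proof -
  have [measurable]: "fst \<in> borel_measurable (borel :: (real \<times> 'a) measure)"
    by (simp add: borel_prod[symmetric])
  show ?thesis unfolding fsrc_def[abs_def] by measurable
qed

lemma heatE_le:
  assumes \<rho>: "\<rho> > 0" and u0: "small_data \<rho> u0"
  shows "\<bar>heatE u0 z\<bar> \<le> heatV u0 z"
proof (cases z)
  case (Pair t x)
  have [measurable]: "u0 \<in> borel_measurable borel" using u0 by (simp add: small_data_def)
  show ?thesis
  proof (cases "t > 0")
    case True
    have le: "ennreal (norm (E (t, x - y) * u0 y)) \<le> ennreal (K (t, x - y) * \<bar>u0 y\<bar>)" for y
      using E_le by (intro ennreal_leI) (auto simp: abs_mult intro!: mult_right_mono)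
    have fin: "(\<integral>\<^sup>+y. ennreal (norm (E (t, x - y) * u0 y)) \<partial>lborel) \<le> ennreal (heatV u0 (t, x))"
      unfolding heatV_eq_nn[OF \<rho> u0 True, symmetric] by (intro nn_integral_mono le)
    have "integrable lborel (\<lambda>y. E (t, x - y) * u0 y)"
      using le_less_trans[OF fin ennreal_less_top] by (intro integrableI_bounded) auto
    from order.trans[OF integral_norm_bound_ennreal[OF this] fin]
    show ?thesis unfolding Pair heatE_def using heatV_nonneg by (simp add: ennreal_le_iff)
  next
    case False
    then have "E (t, x - y) = 0" for y using E_le[of "(t, x - y)"] K_past[of t "x - y"] by simp
    then show ?thesis unfolding Pair heatE_def by (simp add: heatV_nonneg)
  qed
qed

section \<open>Picard iterates and their majorants\<close>

primrec Wit :: "('a \<Rightarrow> real) \<Rightarrow> nat \<Rightarrow> real \<times> 'a \<Rightarrow> real" where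
  "Wit u0 0 = (\<lambda>z. 0)"
| "Wit u0 (Suc n) = (\<lambda>z. enn2real (duh (src u0 (Wit u0 n)) z))"

primrec Uit :: "('a \<Rightarrow> real) \<Rightarrow> nat \<Rightarrow> real \<times> 'a \<Rightarrow> real" where
  "Uit u0 0 = heatE u0"
| "Uit u0 (Suc n) = (\<lambda>z. heatE u0 z + (\<integral>w. E (z - w) * fsrc (Uit u0 n) w \<partial>lborel))"

lemma src_mono: "(\<And>w. 0 \<le> W w) \<Longrightarrow> (\<And>w. W w \<le> W' w) \<Longrightarrow> src u0 W w \<le> src u0 W' w"
  unfolding src_def by (simp add: F_mono heatV_nonneg)

lemma integrable_K_src:
  assumes [measurable]: "u0 \<in> borel_measurable borel" "W \<in> borel_measurable borel"
    and "duh (src u0 W) z < \<infinity>"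
  shows "integrable lborel (\<lambda>w. K (z - w) * src u0 W w)"
    and "(\<integral>w. K (z - w) * src u0 W w \<partial>lborel) = enn2real (duh (src u0 W) z)"
proof -
  show "integrable lborel (\<lambda>w. K (z - w) * src u0 W w)"
    using assms(3) unfolding duh_def by (intro integrableI_nonneg) (auto simp: K_nonneg src_nonneg)
  show "(\<integral>w. K (z - w) * src u0 W w \<partial>lborel) = enn2real (duh (src u0 W) z)"
    unfolding duh_def by (rule integral_eq_nn_integral) (auto simp: K_nonneg src_nonneg)
qed

lemma fsrc_le: "\<bar>u w\<bar> \<le> heatV u0 w + W w \<Longrightarrow> \<bar>fsrc u w\<bar> \<le> src u0 W w"
  by (simp add: fsrc_def src_def f_le)

lemma abs_E_mult_le: "\<bar>a\<bar> \<le> b \<Longrightarrow> \<bar>E z * a\<bar> \<le> K z * b"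
  using E_le[of z] by (auto simp: abs_mult intro!: mult_mono K_nonneg)

lemma integrable_E_fsrc:
  assumes [measurable]: "u0 \<in> borel_measurable borel" "W \<in> borel_measurable borel" "u \<in> borel_measurable borel"
    and fin: "duh (src u0 W) z < \<infinity>" and u: "\<And>w. \<bar>u w\<bar> \<le> heatV u0 w + W w"
  shows "integrable lborel (\<lambda>w. E (z - w) * fsrc u w)"
proof (rule Bochner_Integration.integrable_bound[OF integrable_K_src(1)[OF assms(1,2) fin]])
  have "\<bar>E (z - w) * fsrc u w\<bar> \<le> \<bar>K (z - w) * src u0 W w\<bar>" for w
    by (rule order.trans[OF _ abs_ge_self]) (intro abs_E_mult_le fsrc_le u)
  then show "AE w in lborel. norm (E (z - w) * fsrc u w) \<le> norm (K (z - w) * src u0 W w)"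
    unfolding real_norm_def by (rule AE_I2)
qed measurable

context
  fixes \<rho> :: real and u0 :: "'a \<Rightarrow> real"
  assumes \<rho>: "\<rho> > 0" and u0: "small_data \<rho> u0"
    and fin: "\<And>W z. admissible \<rho> W \<Longrightarrow> duh (src u0 W) z < \<infinity>"
    and step: "\<And>W. admissible \<rho> W \<Longrightarrow> admissible \<rho> (\<lambda>z. enn2real (duh (src u0 W) z))"
begin

lemma u0_measurable [measurable]: "u0 \<in> borel_measurable borel"
  using u0 by (simp add: small_data_def)

lemma Wit_admissible: "admissible \<rho> (Wit u0 n)"
proof (induction n)
  case 0
  show ?case using \<rho> by (auto simp: admissible_def)
qed (simp add: step)

lemma Wit_measurable [measurable]: "Wit u0 n \<in> borel_measurable borel"
  and Wit_nonneg: "Wit u0 n z \<ge> 0"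
  using Wit_admissible[of n] unfolding admissible_def by blast+

lemma Wit_Suc: "Wit u0 n z \<le> Wit u0 (Suc n) z"
proof (induction n arbitrary: z)
  case (Suc n)
  have "duh (src u0 (Wit u0 n)) z \<le> duh (src u0 (Wit u0 (Suc n))) z"
    by (intro duh_mono src_mono Wit_nonneg Suc)
  then show ?case
    using fin[OF Wit_admissible[of "Suc n"], of z] by (subst (1 2) Wit.simps(2)) (rule enn2real_mono, auto)
qed simp

lemma Wit_eq: "Wit u0 (Suc n) z = (\<integral>w. K (z - w) * src u0 (Wit u0 n) w \<partial>lborel)"
  using integrable_K_src(2)[OF u0_measurable Wit_measurable fin[OF Wit_admissible]] by simp

lemma Uit_measurable [measurable]: "Uit u0 n \<in> borel_measurable borel"
  by (induction n) simp_all

text \<open>The two bounds are proved together: the first at n + 1 is the sum of both at n, and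
  \<open>f_diff_le\<close> uses the bounds on both iterates as well as the one on the
  increment.\<close>

lemma Uit_bounds:
  "(\<forall>z. \<bar>Uit u0 n z\<bar> \<le> heatV u0 z + Wit u0 n z) \<and>
   (\<forall>z. \<bar>Uit u0 (Suc n) z - Uit u0 n z\<bar> \<le> Wit u0 (Suc n) z - Wit u0 n z)"
proof (induction n)
  case 0
  have A: "\<bar>Uit u0 0 z\<bar> \<le> heatV u0 z + Wit u0 0 z" for z
    using heatE_le[OF \<rho> u0] by simp
  have B: "\<bar>Uit u0 (Suc 0) z - Uit u0 0 z\<bar> \<le> Wit u0 (Suc 0) z - Wit u0 0 z" for z
  proof -
    have "\<bar>(\<integral>w. E (z - w) * fsrc (Uit u0 0) w \<partial>lborel)\<bar> \<le> (\<integral>w. K (z - w) * src u0 (Wit u0 0) w \<partial>lborel)"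
      by (rule Bochner_Integration.integral_abs_bound_integral)
        (auto intro!: integrable_E_fsrc[OF u0_measurable Wit_measurable Uit_measurable fin[OF Wit_admissible]]
           integrable_K_src(1)[OF u0_measurable Wit_measurable fin[OF Wit_admissible]] A abs_E_mult_le fsrc_le simp del: Wit.simps Uit.simps)
    then show ?thesis unfolding Wit_eq by simp
  qed
  from A B show ?case by blast
next
  case (Suc n)
  have A: "\<bar>Uit u0 (Suc n) z\<bar> \<le> heatV u0 z + Wit u0 (Suc n) z" for z
  proof -
    have "\<bar>Uit u0 n z\<bar> \<le> heatV u0 z + Wit u0 n z" "\<bar>Uit u0 (Suc n) z - Uit u0 n z\<bar> \<le> Wit u0 (Suc n) z - Wit u0 n z"
      using Suc by blast+
    then show ?thesis by linarith
  qed
  have B: "\<bar>Uit u0 (Suc (Suc n)) z - Uit u0 (Suc n) z\<bar> \<le> Wit u0 (Suc (Suc n)) z - Wit u0 (Suc n) z" for z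
  proof -
    let ?d = "\<lambda>w. fsrc (Uit u0 (Suc n)) w - fsrc (Uit u0 n) w"
    let ?D = "\<lambda>w. src u0 (Wit u0 (Suc n)) w - src u0 (Wit u0 n) w"
    have A': "\<bar>Uit u0 n w\<bar> \<le> heatV u0 w + Wit u0 n w" for w using Suc by blast
    have S: "\<bar>Uit u0 (Suc n) w - Uit u0 n w\<bar> \<le> Wit u0 (Suc n) w - Wit u0 n w" for w using Suc by blast
    have iE: "integrable lborel (\<lambda>w. E (z - w) * fsrc (Uit u0 (Suc n)) w)" "integrable lborel (\<lambda>w. E (z - w) * fsrc (Uit u0 n) w)"
      by (rule integrable_E_fsrc[OF u0_measurable Wit_measurable Uit_measurable fin[OF Wit_admissible]], rule A A')+
    have iK: "integrable lborel (\<lambda>w. K (z - w) * src u0 (Wit u0 n) w)" for n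
      by (rule integrable_K_src(1)[OF u0_measurable Wit_measurable fin[OF Wit_admissible]])
    have d: "\<bar>?d w\<bar> \<le> ?D w" for w
    proof (cases "fst w > 0")
      case True
      have "\<bar>f (Uit u0 (Suc n) w) - f (Uit u0 n w)\<bar> \<le> F (heatV u0 w + Wit u0 (Suc n) w) - F (heatV u0 w + Wit u0 n w)"
        by (rule f_diff_le[OF A A']) (use S[of w] in linarith)
      with True show ?thesis by (simp add: fsrc_def src_def del: Wit.simps Uit.simps)
    qed (simp add: fsrc_def src_def)
    have "\<bar>(\<integral>w. E (z - w) * ?d w \<partial>lborel)\<bar> \<le> (\<integral>w. K (z - w) * ?D w \<partial>lborel)"
    proof (rule Bochner_Integration.integral_abs_bound_integral)
      show "integrable lborel (\<lambda>w. E (z - w) * ?d w)"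
        unfolding right_diff_distrib by (rule Bochner_Integration.integrable_diff[OF iE])
      show "integrable lborel (\<lambda>w. K (z - w) * ?D w)"
        unfolding right_diff_distrib by (rule Bochner_Integration.integrable_diff[OF iK iK])
    qed (rule abs_E_mult_le[OF d])
    also have "(\<integral>w. K (z - w) * ?D w \<partial>lborel) = Wit u0 (Suc (Suc n)) z - Wit u0 (Suc n) z"
    proof -
      have "(\<integral>w. K (z - w) * ?D w \<partial>lborel) = (\<integral>w. K (z - w) * src u0 (Wit u0 (Suc n)) w \<partial>lborel) - (\<integral>w. K (z - w) * src u0 (Wit u0 n) w \<partial>lborel)"
        unfolding right_diff_distrib by (rule Bochner_Integration.integral_diff[OF iK iK])
      then show ?thesis unfolding Wit_eq[symmetric] .
    qed
    also have "(\<integral>w. E (z - w) * ?d w \<partial>lborel) = Uit u0 (Suc (Suc n)) z - Uit u0 (Suc n) z"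
    proof -
      have "(\<integral>w. E (z - w) * ?d w \<partial>lborel) = (\<integral>w. E (z - w) * fsrc (Uit u0 (Suc n)) w \<partial>lborel) - (\<integral>w. E (z - w) * fsrc (Uit u0 n) w \<partial>lborel)"
        unfolding right_diff_distrib by (rule Bochner_Integration.integral_diff[OF iE])
      then show ?thesis by simp
    qed
    finally show ?thesis .
  qed
  from A B show ?case by blast
qed

lemma Uit_diff: "\<bar>Uit u0 (k + j) z - Uit u0 k z\<bar> \<le> Wit u0 (k + j) z - Wit u0 k z"
proof (induction j)
  case (Suc j)
  have "\<bar>Uit u0 (Suc (k + j)) z - Uit u0 (k + j) z\<bar> \<le> Wit u0 (Suc (k + j)) z - Wit u0 (k + j) z"
    using Uit_bounds by blast
  with Suc show ?case unfolding add_Suc_right by linarith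
qed simp

text \<open>The increments of the Picard iterates are dominated by those of a bounded increasing
  sequence, so the iterates are pointwise Cauchy. Monotone convergence carries the L^2 bound in
  \<open>admissible\<close> to the limit W, and K times \<open>src u0 W\<close> dominates all the
  integrands in the equation.\<close>

lemma mild_solution_limit:
  obtains u W where "admissible \<rho> W" "u \<in> borel_measurable borel"
    "\<And>z. \<bar>u z\<bar> \<le> heatV u0 z + W z" "\<And>z. \<bar>u z - heatE u0 z\<bar> \<le> W z"
    "\<And>z. u z = heatE u0 z + (\<integral>w. E (z - w) * fsrc u w \<partial>lborel)"
proof -
  have inc: "incseq (\<lambda>n. Wit u0 n z)" for z by (intro incseq_SucI Wit_Suc)
  have bnd: "Wit u0 n z \<le> \<rho>" for n z
  proof (cases z)
    case (Pair t x)
    show ?thesis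
    proof (cases "t > 0")
      case True
      have "(1 + t) powr (- g / 2) \<le> (1 + t) powr 0" using True g_pos by (intro powr_mono) auto
      then have "\<rho> * (1 + t) powr (- g / 2) \<le> \<rho>" using True \<rho> by (intro mult_left_le) auto
      then show ?thesis unfolding Pair using admissible_sup[OF _ Wit_admissible True, of n x] \<rho> by linarith
    next
      case False
      then show ?thesis unfolding Pair using Wit_admissible[of n] \<rho> by (auto simp: admissible_def)
    qed
  qed
  define W where "W z = lim (\<lambda>n. Wit u0 n z)" for z
  have Wlim: "(\<lambda>n. Wit u0 n z) \<longlonglongrightarrow> W z" for z
  proof -
    obtain L where "(\<lambda>n. Wit u0 n z) \<longlonglongrightarrow> L"
      by (rule incseq_convergent[OF inc[of z], of \<rho>]) (simp_all add: bnd del: Wit.simps)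
    then show ?thesis unfolding W_def by (simp add: limI)
  qed
  have W_ge: "Wit u0 n z \<le> W z" for n z by (rule incseq_le[OF inc Wlim])
  have Wm[measurable]: "W \<in> borel_measurable borel"
    by (rule borel_measurable_LIMSEQ_real[OF Wlim]) measurable
  have W0: "W z \<ge> 0" for z using W_ge[of 0 z] by simp
  have adm: "admissible \<rho> W"
    unfolding admissible_def
  proof (intro conjI allI impI Wm W0)
    show "W (t, x) = 0" if "t \<le> 0" for t x
    proof -
      have "Wit u0 n (t, x) = 0" for n using Wit_admissible[of n] that by (auto simp: admissible_def)
      then show ?thesis using LIMSEQ_unique[OF Wlim[of "(t, x)"], of 0] by simp
    qed
    show "W (t, x) \<le> \<rho> * min 1 t powr (1 / (g + 1)) * (1 + t) powr (- g / 2)" if "t > 0" for t x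
      using Wit_admissible that by (intro LIMSEQ_le_const2[OF Wlim]) (auto simp: admissible_def)
    show "(\<integral>\<^sup>+x. ennreal ((W (t, x))\<^sup>2) \<partial>lborel) \<le> ennreal ((\<rho> * min 1 t)\<^sup>2)" if "t > 0" for t
    proof (rule LIMSEQ_le_const2)
      show "(\<lambda>n. \<integral>\<^sup>+x. ennreal ((Wit u0 n (t, x))\<^sup>2) \<partial>lborel) \<longlonglongrightarrow> (\<integral>\<^sup>+x. ennreal ((W (t, x))\<^sup>2) \<partial>lborel)"
      proof (rule nn_integral_LIMSEQ)
        show "incseq (\<lambda>n x. ennreal ((Wit u0 n (t, x))\<^sup>2))"
          by (intro incseq_SucI le_funI ennreal_leI power_mono Wit_Suc Wit_nonneg)
        show "(\<lambda>n. ennreal ((Wit u0 n (t, x))\<^sup>2)) \<longlonglongrightarrow> ennreal ((W (t, x))\<^sup>2)" for x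
          by (intro tendsto_intros Wlim)
      qed measurable
      show "\<exists>N. \<forall>n\<ge>N. (\<integral>\<^sup>+x. ennreal ((Wit u0 n (t, x))\<^sup>2) \<partial>lborel) \<le> ennreal ((\<rho> * min 1 t)\<^sup>2)"
        using Wit_admissible that by (auto simp: admissible_def)
    qed
  qed
  have "Cauchy (\<lambda>n. Uit u0 n z)" for z
  proof (rule metric_CauchyI)
    fix e :: real assume e: "e > 0"
    obtain M where M: "\<And>n. n \<ge> M \<Longrightarrow> dist (Wit u0 n z) (W z) < e / 2"
      using metric_LIMSEQ_D[OF Wlim[of z], of "e / 2"] e by auto
    have d: "dist (Uit u0 n z) (Uit u0 M z) < e / 2" if "n \<ge> M" for n
      using Uit_diff[of M "n - M" z] that M[of M] W_ge[of n z] by (auto simp: dist_real_def)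
    show "\<exists>M. \<forall>m\<ge>M. \<forall>n\<ge>M. dist (Uit u0 m z) (Uit u0 n z) < e"
    proof (intro exI[of _ M] allI impI)
      fix i j assume "i \<ge> M" "j \<ge> M"
      then show "dist (Uit u0 i z) (Uit u0 j z) < e"
        using d[of i] d[of j] dist_triangle2[of "Uit u0 i z" "Uit u0 j z" "Uit u0 M z"] by linarith
    qed
  qed
  then have cv: "convergent (\<lambda>n. Uit u0 n z)" for z by (simp add: Cauchy_convergent_iff)
  define u where "u z = lim (\<lambda>n. Uit u0 n z)" for z
  have Ulim: "(\<lambda>n. Uit u0 n z) \<longlonglongrightarrow> u z" for z
    using cv[of z] unfolding u_def by (rule convergent_LIMSEQ_iff[THEN iffD1])
  have um[measurable]: "u \<in> borel_measurable borel"
    by (rule borel_measurable_LIMSEQ_real[OF Ulim]) measurable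
  have UW: "\<bar>Uit u0 n z\<bar> \<le> heatV u0 z + W z" for n z
  proof -
    have "\<bar>Uit u0 n z\<bar> \<le> heatV u0 z + Wit u0 n z" using Uit_bounds by blast
    with W_ge[of n z] show ?thesis by linarith
  qed
  show ?thesis
  proof
    show "admissible \<rho> W" "u \<in> borel_measurable borel" by (rule adm um)+
    show "\<bar>u z\<bar> \<le> heatV u0 z + W z" for z
      by (rule LIMSEQ_le_const2[OF tendsto_rabs[OF Ulim]]) (use UW in auto)
    show "\<bar>u z - heatE u0 z\<bar> \<le> W z" for z
    proof (rule LIMSEQ_le_const2)
      show "(\<lambda>n. \<bar>Uit u0 n z - heatE u0 z\<bar>) \<longlonglongrightarrow> \<bar>u z - heatE u0 z\<bar>" by (intro tendsto_intros Ulim)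
      show "\<exists>N. \<forall>n\<ge>N. \<bar>Uit u0 n z - heatE u0 z\<bar> \<le> W z"
      proof (intro exI allI impI)
        fix n :: nat
        show "\<bar>Uit u0 n z - heatE u0 z\<bar> \<le> W z" using Uit_diff[of 0 n z] W_ge[of n z] by simp
      qed
    qed
    fix z
    have "(\<lambda>n. \<integral>w. E (z - w) * fsrc (Uit u0 n) w \<partial>lborel) \<longlonglongrightarrow> (\<integral>w. E (z - w) * fsrc u w \<partial>lborel)"
    proof (rule integral_dominated_convergence[where w = "\<lambda>w. K (z - w) * src u0 W w"])
      show "integrable lborel (\<lambda>w. K (z - w) * src u0 W w)"
        by (rule integrable_K_src(1)[OF u0_measurable Wm fin[OF adm]])
      show "AE w in lborel. norm (E (z - w) * fsrc (Uit u0 n) w) \<le> K (z - w) * src u0 W w" for n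
        unfolding real_norm_def by (intro AE_I2 abs_E_mult_le fsrc_le UW)
      have "(\<lambda>n. fsrc (Uit u0 n) w) \<longlonglongrightarrow> fsrc u w" for w
        unfolding fsrc_def using isCont_tendsto_compose[OF f_isCont Ulim] by auto
      then show "AE w in lborel. (\<lambda>n. E (z - w) * fsrc (Uit u0 n) w) \<longlonglongrightarrow> E (z - w) * fsrc u w"
        by (intro AE_I2 tendsto_intros)
    qed measurable
    then have "(\<lambda>n. Uit u0 (Suc n) z) \<longlonglongrightarrow> heatE u0 z + (\<integral>w. E (z - w) * fsrc u w \<partial>lborel)"
      by (auto intro!: tendsto_intros)
    moreover have "(\<lambda>n. Uit u0 (Suc n) z) \<longlonglongrightarrow> u z" by (rule LIMSEQ_Suc[OF Ulim])
    ultimately show "u z = heatE u0 z + (\<integral>w. E (z - w) * fsrc u w \<partial>lborel)"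
      by (rule LIMSEQ_unique[rotated])
  qed
qed

end

lemma mild_solution_exists:
  obtains \<rho> where "\<rho> > 0"
    "\<And>u0 W z. small_data \<rho> u0 \<Longrightarrow> admissible \<rho> W \<Longrightarrow> duh (src u0 W) z < \<infinity>"
    "\<And>u0. small_data \<rho> u0 \<Longrightarrow> \<exists>u W. admissible \<rho> W \<and> u \<in> borel_measurable borel \<and>
       (\<forall>z. \<bar>u z\<bar> \<le> heatV u0 z + W z) \<and> (\<forall>z. \<bar>u z - heatE u0 z\<bar> \<le> W z) \<and>
       (\<forall>z. u z = heatE u0 z + (\<integral>w. E (z - w) * fsrc u w \<partial>lborel))"
proof -
  obtain \<rho> where \<rho>: "\<rho> > 0"
    and fin: "\<And>u0 W z. small_data \<rho> u0 \<Longrightarrow> admissible \<rho> W \<Longrightarrow> duh (src u0 W) z < \<infinity>"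
    and step: "\<And>u0 W. small_data \<rho> u0 \<Longrightarrow> admissible \<rho> W \<Longrightarrow> admissible \<rho> (\<lambda>z. enn2real (duh (src u0 W) z))"
    using admissible_step by blast
  show ?thesis
  proof (rule that[OF \<rho> fin])
    fix u0 assume u0: "small_data \<rho> u0"
    show "\<exists>u W. admissible \<rho> W \<and> u \<in> borel_measurable borel \<and>
       (\<forall>z. \<bar>u z\<bar> \<le> heatV u0 z + W z) \<and> (\<forall>z. \<bar>u z - heatE u0 z\<bar> \<le> W z) \<and>
       (\<forall>z. u z = heatE u0 z + (\<integral>w. E (z - w) * fsrc u w \<partial>lborel))"
      by (rule mild_solution_limit[OF \<rho> u0 fin[OF u0] step[OF u0]]) blast+
  qed
qed

end

section \<open>The Orlicz space and its predual\<close>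

lemma expL2_norm_le:
  assumes "\<alpha> > 0" "(\<integral>\<^sup>+x. ennreal (exp ((u x)\<^sup>2 / \<alpha>\<^sup>2) - 1) \<partial>lebesgue) \<le> 1"
  shows "expL2_norm u \<le> \<alpha>" "0 \<le> expL2_norm u"
proof -
  let ?S = "{\<alpha>. \<alpha> > 0 \<and> (\<integral>\<^sup>+x. ennreal (exp ((u x)\<^sup>2 / \<alpha>\<^sup>2) - 1) \<partial>lebesgue) \<le> 1}"
  have "\<alpha> \<in> ?S" using assms by simp
  moreover have "bdd_below ?S" by (rule bdd_belowI[of _ 0]) auto
  ultimately show "expL2_norm u \<le> \<alpha>" "0 \<le> expL2_norm u"
    unfolding expL2_norm_def by (auto intro!: cInf_lower cInf_greatest)
qed

text \<open>The tangent of y^c at y = 1, read at y = exp (z / c). It trades a larger scale for a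
  smaller modular and, with c = 4, yields the doubling property of the conjugate function.\<close>

lemma expm1_div_le:
  assumes "c \<ge> 1" "z \<ge> 0"
  shows "exp (z / c) - 1 \<le> (exp z - 1) / (c::real)"
proof -
  have "1 powr c + c * 1 powr (c - 1) * (exp (z / c) - 1) \<le> exp (z / c) powr c"
    using assms by (intro powr_above_tangent) auto
  then have "c * (exp (z / c) - 1) \<le> exp z - 1"
    using assms by (simp add: exp_powr_real)
  then show ?thesis using assms by (simp add: pos_le_divide_eq mult.commute)
qed

text \<open>The infimum defining the norm is a junk value on an empty set; membership in \<open>expL2\<close> excludes this
  by convexity, after enlarging \<open>\<alpha>\<close>.\<close>

lemma expL2_norm_less:
  assumes u: "u \<in> expL2" and r: "expL2_norm u < r"
  shows "(\<integral>\<^sup>+x. ennreal (exp ((u x)\<^sup>2 / r\<^sup>2) - 1) \<partial>lebesgue) \<le> 1"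
proof -
  let ?S = "{\<alpha>. \<alpha> > 0 \<and> (\<integral>\<^sup>+x. ennreal (exp ((u x)\<^sup>2 / \<alpha>\<^sup>2) - 1) \<partial>lebesgue) \<le> 1}"
  have [measurable]: "u \<in> borel_measurable lebesgue" using u by (simp add: expL2_def loc_integrable_def)
  obtain \<alpha> where \<alpha>: "\<alpha> > 0" "(\<integral>\<^sup>+x. ennreal (exp ((u x)\<^sup>2 / \<alpha>\<^sup>2) - 1) \<partial>lebesgue) < \<infinity>"
    using u by (auto simp: expL2_def)
  define c where "c = max 1 (enn2real (\<integral>\<^sup>+x. ennreal (exp ((u x)\<^sup>2 / \<alpha>\<^sup>2) - 1) \<partial>lebesgue))"
  have c: "c \<ge> 1" "(\<integral>\<^sup>+x. ennreal (exp ((u x)\<^sup>2 / \<alpha>\<^sup>2) - 1) \<partial>lebesgue) \<le> ennreal c"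
  proof -
    show "c \<ge> 1" by (simp add: c_def)
    have "(\<integral>\<^sup>+x. ennreal (exp ((u x)\<^sup>2 / \<alpha>\<^sup>2) - 1) \<partial>lebesgue) = ennreal (enn2real (\<integral>\<^sup>+x. ennreal (exp ((u x)\<^sup>2 / \<alpha>\<^sup>2) - 1) \<partial>lebesgue))"
      using \<alpha>(2) by simp
    also have "\<dots> \<le> ennreal c" by (intro ennreal_leI) (simp add: c_def)
    finally show "(\<integral>\<^sup>+x. ennreal (exp ((u x)\<^sup>2 / \<alpha>\<^sup>2) - 1) \<partial>lebesgue) \<le> ennreal c" .
  qed
  have "(\<integral>\<^sup>+x. ennreal (exp ((u x)\<^sup>2 / (\<alpha> * sqrt c)\<^sup>2) - 1) \<partial>lebesgue) \<le> (\<integral>\<^sup>+x. ennreal (1 / c) * ennreal (exp ((u x)\<^sup>2 / \<alpha>\<^sup>2) - 1) \<partial>lebesgue)"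
  proof (rule nn_integral_mono)
    fix x
    have "exp ((u x)\<^sup>2 / (\<alpha> * sqrt c)\<^sup>2) - 1 \<le> (1 / c) * (exp ((u x)\<^sup>2 / \<alpha>\<^sup>2) - 1)"
      using expm1_div_le[OF c(1), of "(u x)\<^sup>2 / \<alpha>\<^sup>2"] c by (simp add: power_mult_distrib)
    then show "ennreal (exp ((u x)\<^sup>2 / (\<alpha> * sqrt c)\<^sup>2) - 1) \<le> ennreal (1 / c) * ennreal (exp ((u x)\<^sup>2 / \<alpha>\<^sup>2) - 1)"
      using c by (subst ennreal_mult[symmetric]) (auto intro: ennreal_leI)
  qed
  also have "\<dots> = ennreal (1 / c) * (\<integral>\<^sup>+x. ennreal (exp ((u x)\<^sup>2 / \<alpha>\<^sup>2) - 1) \<partial>lebesgue)"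
    by (rule nn_integral_cmult) measurable
  also have "\<dots> \<le> ennreal (1 / c) * ennreal c" by (intro mult_left_mono c) simp
  also have "\<dots> = 1" using c by (simp add: ennreal_mult[symmetric])
  finally have "\<alpha> * sqrt c \<in> ?S" using \<alpha> c by simp
  then have ne: "?S \<noteq> {}" by blast
  have "Inf ?S < r" using r by (simp add: expL2_norm_def)
  from cInf_lessD[OF ne this] obtain b where b: "b \<in> ?S" "b < r" by (elim bexE) (rule that)
  have "(\<integral>\<^sup>+x. ennreal (exp ((u x)\<^sup>2 / r\<^sup>2) - 1) \<partial>lebesgue) \<le> (\<integral>\<^sup>+x. ennreal (exp ((u x)\<^sup>2 / b\<^sup>2) - 1) \<partial>lebesgue)"
    using b by (intro nn_integral_mono ennreal_leI diff_right_mono) (auto intro!: divide_left_mono power_mono)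
  also have "\<dots> \<le> 1" using b by simp
  finally show ?thesis .
qed

section \<open>The conjugate Young function and the Orlicz pairing\<close>

lemma young_bdd_above: "bdd_above {r * s - (exp (r\<^sup>2) - 1) | r. r \<ge> (0::real)}"
proof (rule bdd_aboveI[of _ "s\<^sup>2"])
  \<comment> \<open>Boundedness gives the \<open>Sup\<close> in the definition its meaning; s^2 is a
    bound because exp (r^2) - 1 \<ge> r^2 and r s \<le> r^2 + s^2.\<close>
  fix y assume "y \<in> {r * s - (exp (r\<^sup>2) - 1) | r. r \<ge> 0}"
  then obtain r where y: "y = r * s - (exp (r\<^sup>2) - 1)" by auto
  have "1 + r\<^sup>2 \<le> exp (r\<^sup>2)" by (rule exp_ge_add_one_self)
  moreover have "r * s \<le> r\<^sup>2 + s\<^sup>2"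
    using sum_squares_bound[of r s] zero_le_power2[of r] zero_le_power2[of s] by linarith
  ultimately show "y \<le> s\<^sup>2" unfolding y by linarith
qed

lemma young_conj_ge: "r \<ge> 0 \<Longrightarrow> r * s - (exp (r\<^sup>2) - 1) \<le> young_conj_expsq s"
  unfolding young_conj_expsq_def by (rule cSup_upper[OF _ young_bdd_above]) auto

lemma young_conj_le:
  assumes "\<And>r. r \<ge> 0 \<Longrightarrow> r * s - (exp (r\<^sup>2) - 1) \<le> c"
  shows "young_conj_expsq s \<le> c"
  unfolding young_conj_expsq_def by (rule cSup_least) (use assms in auto)

lemma young_conj_nonneg: "young_conj_expsq s \<ge> 0"
  using young_conj_ge[of 0 s] by simp

lemma young_conj_0: "young_conj_expsq 0 = 0"
  by (intro antisym young_conj_le young_conj_nonneg) auto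

lemma young_conj_mono: "mono young_conj_expsq"
proof (rule monoI, rule young_conj_le)
  fix s s' r :: real assume "s \<le> s'" "r \<ge> 0"
  then have "r * s \<le> r * s'" by (intro mult_left_mono)
  with young_conj_ge[OF \<open>r \<ge> 0\<close>, of s'] show "r * s - (exp (r\<^sup>2) - 1) \<le> young_conj_expsq s'" by linarith
qed

lemma young_conj_measurable [measurable]: "young_conj_expsq \<in> borel_measurable borel"
  by (rule borel_measurable_mono[OF young_conj_mono])

text \<open>The Delta_2 condition: write r (2 s) = 4 (r / 2) s and use 4 (exp (r^2 / 4) - 1) \<le>
  exp (r^2) - 1.\<close>

lemma young_conj_double: "young_conj_expsq (2 * s) \<le> 4 * young_conj_expsq s"
proof (rule young_conj_le)
  fix r :: real assume r: "r \<ge> 0"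
  have "exp (r\<^sup>2 / 4) - 1 \<le> (exp (r\<^sup>2) - 1) / 4" by (rule expm1_div_le) auto
  moreover have "(r / 2) * s - (exp ((r / 2)\<^sup>2) - 1) \<le> young_conj_expsq s"
    using r by (intro young_conj_ge) simp
  ultimately show "r * (2 * s) - (exp (r\<^sup>2) - 1) \<le> 4 * young_conj_expsq s"
    by (simp add: power_divide)
qed

lemma young_conj_power: "young_conj_expsq (2 ^ k * s) \<le> 4 ^ k * young_conj_expsq s"
proof (induction k)
  case (Suc k)
  have "young_conj_expsq (2 ^ Suc k * s) \<le> 4 * young_conj_expsq (2 ^ k * s)"
    using young_conj_double[of "2 ^ k * s"] by (simp add: mult.assoc)
  with Suc show ?case by simp
qed simp

text \<open>Membership in the predual provides some scale; by doubling, finiteness then holds at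
  every scale, in particular at the small ones needed for the remainder of a test function.\<close>

lemma young_conj_scale_finite:
  assumes [measurable]: "\<phi> \<in> borel_measurable M"
    and fin: "(\<integral>\<^sup>+x. ennreal (young_conj_expsq (\<bar>\<phi> x\<bar> / \<alpha>)) \<partial>M) < \<infinity>" and \<alpha>: "\<alpha> > 0" and \<beta>: "\<beta> > 0"
  shows "(\<integral>\<^sup>+x. ennreal (young_conj_expsq (\<bar>\<phi> x\<bar> / \<beta>)) \<partial>M) < \<infinity>"
proof -
  obtain k where k: "\<alpha> / \<beta> < 2 ^ k" using real_arch_pow[of 2 "\<alpha> / \<beta>"] by auto
  have "young_conj_expsq (\<bar>\<phi> x\<bar> / \<beta>) \<le> 4 ^ k * young_conj_expsq (\<bar>\<phi> x\<bar> / \<alpha>)" for x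
  proof -
    have "\<bar>\<phi> x\<bar> / \<beta> = (\<alpha> / \<beta>) * (\<bar>\<phi> x\<bar> / \<alpha>)" using \<alpha> by simp
    also have "\<dots> \<le> 2 ^ k * (\<bar>\<phi> x\<bar> / \<alpha>)" using k \<alpha> by (intro mult_right_mono) auto
    finally have "young_conj_expsq (\<bar>\<phi> x\<bar> / \<beta>) \<le> young_conj_expsq (2 ^ k * (\<bar>\<phi> x\<bar> / \<alpha>))"
      by (rule monoD[OF young_conj_mono])
    then show ?thesis using young_conj_power by (rule order_trans)
  qed
  then have "(\<integral>\<^sup>+x. ennreal (young_conj_expsq (\<bar>\<phi> x\<bar> / \<beta>)) \<partial>M) \<le> (\<integral>\<^sup>+x. ennreal (4 ^ k) * ennreal (young_conj_expsq (\<bar>\<phi> x\<bar> / \<alpha>)) \<partial>M)"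
    using young_conj_nonneg by (intro nn_integral_mono) (subst ennreal_mult[symmetric], auto intro: ennreal_leI)
  also have "\<dots> = ennreal (4 ^ k) * (\<integral>\<^sup>+x. ennreal (young_conj_expsq (\<bar>\<phi> x\<bar> / \<alpha>)) \<partial>M)"
    by (rule nn_integral_cmult) measurable
  also have "\<dots> < \<infinity>" using fin by (simp add: ennreal_mult_less_top)
  finally show ?thesis .
qed

text \<open>Young's inequality pointwise, after rescaling v by \<alpha> and \<phi> by
  \<beta>.\<close>

lemma orlicz_pairing_le:
  assumes [measurable]: "v \<in> borel_measurable M" "\<phi> \<in> borel_measurable M"
    and \<alpha>: "\<alpha> > 0" and \<beta>: "\<beta> > 0"
    and a: "(\<integral>\<^sup>+x. ennreal (exp ((v x / \<alpha>)\<^sup>2) - 1) \<partial>M) \<le> a"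
    and b: "(\<integral>\<^sup>+x. ennreal (young_conj_expsq (\<bar>\<phi> x\<bar> / \<beta>)) \<partial>M) \<le> b"
  shows "(\<integral>\<^sup>+x. ennreal (\<bar>v x\<bar> * \<bar>\<phi> x\<bar>) \<partial>M) \<le> ennreal (\<alpha> * \<beta>) * (a + b)"
proof -
  have "\<bar>v x\<bar> * \<bar>\<phi> x\<bar> \<le> (\<alpha> * \<beta>) * ((exp ((v x / \<alpha>)\<^sup>2) - 1) + young_conj_expsq (\<bar>\<phi> x\<bar> / \<beta>))" for x
  proof -
    have "(\<bar>v x\<bar> / \<alpha>) * (\<bar>\<phi> x\<bar> / \<beta>) \<le> (exp ((v x / \<alpha>)\<^sup>2) - 1) + young_conj_expsq (\<bar>\<phi> x\<bar> / \<beta>)"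
      using young_conj_ge[of "\<bar>v x\<bar> / \<alpha>" "\<bar>\<phi> x\<bar> / \<beta>"] \<alpha> by (simp add: power_divide)
    then have "(\<alpha> * \<beta>) * ((\<bar>v x\<bar> / \<alpha>) * (\<bar>\<phi> x\<bar> / \<beta>)) \<le> (\<alpha> * \<beta>) * ((exp ((v x / \<alpha>)\<^sup>2) - 1) + young_conj_expsq (\<bar>\<phi> x\<bar> / \<beta>))"
      using \<alpha> \<beta> by (intro mult_left_mono) auto
    then show ?thesis using \<alpha> \<beta> by simp
  qed
  then have "(\<integral>\<^sup>+x. ennreal (\<bar>v x\<bar> * \<bar>\<phi> x\<bar>) \<partial>M)
      \<le> (\<integral>\<^sup>+x. ennreal (\<alpha> * \<beta>) * (ennreal (exp ((v x / \<alpha>)\<^sup>2) - 1) + ennreal (young_conj_expsq (\<bar>\<phi> x\<bar> / \<beta>))) \<partial>M)"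
    using young_conj_nonneg \<alpha> \<beta>
    by (intro nn_integral_mono) (subst ennreal_plus[symmetric], simp, simp, subst ennreal_mult[symmetric], auto intro!: ennreal_leI)
  also have "\<dots> = ennreal (\<alpha> * \<beta>) * ((\<integral>\<^sup>+x. ennreal (exp ((v x / \<alpha>)\<^sup>2) - 1) \<partial>M) + (\<integral>\<^sup>+x. ennreal (young_conj_expsq (\<bar>\<phi> x\<bar> / \<beta>)) \<partial>M))"
    by (simp add: nn_integral_cmult nn_integral_add)
  also have "\<dots> \<le> ennreal (\<alpha> * \<beta>) * (a + b)"
    by (intro mult_left_mono add_mono a b) auto
  finally show ?thesis .
qed

text \<open>From exp z - 1 \<le> z exp z: the sup bound controls the exponential and the L^2 norm
  the factor z. At a fixed scale, a bounded function with small L^2 norm thus has a small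
  modular.\<close>

lemma exp_integral_le_of_L2:
  assumes [measurable]: "w \<in> borel_measurable M" and c: "\<And>x. \<bar>w x\<bar> \<le> c" and \<alpha>: "\<alpha> > 0"
    and b: "(\<integral>\<^sup>+x. ennreal ((w x)\<^sup>2) \<partial>M) \<le> ennreal b" "b \<ge> 0"
  shows "(\<integral>\<^sup>+x. ennreal (exp ((w x / \<alpha>)\<^sup>2) - 1) \<partial>M) \<le> ennreal (exp ((c / \<alpha>)\<^sup>2) / \<alpha>\<^sup>2 * b)"
proof -
  have "exp ((w x / \<alpha>)\<^sup>2) - 1 \<le> exp ((c / \<alpha>)\<^sup>2) / \<alpha>\<^sup>2 * (w x)\<^sup>2" for x
  proof -
    let ?z = "(w x / \<alpha>)\<^sup>2"
    have "1 + (- ?z) \<le> exp (- ?z)" by (rule exp_ge_add_one_self)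
    then have "exp ?z * (1 - ?z) \<le> exp ?z * exp (- ?z)" by (intro mult_left_mono) auto
    then have 1: "exp ?z - 1 \<le> exp ?z * ?z" by (simp add: exp_add[symmetric] algebra_simps)
    have "?z \<le> (c / \<alpha>)\<^sup>2"
      using c[of x] \<alpha> unfolding power_divide by (intro divide_right_mono) (metis abs_ge_zero abs_of_nonneg order_trans power2_abs power_mono, simp)
    then have "exp ?z * ?z \<le> exp ((c / \<alpha>)\<^sup>2) * ?z" by (intro mult_right_mono) auto
    with 1 show ?thesis by (simp add: power_divide)
  qed
  then have "(\<integral>\<^sup>+x. ennreal (exp ((w x / \<alpha>)\<^sup>2) - 1) \<partial>M) \<le> (\<integral>\<^sup>+x. ennreal (exp ((c / \<alpha>)\<^sup>2) / \<alpha>\<^sup>2) * ennreal ((w x)\<^sup>2) \<partial>M)"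
    by (intro nn_integral_mono) (subst ennreal_mult[symmetric], auto intro!: ennreal_leI)
  also have "\<dots> = ennreal (exp ((c / \<alpha>)\<^sup>2) / \<alpha>\<^sup>2) * (\<integral>\<^sup>+x. ennreal ((w x)\<^sup>2) \<partial>M)"
    by (rule nn_integral_cmult) measurable
  also have "\<dots> \<le> ennreal (exp ((c / \<alpha>)\<^sup>2) / \<alpha>\<^sup>2) * ennreal b" by (intro mult_left_mono b) simp
  also have "\<dots> = ennreal (exp ((c / \<alpha>)\<^sup>2) / \<alpha>\<^sup>2 * b)" using b by (intro ennreal_mult[symmetric]) auto
  finally show ?thesis .
qed

text \<open>Truncation gives a bounded v with bounded support near u. As a measurable function, v is
  an a.e. limit of continuous ones; clipping these and cutting them off makes dominated convergence
  applicable. Each error is at most \<delta> / 4, since squaring a sum costs a factor 2.\<close>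

lemma L2_approx_continuous:
  fixes u :: "'a::euclidean_space \<Rightarrow> real"
  assumes [measurable]: "u \<in> borel_measurable borel" and u2: "(\<integral>\<^sup>+x. ennreal ((u x)\<^sup>2) \<partial>lborel) < \<infinity>" and \<delta>: "\<delta> > 0"
  obtains G b where "continuous_on UNIV G" "\<And>x. \<bar>G x\<bar> \<le> b" "(\<integral>\<^sup>+x. ennreal ((u x - G x)\<^sup>2) \<partial>lborel) \<le> ennreal \<delta>"
proof -
  define v where "v n x = (if \<bar>u x\<bar> \<le> real n \<and> norm x \<le> real n then u x else 0)" for n x
  have [measurable]: "v n \<in> borel_measurable borel" for n unfolding v_def by measurable
  have "(\<lambda>n. \<integral>\<^sup>+x. ennreal ((u x - v n x)\<^sup>2) \<partial>lborel) \<longlonglongrightarrow> (\<integral>\<^sup>+(x::'a). 0 \<partial>lborel)"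
  proof (rule nn_integral_dominated_convergence[where w = "\<lambda>x. ennreal ((u x)\<^sup>2)"])
    show "AE x in lborel. ennreal ((u x - v n x)\<^sup>2) \<le> ennreal ((u x)\<^sup>2)" for n
      by (intro AE_I2 ennreal_leI) (auto simp: v_def)
    have "(\<lambda>n. ennreal ((u x - v n x)\<^sup>2)) \<longlonglongrightarrow> 0" for x
    proof (rule tendsto_eventually)
      obtain k :: nat where "\<bar>u x\<bar> + norm x \<le> real k" using real_arch_simple by blast
      then show "eventually (\<lambda>n. ennreal ((u x - v n x)\<^sup>2) = 0) sequentially"
        unfolding eventually_sequentially
      proof (intro exI[of _ k] allI impI)
        fix n assume "k \<le> n"
        then have "\<bar>u x\<bar> + norm x \<le> real n" using \<open>_ \<le> real k\<close> by linarith
        then have "\<bar>u x\<bar> \<le> real n \<and> norm x \<le> real n"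
          using norm_ge_zero[of x] abs_ge_zero[of "u x"] by linarith
        then show "ennreal ((u x - v n x)\<^sup>2) = 0" by (simp add: v_def)
      qed
    qed
    then show "AE x in lborel. (\<lambda>n. ennreal ((u x - v n x)\<^sup>2)) \<longlonglongrightarrow> 0" by simp
  qed (use u2 in auto)
  then have "(\<lambda>n. \<integral>\<^sup>+x. ennreal ((u x - v n x)\<^sup>2) \<partial>lborel) \<longlonglongrightarrow> 0" by simp
  then have "eventually (\<lambda>n. (\<integral>\<^sup>+x. ennreal ((u x - v n x)\<^sup>2) \<partial>lborel) < ennreal (\<delta> / 4)) sequentially"
    by (rule order_tendstoD) (use \<delta> in simp)
  then obtain n where n: "(\<integral>\<^sup>+x. ennreal ((u x - v n x)\<^sup>2) \<partial>lborel) \<le> ennreal (\<delta> / 4)"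
    by (meson eventually_sequentially less_imp_le order_refl)
  have "v n measurable_on UNIV"
    by (rule lebesgue_measurable_imp_measurable_on_real) (auto intro: measurable_completion)
  then obtain Z h where Z: "negligible Z" and hc: "\<And>k. continuous_on UNIV (h k)"
    and hlim: "\<And>x. x \<notin> Z \<Longrightarrow> (\<lambda>k. h k x) \<longlonglongrightarrow> v n x"
    unfolding measurable_on_def by auto
  \<comment> \<open>A continuous cutoff, equal to 1 where v n may be nonzero and to 0 for |x| \<ge>
    n + 1.\<close>
  define \<theta> where "\<theta> x = max 0 (min 1 (real n + 1 - norm x))" for x :: 'a
  define G where "G k x = \<theta> x * max (- real n) (min (real n) (h k x))" for k x
  have Gc: "continuous_on UNIV (G k)" for k
    unfolding G_def \<theta>_def by (intro continuous_intros hc)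
  have [measurable]: "G k \<in> borel_measurable borel" for k by (rule borel_measurable_continuous_onI[OF Gc])
  have \<theta>: "0 \<le> \<theta> x" "\<theta> x \<le> 1" for x by (auto simp: \<theta>_def)
  have Gb: "\<bar>G k x\<bar> \<le> real n" for k x
  proof -
    have "\<bar>G k x\<bar> \<le> 1 * real n" unfolding G_def abs_mult using \<theta>[of x] by (intro mult_mono) auto
    then show ?thesis by simp
  qed
  have [measurable]: "cball (0::'a) (real n + 1) \<in> sets borel" by (simp add: borel_closed)
  have vb: "\<bar>v n x\<bar> \<le> real n" for x by (simp add: v_def)
  have v\<theta>: "\<theta> x * v n x = v n x" for x by (auto simp: v_def \<theta>_def)
  have "(\<lambda>k. \<integral>\<^sup>+x. ennreal ((v n x - G k x)\<^sup>2) \<partial>lborel) \<longlonglongrightarrow> (\<integral>\<^sup>+(x::'a). 0 \<partial>lborel)"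
  proof (rule nn_integral_dominated_convergence[where w = "\<lambda>x. ennreal ((2 * real n)\<^sup>2) * indicator (cball 0 (real n + 1)) x"])
    show "(\<integral>\<^sup>+x. ennreal ((2 * real n)\<^sup>2) * indicator (cball (0::'a) (real n + 1)) x \<partial>lborel) < \<infinity>"
      using emeasure_lborel_cball_finite[of "0::'a" "real n + 1"]
      by (subst nn_integral_cmult_indicator) (auto simp: ennreal_mult_less_top less_top)
    show "AE x in lborel. ennreal ((v n x - G k x)\<^sup>2) \<le> ennreal ((2 * real n)\<^sup>2) * indicator (cball 0 (real n + 1)) x" for k
    proof (rule AE_I2)
      fix x :: 'a
      show "ennreal ((v n x - G k x)\<^sup>2) \<le> ennreal ((2 * real n)\<^sup>2) * indicator (cball 0 (real n + 1)) x"
      proof (cases "norm x \<le> real n + 1")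
        case True
        have "\<bar>v n x - G k x\<bar> \<le> \<bar>2 * real n\<bar>" using Gb[of k x] vb[of x] by linarith
        then have "(v n x - G k x)\<^sup>2 \<le> (2 * real n)\<^sup>2" by (simp only: abs_le_square_iff)
        with True show ?thesis by (simp add: ennreal_leI)
      qed (simp add: G_def \<theta>_def v_def)
    qed
    have "AE x in lebesgue. x \<notin> Z"
      using Z by (intro AE_not_in) (simp add: negligible_iff_null_sets)
    then have "AE x in lborel. x \<notin> Z" by (simp only: AE_completion_iff)
    then show "AE x in lborel. (\<lambda>k. ennreal ((v n x - G k x)\<^sup>2)) \<longlonglongrightarrow> 0"
    proof eventually_elim
      case (elim x)
      have "(\<lambda>k. G k x) \<longlonglongrightarrow> \<theta> x * max (- real n) (min (real n) (v n x))"
        unfolding G_def by (intro tendsto_intros hlim elim)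
      also have "\<theta> x * max (- real n) (min (real n) (v n x)) = v n x"
      proof -
        have "max (- real n) (min (real n) (v n x)) = v n x" using vb[of x] by (simp add: abs_le_iff)
        then show ?thesis by (simp only: v\<theta>)
      qed
      finally have "(\<lambda>k. ennreal ((v n x - G k x)\<^sup>2)) \<longlonglongrightarrow> ennreal ((v n x - v n x)\<^sup>2)"
        by (intro tendsto_intros)
      then show ?case by simp
    qed
  qed measurable
  then have "(\<lambda>k. \<integral>\<^sup>+x. ennreal ((v n x - G k x)\<^sup>2) \<partial>lborel) \<longlonglongrightarrow> 0" by simp
  then have "eventually (\<lambda>k. (\<integral>\<^sup>+x. ennreal ((v n x - G k x)\<^sup>2) \<partial>lborel) < ennreal (\<delta> / 4)) sequentially"
    by (rule order_tendstoD) (use \<delta> in simp)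
  then obtain k where k: "(\<integral>\<^sup>+x. ennreal ((v n x - G k x)\<^sup>2) \<partial>lborel) \<le> ennreal (\<delta> / 4)"
    by (meson eventually_sequentially less_imp_le order_refl)
  have sq: "(a + b)\<^sup>2 \<le> 2 * a\<^sup>2 + 2 * b\<^sup>2" for a b :: real
    using sum_squares_bound[of a b] by (simp add: power2_sum)
  have "(\<integral>\<^sup>+x. ennreal ((u x - G k x)\<^sup>2) \<partial>lborel) \<le> (\<integral>\<^sup>+x. 2 * ennreal ((u x - v n x)\<^sup>2) + 2 * ennreal ((v n x - G k x)\<^sup>2) \<partial>lborel)"
  proof (rule nn_integral_mono)
    fix x
    have "(u x - G k x)\<^sup>2 = ((u x - v n x) + (v n x - G k x))\<^sup>2" by simp
    also have "\<dots> \<le> 2 * (u x - v n x)\<^sup>2 + 2 * (v n x - G k x)\<^sup>2"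
      by (rule sq)
    finally show "ennreal ((u x - G k x)\<^sup>2) \<le> 2 * ennreal ((u x - v n x)\<^sup>2) + 2 * ennreal ((v n x - G k x)\<^sup>2)"
      by (simp add: ennreal_plus[symmetric] ennreal_mult[symmetric] ennreal_numeral[symmetric] ennreal_leI del: ennreal_plus ennreal_numeral)
  qed
  also have "\<dots> = 2 * (\<integral>\<^sup>+x. ennreal ((u x - v n x)\<^sup>2) \<partial>lborel) + 2 * (\<integral>\<^sup>+x. ennreal ((v n x - G k x)\<^sup>2) \<partial>lborel)"
    by (simp add: nn_integral_add nn_integral_cmult)
  also have "\<dots> \<le> 2 * ennreal (\<delta> / 4) + 2 * ennreal (\<delta> / 4)"
    by (intro add_mono mult_left_mono n k) auto
  also have "\<dots> = ennreal \<delta>"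
    using \<delta> by (simp add: ennreal_plus[symmetric] ennreal_mult[symmetric] ennreal_numeral[symmetric] del: ennreal_plus ennreal_numeral)
  finally show ?thesis using that[OF Gc Gb] by blast
qed

section \<open>Convergence to the initial datum\<close>

lemma tendsto_ennreal_0I:
  fixes f :: "'b \<Rightarrow> ennreal"
  assumes "\<And>e. e > 0 \<Longrightarrow> eventually (\<lambda>x. f x \<le> ennreal e) F"
  shows "(f \<longlongrightarrow> 0) F"
proof (rule order_tendstoI)
  fix a :: ennreal assume "0 < a"
  then obtain c where c: "0 < c" "c < a" using dense by blast
  then obtain e where e: "c = ennreal e" "e > 0"
    by (cases c) (auto simp: ennreal_less_zero_iff)
  show "eventually (\<lambda>x. f x < a) F"
    using assms[OF e(2)] by eventually_elim (use c e in auto)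
qed simp

text \<open>|X| \<le> \<eta> + X^2 / \<eta>, with \<eta> left free; a ball has finite measure, so
  L^2 smallness becomes L^1 smallness there.\<close>

lemma nn_integral_cball_le_L2:
  fixes X :: "'a::euclidean_space \<Rightarrow> real"
  assumes [measurable]: "X \<in> borel_measurable borel" and X2: "(\<integral>\<^sup>+x. ennreal ((X x)\<^sup>2) \<partial>lborel) \<le> ennreal b"
    and b: "b \<ge> 0" and \<eta>: "\<eta> > 0"
  shows "(\<integral>\<^sup>+x\<in>cball 0 R. ennreal \<bar>X x\<bar> \<partial>lborel) \<le> ennreal (\<eta> * measure lborel (cball (0::'a) R) + b / \<eta>)"
proof -
  have [measurable]: "cball (0::'a) R \<in> sets borel" by (simp add: borel_closed)
  have "\<bar>X x\<bar> \<le> \<eta> + (1 / \<eta>) * (X x)\<^sup>2" for x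
  proof -
    have "2 * \<eta> * \<bar>X x\<bar> \<le> \<eta>\<^sup>2 + (X x)\<^sup>2" using sum_squares_bound[of \<eta> "\<bar>X x\<bar>"] by simp
    moreover have "0 \<le> \<eta> * \<bar>X x\<bar>" using \<eta> by simp
    ultimately have "\<eta> * \<bar>X x\<bar> \<le> \<eta>\<^sup>2 + (X x)\<^sup>2" by linarith
    then have "\<eta> * \<bar>X x\<bar> \<le> \<eta> * (\<eta> + (1 / \<eta>) * (X x)\<^sup>2)"
      using \<eta> by (simp add: power2_eq_square distrib_left)
    then show ?thesis using \<eta> by simp
  qed
  then have "(\<integral>\<^sup>+x\<in>cball 0 R. ennreal \<bar>X x\<bar> \<partial>lborel)
     \<le> (\<integral>\<^sup>+x. ennreal \<eta> * indicator (cball 0 R) x + ennreal (1 / \<eta>) * ennreal ((X x)\<^sup>2) \<partial>lborel)"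
    using \<eta> by (intro nn_integral_mono)
      (auto split: split_indicator simp: ennreal_mult[symmetric] ennreal_plus[symmetric] ennreal_leI simp del: ennreal_plus)
  also have "\<dots> = ennreal \<eta> * emeasure lborel (cball (0::'a) R) + ennreal (1 / \<eta>) * (\<integral>\<^sup>+x. ennreal ((X x)\<^sup>2) \<partial>lborel)"
    by (subst nn_integral_add) (auto simp: nn_integral_cmult nn_integral_cmult_indicator)
  also have "\<dots> \<le> ennreal \<eta> * ennreal (measure lborel (cball (0::'a) R)) + ennreal (1 / \<eta>) * ennreal b"
    using emeasure_lborel_cball_finite[of "0::'a" R]
    by (intro add_mono mult_left_mono X2) (auto simp: emeasure_eq_ennreal_measure less_top)
  also have "\<dots> = ennreal (\<eta> * measure lborel (cball (0::'a) R) + b / \<eta>)"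
    using \<eta> b by (simp add: ennreal_mult[symmetric] ennreal_plus[symmetric] del: ennreal_plus)
  finally show ?thesis .
qed

lemma nn_integral_add3:
  assumes [measurable]: "f \<in> borel_measurable M" "g \<in> borel_measurable M" "h \<in> borel_measurable M"
  shows "(\<integral>\<^sup>+x. f x + (g x + h x) \<partial>M) = (\<integral>\<^sup>+x. f x \<partial>M) + ((\<integral>\<^sup>+x. g x \<partial>M) + (\<integral>\<^sup>+x. h x \<partial>M))"
  by (simp add: nn_integral_add)

text \<open>Existence rests on the domination of E by K; the return to the initial datum also uses
  that E is an approximate identity.\<close>

locale semilinear_flow = semilinear K A kap g m C0 lam E f
  for K :: "real \<times> 'a::euclidean_space \<Rightarrow> real" and A kap g m C0 lam E f +
  assumes E_approx: "\<And>G b x. continuous_on UNIV G \<Longrightarrow> (\<And>x. \<bar>G x\<bar> \<le> b) \<Longrightarrow>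
    ((\<lambda>t. \<integral>y. E (t, x - y) * G y \<partial>lborel) \<longlongrightarrow> G x) (at_right 0)"
begin

lemma integrable_K_u0:
  assumes \<rho>: "\<rho> > 0" and u0: "small_data \<rho> u0" and t: "t > 0"
  shows "integrable lborel (\<lambda>y. K (t, x - y) * \<bar>u0 y\<bar>)"
proof -
  have [measurable]: "u0 \<in> borel_measurable borel" using u0 by (simp add: small_data_def)
  show ?thesis
    using heatV_eq_nn[OF \<rho> u0 t, of x] by (intro integrableI_nonneg) (auto simp: K_nonneg)
qed

lemma integrable_K_bounded:
  assumes [measurable]: "G \<in> borel_measurable borel" and b: "\<And>x. \<bar>G x\<bar> \<le> b" and t: "t > 0"
  shows "integrable lborel (\<lambda>y. K (t, x - y) * \<bar>G y\<bar>)"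
proof -
  have i: "integrable lborel (\<lambda>y. K (t, x - y))"
    using K_mass_shift[OF t, of x] by (intro integrableI_nonneg) (auto simp: K_nonneg)
  have "integrable lborel (\<lambda>y. K (t, x - y) * b)" using i by (rule integrable_mult_left)
  then show ?thesis
    by (rule Bochner_Integration.integrable_bound)
      (auto simp: abs_mult K_nonneg intro!: mult_left_mono order.trans[OF b abs_ge_self])
qed

lemma heatE_bounded:
  assumes [measurable]: "G \<in> borel_measurable borel" and b: "\<And>x. \<bar>G x\<bar> \<le> b" and t: "t > 0"
  shows "\<bar>heatE G (t, x)\<bar> \<le> kap * b"
proof -
  have i: "integrable lborel (\<lambda>y. K (t, x - y))"
    using K_mass_shift[OF t, of x] by (intro integrableI_nonneg) (auto simp: K_nonneg)
  have "(\<integral>y. K (t, x - y) \<partial>lborel) = kap"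
    using K_mass_shift[OF t, of x] kap_pos by (subst integral_eq_nn_integral) (auto simp: K_nonneg)
  then have eq: "(\<integral>y. K (t, x - y) * b \<partial>lborel) = kap * b" by simp
  have iE: "integrable lborel (\<lambda>y. E (t, x - y) * G y)"
    by (rule Bochner_Integration.integrable_bound[OF integrable_K_bounded[OF assms(1) b t, of x]])
      (auto simp: abs_mult K_nonneg intro!: mult_right_mono E_le)
  have "\<bar>(\<integral>y. E (t, x - y) * G y \<partial>lborel)\<bar> \<le> (\<integral>y. K (t, x - y) * b \<partial>lborel)"
    by (rule Bochner_Integration.integral_abs_bound_integral[OF iE])
      (auto intro!: abs_E_mult_le b integrable_mult_left i)
  then show ?thesis unfolding heatE_def eq by simp
qed

lemma heatE_diff_le:
  assumes \<rho>: "\<rho> > 0" and u0: "small_data \<rho> u0" and t: "t > 0"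
    and [measurable]: "G \<in> borel_measurable borel" and b: "\<And>x. \<bar>G x\<bar> \<le> b"
  shows "\<bar>heatE u0 (t, x) - heatE G (t, x)\<bar> \<le> heatV (\<lambda>y. u0 y - G y) (t, x)"
proof -
  have [measurable]: "u0 \<in> borel_measurable borel" using u0 by (simp add: small_data_def)
  note i = integrable_K_u0[OF \<rho> u0 t, of x] integrable_K_bounded[OF assms(4) b t, of x]
  have iE: "integrable lborel (\<lambda>y. E (t, x - y) * u0 y)" "integrable lborel (\<lambda>y. E (t, x - y) * G y)"
    by (rule Bochner_Integration.integrable_bound[OF i(1)] Bochner_Integration.integrable_bound[OF i(2)],
        auto simp: abs_mult K_nonneg intro!: mult_right_mono E_le)+
  have iK: "integrable lborel (\<lambda>y. K (t, x - y) * \<bar>u0 y - G y\<bar>)"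
  proof (rule Bochner_Integration.integrable_bound[OF Bochner_Integration.integrable_add[OF i]])
    show "AE y in lborel. norm (K (t, x - y) * \<bar>u0 y - G y\<bar>) \<le> norm (K (t, x - y) * \<bar>u0 y\<bar> + K (t, x - y) * \<bar>G y\<bar>)"
      by (intro AE_I2) (auto simp: K_nonneg distrib_left[symmetric] abs_mult intro!: mult_left_mono)
  qed measurable
  have "heatE u0 (t, x) - heatE G (t, x) = (\<integral>y. E (t, x - y) * (u0 y - G y) \<partial>lborel)"
    unfolding heatE_def right_diff_distrib using Bochner_Integration.integral_diff[OF iE] by simp
  also have "\<bar>\<dots>\<bar> \<le> (\<integral>y. K (t, x - y) * \<bar>u0 y - G y\<bar> \<partial>lborel)"
  proof (rule Bochner_Integration.integral_abs_bound_integral)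
    show "integrable lborel (\<lambda>y. E (t, x - y) * (u0 y - G y))"
      unfolding right_diff_distrib by (rule Bochner_Integration.integrable_diff[OF iE])
  qed (auto intro!: abs_E_mult_le iK)
  also have "\<dots> = heatV (\<lambda>y. u0 y - G y) (t, x)"
    unfolding heatV_def by (simp, rule integral_eq_nn_integral) (auto simp: K_nonneg)
  finally show ?thesis .
qed

text \<open>Jensen for the square, as for the exponential in \<open>heatV_exp\<close>.\<close>

lemma heatV_L2:
  assumes [measurable]: "h \<in> borel_measurable borel" and t: "t > 0"
    and b: "(\<integral>\<^sup>+y. ennreal ((h y)\<^sup>2) \<partial>lborel) \<le> ennreal b" "b \<ge> 0"
  shows "(\<integral>\<^sup>+x. ennreal ((heatV h (t, x))\<^sup>2) \<partial>lborel) \<le> ennreal (kap\<^sup>2 * b)"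
proof -
  have J: "ennreal ((heatV h (t, x))\<^sup>2) \<le> ennreal kap * (\<integral>\<^sup>+y. ennreal (K (t, x - y)) * ennreal ((h y)\<^sup>2) \<partial>lborel)" for x
  proof -
    have "ennreal (kap * (enn2real (\<integral>\<^sup>+y. ennreal (K (t, x - y) * \<bar>h y\<bar>) \<partial>lborel) / kap)\<^sup>2) \<le> (\<integral>\<^sup>+y. ennreal (K (t, x - y) * \<bar>h y\<bar>\<^sup>2) \<partial>lborel)"
    proof (rule nn_integral_Jensen[OF _ _ _ _ _ K_mass_shift[OF t] kap_pos])
      fix z :: real assume z: "z \<ge> 0"
      have "z\<^sup>2 + 2 * z * (y - z) \<le> y\<^sup>2" for y
        using zero_le_power2[of "y - z"] by (simp add: power2_eq_square algebra_simps)
      then show "\<exists>c\<ge>0. \<forall>y\<ge>0. z\<^sup>2 + c * (y - z) \<le> y\<^sup>2" using z by (intro exI[of _ "2 * z"]) auto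
    qed (auto simp: K_nonneg)
    then have "ennreal kap * ennreal (kap * (heatV h (t, x) / kap)\<^sup>2) \<le> ennreal kap * (\<integral>\<^sup>+y. ennreal (K (t, x - y)) * ennreal ((h y)\<^sup>2) \<partial>lborel)"
      by (intro mult_left_mono) (auto simp: heatV_def ennreal_mult K_nonneg)
    moreover have "ennreal kap * ennreal (kap * (heatV h (t, x) / kap)\<^sup>2) = ennreal ((heatV h (t, x))\<^sup>2)"
      using kap_pos by (subst ennreal_mult[symmetric]) (auto simp: power2_eq_square)
    ultimately show ?thesis by simp
  qed
  have "(\<integral>\<^sup>+x. ennreal ((heatV h (t, x))\<^sup>2) \<partial>lborel) \<le> (\<integral>\<^sup>+x. ennreal kap * (\<integral>\<^sup>+y. ennreal (K (t, x - y)) * ennreal ((h y)\<^sup>2) \<partial>lborel) \<partial>lborel)"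
    by (intro nn_integral_mono J)
  also have "\<dots> = ennreal kap * (ennreal kap * (\<integral>\<^sup>+y. ennreal ((h y)\<^sup>2) \<partial>lborel))"
    by (subst nn_integral_cmult) (auto simp: K_conv_mass[OF t])
  also have "\<dots> \<le> ennreal kap * (ennreal kap * ennreal b)" by (intro mult_left_mono b) auto
  also have "\<dots> = ennreal (kap\<^sup>2 * b)"
    using kap_pos b by (simp add: ennreal_mult[symmetric] power2_eq_square mult.assoc)
  finally show ?thesis .
qed

text \<open>Compare u0 with a bounded continuous G near it in L^2. The transported error is bounded
  in L^2 by \<open>heatV_L2\<close>, and on G the convolution converges pointwise and
  boundedly.\<close>

lemma heatE_local_L1:
  assumes \<rho>: "\<rho> > 0" and u0: "small_data \<rho> u0"
    and X: "\<And>i::nat. X i > 0" "X \<longlonglongrightarrow> 0"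
  shows "(\<lambda>i. \<integral>\<^sup>+x\<in>cball 0 R. ennreal \<bar>heatE u0 (X i, x) - u0 x\<bar> \<partial>lborel) \<longlonglongrightarrow> 0"
proof (rule tendsto_ennreal_0I)
  fix e :: real assume e: "e > 0"
  have [measurable]: "u0 \<in> borel_measurable borel" using u0 by (simp add: small_data_def)
  have [measurable]: "cball (0::'a) R \<in> sets borel" by (simp add: borel_closed)
  define \<beta> where "\<beta> = measure lborel (cball (0::'a) R)"
  have \<beta>: "\<beta> \<ge> 0" by (simp add: \<beta>_def)
  \<comment> \<open>\<eta> and \<delta> make each of \<eta> \<beta> (which occurs twice), kap^2
    \<delta> / \<eta> and \<delta> / \<eta> at most e / 8; the middle term, with G, takes the
    remaining e / 2.\<close>
  define \<eta> where "\<eta> = e / (8 * (\<beta> + 1))"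
  have \<eta>: "\<eta> > 0" using e \<beta> by (simp add: \<eta>_def)
  have \<eta>\<beta>: "\<eta> * \<beta> \<le> e / 8" using e \<beta> by (simp add: \<eta>_def field_simps)
  define \<delta> where "\<delta> = \<eta> * e / (8 * (kap\<^sup>2 + 1))"
  have \<delta>: "\<delta> > 0" using \<eta> e by (simp add: \<delta>_def add_nonneg_pos)
  have \<delta>1: "(kap\<^sup>2 * \<delta>) / \<eta> \<le> e / 8" "\<delta> / \<eta> \<le> e / 8"
  proof -
    define q where "q = e / (8 * (kap\<^sup>2 + 1))"
    have k1: "kap\<^sup>2 + 1 > 0" by (rule add_nonneg_pos) auto
    have q: "q \<ge> 0" "kap\<^sup>2 * q \<ge> 0" using e k1 by (auto simp: q_def)
    have eq: "\<delta> / \<eta> = q" using \<eta> by (simp add: \<delta>_def q_def)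
    have "e / (8 * k) * k = e / 8" if "k > 0" for k :: real using that by simp
    from this[OF k1] have "q * (kap\<^sup>2 + 1) = e / 8" unfolding q_def .
    then have "kap\<^sup>2 * q + q = e / 8" by (simp add: distrib_left mult.commute)
    then have "kap\<^sup>2 * q \<le> e / 8" "q \<le> e / 8" using q by linarith+
    then show "(kap\<^sup>2 * \<delta>) / \<eta> \<le> e / 8" "\<delta> / \<eta> \<le> e / 8"
      unfolding times_divide_eq_right[symmetric] eq .
  qed
  have "(\<integral>\<^sup>+x. ennreal ((u0 x)\<^sup>2) \<partial>lborel) < \<infinity>"
    using le_less_trans[OF small_data_L2[OF \<rho> u0] ennreal_less_top] by simp
  then obtain G b where Gc: "continuous_on UNIV G" and b: "\<And>x. \<bar>G x\<bar> \<le> b"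
    and G2: "(\<integral>\<^sup>+x. ennreal ((u0 x - G x)\<^sup>2) \<partial>lborel) \<le> ennreal \<delta>"
    using L2_approx_continuous[of u0 \<delta>] \<delta> by auto
  have Gm[measurable]: "G \<in> borel_measurable borel" by (rule borel_measurable_continuous_onI[OF Gc])
  have b0: "b \<ge> 0" using b[of 0] by linarith
  have mid: "(\<lambda>i. \<integral>\<^sup>+x. ennreal \<bar>heatE G (X i, x) - G x\<bar> * indicator (cball 0 R) x \<partial>lborel) \<longlonglongrightarrow> (\<integral>\<^sup>+(x::'a). 0 \<partial>lborel)"
  proof (rule nn_integral_dominated_convergence[where w = "\<lambda>x. ennreal (kap * b + b) * indicator (cball 0 R) x"])
    show "(\<integral>\<^sup>+x. ennreal (kap * b + b) * indicator (cball (0::'a) R) x \<partial>lborel) < \<infinity>"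
      using emeasure_lborel_cball_finite[of "0::'a" R]
      by (subst nn_integral_cmult_indicator) (auto simp: ennreal_mult_less_top less_top)
    show "AE x in lborel. ennreal \<bar>heatE G (X i, x) - G x\<bar> * indicator (cball 0 R) x \<le> ennreal (kap * b + b) * indicator (cball 0 R) x" for i
    proof (intro AE_I2 mult_right_mono ennreal_leI)
      fix x show "\<bar>heatE G (X i, x) - G x\<bar> \<le> kap * b + b"
        using heatE_bounded[OF Gm b X(1), of i x] b[of x] by linarith
    qed simp
    show "AE x in lborel. (\<lambda>i. ennreal \<bar>heatE G (X i, x) - G x\<bar> * indicator (cball 0 R) x) \<longlonglongrightarrow> 0"
    proof (rule AE_I2)
      fix x :: 'a
      have "(\<lambda>i. heatE G (X i, x)) \<longlonglongrightarrow> G x"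
        using E_approx[OF Gc b, of x] X unfolding tendsto_at_iff_sequentially heatE_def by (auto simp: o_def)
      then have "(\<lambda>i. ennreal \<bar>heatE G (X i, x) - G x\<bar>) \<longlonglongrightarrow> ennreal \<bar>G x - G x\<bar>"
        by (intro tendsto_intros)
      then show "(\<lambda>i. ennreal \<bar>heatE G (X i, x) - G x\<bar> * indicator (cball 0 R) x) \<longlonglongrightarrow> 0"
        by (cases "x \<in> cball 0 R") auto
    qed
  qed measurable
  then have "eventually (\<lambda>i. (\<integral>\<^sup>+x. ennreal \<bar>heatE G (X i, x) - G x\<bar> * indicator (cball 0 R) x \<partial>lborel) < ennreal (e / 2)) sequentially"
    by (intro order_tendstoD(2)[OF mid]) (use e in simp)
  then show "eventually (\<lambda>i. (\<integral>\<^sup>+x\<in>cball 0 R. ennreal \<bar>heatE u0 (X i, x) - u0 x\<bar> \<partial>lborel) \<le> ennreal e) sequentially"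
  proof eventually_elim
    case (elim i)
    let ?h = "\<lambda>y. u0 y - G y"
    let ?I = "indicator (cball (0::'a) R) :: 'a \<Rightarrow> ennreal"
    have "(\<integral>\<^sup>+x. ennreal \<bar>heatE u0 (X i, x) - u0 x\<bar> * ?I x \<partial>lborel)
       \<le> (\<integral>\<^sup>+x. ennreal \<bar>heatV ?h (X i, x)\<bar> * ?I x + (ennreal \<bar>heatE G (X i, x) - G x\<bar> * ?I x + ennreal \<bar>?h x\<bar> * ?I x) \<partial>lborel)"
    proof (rule nn_integral_mono)
      fix x
      have "\<bar>heatE u0 (X i, x) - u0 x\<bar> \<le> \<bar>heatV ?h (X i, x)\<bar> + (\<bar>heatE G (X i, x) - G x\<bar> + \<bar>?h x\<bar>)"
        using heatE_diff_le[OF \<rho> u0 X(1) Gm b, of i x] by linarith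
      then have "ennreal \<bar>heatE u0 (X i, x) - u0 x\<bar> \<le> ennreal \<bar>heatV ?h (X i, x)\<bar> + (ennreal \<bar>heatE G (X i, x) - G x\<bar> + ennreal \<bar>?h x\<bar>)"
        by (simp add: ennreal_plus[symmetric] ennreal_leI del: ennreal_plus)
      then show "ennreal \<bar>heatE u0 (X i, x) - u0 x\<bar> * ?I x \<le> ennreal \<bar>heatV ?h (X i, x)\<bar> * ?I x + (ennreal \<bar>heatE G (X i, x) - G x\<bar> * ?I x + ennreal \<bar>?h x\<bar> * ?I x)"
        by (auto split: split_indicator)
    qed
    also have "\<dots> = (\<integral>\<^sup>+x. ennreal \<bar>heatV ?h (X i, x)\<bar> * ?I x \<partial>lborel)
        + ((\<integral>\<^sup>+x. ennreal \<bar>heatE G (X i, x) - G x\<bar> * ?I x \<partial>lborel) + (\<integral>\<^sup>+x. ennreal \<bar>?h x\<bar> * ?I x \<partial>lborel))"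
      by (rule nn_integral_add3) measurable
    also have "\<dots> \<le> ennreal (\<eta> * \<beta> + (kap\<^sup>2 * \<delta>) / \<eta>) + (ennreal (e / 2) + ennreal (\<eta> * \<beta> + \<delta> / \<eta>))"
      unfolding \<beta>_def
    proof (intro add_mono nn_integral_cball_le_L2)
      show "(\<integral>\<^sup>+x. ennreal ((heatV ?h (X i, x))\<^sup>2) \<partial>lborel) \<le> ennreal (kap\<^sup>2 * \<delta>)"
        by (rule heatV_L2) (use X G2 \<delta> in auto)
    qed (use elim G2 \<delta> \<eta> in auto)
    also have "\<dots> = ennreal ((\<eta> * \<beta> + (kap\<^sup>2 * \<delta>) / \<eta>) + (e / 2 + (\<eta> * \<beta> + \<delta> / \<eta>)))"
      using \<eta> \<beta> \<delta> e by (subst ennreal_plus[symmetric], simp, simp)+ simp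
    also have "\<dots> \<le> ennreal e"
      by (intro ennreal_leI) (use \<eta>\<beta> \<delta>1 in linarith)
    finally show ?case .
  qed
qed

text \<open>\<open>\<phi>\<close> is cut into a bounded part with bounded support, where local convergence in \<open>L\<^sup>1\<close> suffices, and a
  remainder with small Luxemburg norm; the latter exists because the conjugate Young function is doubling.\<close>

lemma weak_star_convergence:
  assumes \<rho>: "\<rho> > 0" and u0: "small_data \<rho> u0" and W: "admissible \<rho> W"
    and um[measurable]: "u \<in> borel_measurable borel" and uW: "\<And>z. \<bar>u z - heatE u0 z\<bar> \<le> W z"
    and \<phi>m[measurable]: "\<phi> \<in> borel_measurable borel"
    and \<alpha>: "\<alpha> > 0" "(\<integral>\<^sup>+x. ennreal (young_conj_expsq (\<bar>\<phi> x\<bar> / \<alpha>)) \<partial>lborel) < \<infinity>"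
    and X: "\<And>i::nat. X i > 0" "X \<longlonglongrightarrow> 0"
  shows "(\<lambda>i. \<integral>\<^sup>+x. ennreal (\<bar>u (X i, x) - u0 x\<bar> * \<bar>\<phi> x\<bar>) \<partial>lborel) \<longlonglongrightarrow> 0"
proof (rule tendsto_ennreal_0I)
  fix e :: real assume e: "e > 0"
  have [measurable]: "u0 \<in> borel_measurable borel" using u0 by (simp add: small_data_def)
  have Wm[measurable]: "W \<in> borel_measurable borel" using W by (simp add: admissible_def)
  have W0: "W z \<ge> 0" for z using W unfolding admissible_def by blast
  define Y where "Y = enn2real (\<integral>\<^sup>+x. ennreal (young_conj_expsq (\<bar>\<phi> x\<bar> / 1)) \<partial>lborel)"
  have Y: "(\<integral>\<^sup>+x. ennreal (young_conj_expsq (\<bar>\<phi> x\<bar> / 1)) \<partial>lborel) = ennreal Y" "Y \<ge> 0"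
    using young_conj_scale_finite[OF _ \<alpha>(2,1) zero_less_one] by (auto simp: Y_def)
  \<comment> \<open>Once W has modular at most 1 at scale a, its pairing with \<phi> is at most a (1
    + Y), that is, e / 4.\<close>
  define a where "a = e / (4 * (1 + Y))"
  have cancel: "e / (c * k) * k = e / c" if "k > 0" for k c :: real using that by simp
  have a: "a > 0" "a * (1 + Y) = e / 4"
  proof -
    have k: "1 + Y > 0" using Y by linarith
    then show "a > 0" unfolding a_def using e by (intro divide_pos_pos mult_pos_pos) auto
    show "a * (1 + Y) = e / 4" unfolding a_def by (rule cancel[OF k])
  qed
  \<comment> \<open>The factor min 1 t in the L^2 bound sends the modular of W at the fixed scale a
    to 0.\<close>
  have part1: "eventually (\<lambda>i. (\<integral>\<^sup>+x. ennreal (\<bar>W (X i, x)\<bar> * \<bar>\<phi> x\<bar>) \<partial>lborel) \<le> ennreal (e / 4)) sequentially"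
  proof -
    have "(\<lambda>i. exp ((\<rho> / a)\<^sup>2) / a\<^sup>2 * (\<rho> * min 1 (X i))\<^sup>2) \<longlonglongrightarrow> exp ((\<rho> / a)\<^sup>2) / a\<^sup>2 * (\<rho> * min 1 0)\<^sup>2"
      by (intro tendsto_intros X(2)) (use a in auto)
    then have "eventually (\<lambda>i. exp ((\<rho> / a)\<^sup>2) / a\<^sup>2 * (\<rho> * min 1 (X i))\<^sup>2 < 1) sequentially"
      by (rule order_tendstoD) simp
    then show ?thesis
    proof eventually_elim
      case (elim i)
      have "\<bar>W (X i, x)\<bar> \<le> \<rho>" for x
      proof -
        have "(1 + X i) powr (- g / 2) \<le> (1 + X i) powr 0" using X(1)[of i] g_pos by (intro powr_mono) auto
        then have "\<rho> * (1 + X i) powr (- g / 2) \<le> \<rho>" using X(1)[of i] \<rho> by (intro mult_left_le) auto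
        then show ?thesis using admissible_sup[OF _ W X(1), of i x] \<rho> W0[of "(X i, x)"] by linarith
      qed
      then have "(\<integral>\<^sup>+x. ennreal (exp ((W (X i, x) / a)\<^sup>2) - 1) \<partial>lborel) \<le> ennreal (exp ((\<rho> / a)\<^sup>2) / a\<^sup>2 * (\<rho> * min 1 (X i))\<^sup>2)"
        using W X(1)[of i] by (intro exp_integral_le_of_L2 a) (auto simp: admissible_def)
      also have "\<dots> \<le> ennreal 1" by (intro ennreal_leI) (use elim in simp)
      finally have "(\<integral>\<^sup>+x. ennreal (\<bar>W (X i, x)\<bar> * \<bar>\<phi> x\<bar>) \<partial>lborel) \<le> ennreal (a * 1) * (ennreal 1 + ennreal Y)"
        using Y by (intro orlicz_pairing_le a) auto
      also have "\<dots> = ennreal (e / 4)"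
      proof -
        have "ennreal 1 + ennreal Y = ennreal (1 + Y)" by (rule ennreal_plus[symmetric]) (use Y in auto)
        moreover have "ennreal (a * 1) * ennreal (1 + Y) = ennreal (a * 1 * (1 + Y))"
          by (rule ennreal_mult[symmetric]) (use a Y in auto)
        ultimately show ?thesis using a by (simp only: mult_1_right)
      qed
      finally show ?case .
    qed
  qed
  \<comment> \<open>The scale for the remainder \<psi> n: with all modulars at most 1, its pairings
    with \<open>heatV u0\<close> at scale \<rho> and with u0 at scale \<rho> / kap are each at most
    e / 8.\<close>
  define \<beta> where "\<beta> = e / (16 * (\<rho> + \<rho> / kap))"
  have \<beta>: "\<beta> > 0" using e \<rho> kap_pos by (simp add: \<beta>_def add_pos_pos)
  have \<rho>\<beta>: "\<rho> * \<beta> * 2 \<le> e / 8" "\<rho> / kap * \<beta> * 2 \<le> e / 8"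
  proof -
    have "(\<rho> + \<rho> / kap) * \<beta> = e / 16"
    proof -
      have "\<rho> + \<rho> / kap > 0" using \<rho> kap_pos by (simp add: add_pos_pos)
      from cancel[OF this, of 16] show ?thesis unfolding \<beta>_def by (simp only: mult.commute)
    qed
    moreover have "\<rho> * \<beta> \<le> (\<rho> + \<rho> / kap) * \<beta>" "\<rho> / kap * \<beta> \<le> (\<rho> + \<rho> / kap) * \<beta>"
    proof -
      have "\<rho> / kap > 0" using \<rho> kap_pos by simp
      then have le: "\<rho> \<le> \<rho> + \<rho> / kap" "\<rho> / kap \<le> \<rho> + \<rho> / kap" using \<rho> by linarith+
      show "\<rho> * \<beta> \<le> (\<rho> + \<rho> / kap) * \<beta>" "\<rho> / kap * \<beta> \<le> (\<rho> + \<rho> / kap) * \<beta>"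
        by (rule mult_right_mono[OF le(1) less_imp_le[OF \<beta>]] mult_right_mono[OF le(2) less_imp_le[OF \<beta>]])+
    qed
    ultimately show "\<rho> * \<beta> * 2 \<le> e / 8" "\<rho> / kap * \<beta> * 2 \<le> e / 8" by linarith+
  qed
  define \<psi> where "\<psi> n x = (if \<bar>\<phi> x\<bar> \<le> real n \<and> norm x \<le> real n then 0 else \<phi> x)" for n x
  have [measurable]: "\<psi> n \<in> borel_measurable borel" for n unfolding \<psi>_def by measurable
  have "(\<lambda>n. \<integral>\<^sup>+x. ennreal (young_conj_expsq (\<bar>\<psi> n x\<bar> / \<beta>)) \<partial>lborel) \<longlonglongrightarrow> (\<integral>\<^sup>+(x::'a). 0 \<partial>lborel)"
  proof (rule nn_integral_dominated_convergence[where w = "\<lambda>x. ennreal (young_conj_expsq (\<bar>\<phi> x\<bar> / \<beta>))"])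
    show "(\<integral>\<^sup>+x. ennreal (young_conj_expsq (\<bar>\<phi> x\<bar> / \<beta>)) \<partial>lborel) < \<infinity>"
      by (rule young_conj_scale_finite[OF _ \<alpha>(2,1) \<beta>]) simp
    show "AE x in lborel. ennreal (young_conj_expsq (\<bar>\<psi> n x\<bar> / \<beta>)) \<le> ennreal (young_conj_expsq (\<bar>\<phi> x\<bar> / \<beta>))" for n
      by (intro AE_I2 ennreal_leI) (auto simp: \<psi>_def young_conj_0 young_conj_nonneg)
    have "(\<lambda>n. ennreal (young_conj_expsq (\<bar>\<psi> n x\<bar> / \<beta>))) \<longlonglongrightarrow> 0" for x
    proof (rule tendsto_eventually)
      obtain k :: nat where k: "\<bar>\<phi> x\<bar> + norm x \<le> real k" using real_arch_simple by blast
      show "eventually (\<lambda>n. ennreal (young_conj_expsq (\<bar>\<psi> n x\<bar> / \<beta>)) = 0) sequentially"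
        unfolding eventually_sequentially
      proof (intro exI[of _ k] allI impI)
        fix n assume "k \<le> n"
        then have "\<bar>\<phi> x\<bar> + norm x \<le> real n" using k by linarith
        then have "\<bar>\<phi> x\<bar> \<le> real n \<and> norm x \<le> real n"
          using norm_ge_zero[of x] abs_ge_zero[of "\<phi> x"] by linarith
        then show "ennreal (young_conj_expsq (\<bar>\<psi> n x\<bar> / \<beta>)) = 0" by (simp add: \<psi>_def young_conj_0)
      qed
    qed
    then show "AE x in lborel. (\<lambda>n. ennreal (young_conj_expsq (\<bar>\<psi> n x\<bar> / \<beta>))) \<longlonglongrightarrow> 0" by simp
  qed measurable
  then have "(\<lambda>n. \<integral>\<^sup>+x. ennreal (young_conj_expsq (\<bar>\<psi> n x\<bar> / \<beta>)) \<partial>lborel) \<longlonglongrightarrow> 0" by simp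
  then have "eventually (\<lambda>n. (\<integral>\<^sup>+x. ennreal (young_conj_expsq (\<bar>\<psi> n x\<bar> / \<beta>)) \<partial>lborel) < 1) sequentially"
    by (rule order_tendstoD) simp
  then obtain n where n: "(\<integral>\<^sup>+x. ennreal (young_conj_expsq (\<bar>\<psi> n x\<bar> / \<beta>)) \<partial>lborel) \<le> 1"
    by (meson eventually_sequentially less_imp_le order_refl)
  have pair2: "ennreal (r * \<beta>) * (1 + 1) \<le> ennreal (e / 8)" if "r * \<beta> * 2 \<le> e / 8" "r > 0" for r
  proof -
    have "ennreal (r * \<beta>) * (1 + 1) = ennreal (r * \<beta> * 2)"
      using that \<beta> by (simp add: ennreal_mult)
    then show ?thesis using that by (simp add: ennreal_leI)
  qed
  have part3: "(\<integral>\<^sup>+x. ennreal (\<bar>u0 x\<bar> * \<bar>\<psi> n x\<bar>) \<partial>lborel) \<le> ennreal (e / 8)"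
  proof -
    have "(\<integral>\<^sup>+x. ennreal (\<bar>u0 x\<bar> * \<bar>\<psi> n x\<bar>) \<partial>lborel) \<le> ennreal (\<rho> / kap * \<beta>) * (1 + 1)"
    proof (rule orlicz_pairing_le[OF _ _ _ \<beta> _ n])
      have "u0 x / (\<rho> / kap) = kap * u0 x / \<rho>" for x by simp
      then show "(\<integral>\<^sup>+x. ennreal (exp ((u0 x / (\<rho> / kap))\<^sup>2) - 1) \<partial>lborel) \<le> 1"
        using u0 by (simp only: small_data_def)
    qed (use \<rho> kap_pos in simp_all)
    with pair2[OF \<rho>\<beta>(2)] \<rho> kap_pos show ?thesis by simp
  qed
  have part4: "(\<integral>\<^sup>+x. ennreal (\<bar>heatV u0 (X i, x)\<bar> * \<bar>\<psi> n x\<bar>) \<partial>lborel) \<le> ennreal (e / 8)" for i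
  proof -
    have "(\<integral>\<^sup>+x. ennreal (\<bar>heatV u0 (X i, x)\<bar> * \<bar>\<psi> n x\<bar>) \<partial>lborel) \<le> ennreal (\<rho> * \<beta>) * (1 + 1)"
      by (rule orlicz_pairing_le[OF _ _ \<rho> \<beta> heatV_exp[OF \<rho> u0 X(1)] n]) measurable
    with pair2[OF \<rho>\<beta>(1) \<rho>] show ?thesis by simp
  qed
  have [measurable]: "cball (0::'a) (real n) \<in> sets borel" by (simp add: borel_closed)
  let ?J = "\<lambda>i. \<integral>\<^sup>+x\<in>cball 0 (real n). ennreal \<bar>heatE u0 (X i, x) - u0 x\<bar> \<partial>lborel"
  have "eventually (\<lambda>i. ?J i < ennreal (e / (4 * (real n + 1)))) sequentially"
    by (rule order_tendstoD(2)[OF heatE_local_L1[OF \<rho> u0 X]]) (use e in \<open>simp add: add_nonneg_pos\<close>)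
  with part1 show "eventually (\<lambda>i. (\<integral>\<^sup>+x. ennreal (\<bar>u (X i, x) - u0 x\<bar> * \<bar>\<phi> x\<bar>) \<partial>lborel) \<le> ennreal e) sequentially"
  proof eventually_elim
    case (elim i)
    let ?I = "indicator (cball (0::'a) (real n)) :: 'a \<Rightarrow> ennreal"
    have "(\<integral>\<^sup>+x. ennreal (\<bar>u (X i, x) - u0 x\<bar> * \<bar>\<phi> x\<bar>) \<partial>lborel)
      \<le> (\<integral>\<^sup>+x. ennreal (\<bar>W (X i, x)\<bar> * \<bar>\<phi> x\<bar>) + (ennreal (real n) * (ennreal \<bar>heatE u0 (X i, x) - u0 x\<bar> * ?I x)
          + (ennreal (\<bar>heatV u0 (X i, x)\<bar> * \<bar>\<psi> n x\<bar>) + ennreal (\<bar>u0 x\<bar> * \<bar>\<psi> n x\<bar>))) \<partial>lborel)"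
    proof (rule nn_integral_mono)
      fix x
      let ?d = "\<bar>heatE u0 (X i, x) - u0 x\<bar>"
      have 1: "\<bar>u (X i, x) - u0 x\<bar> \<le> \<bar>W (X i, x)\<bar> + ?d" using uW[of "(X i, x)"] by linarith
      have 2: "?d \<le> \<bar>heatV u0 (X i, x)\<bar> + \<bar>u0 x\<bar>" using heatE_le[OF \<rho> u0, of "(X i, x)"] by linarith
      show "ennreal (\<bar>u (X i, x) - u0 x\<bar> * \<bar>\<phi> x\<bar>) \<le> ennreal (\<bar>W (X i, x)\<bar> * \<bar>\<phi> x\<bar>) + (ennreal (real n) * (ennreal ?d * ?I x)
          + (ennreal (\<bar>heatV u0 (X i, x)\<bar> * \<bar>\<psi> n x\<bar>) + ennreal (\<bar>u0 x\<bar> * \<bar>\<psi> n x\<bar>)))"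
      proof (cases "\<bar>\<phi> x\<bar> \<le> real n \<and> norm x \<le> real n")
        case True
        have "\<bar>u (X i, x) - u0 x\<bar> * \<bar>\<phi> x\<bar> \<le> (\<bar>W (X i, x)\<bar> + ?d) * \<bar>\<phi> x\<bar>" by (intro mult_right_mono 1) simp
        also have "\<dots> \<le> \<bar>W (X i, x)\<bar> * \<bar>\<phi> x\<bar> + real n * ?d"
          using True by (simp add: distrib_right mult.commute[of ?d] mult_right_mono)
        finally have "ennreal (\<bar>u (X i, x) - u0 x\<bar> * \<bar>\<phi> x\<bar>) \<le> ennreal (\<bar>W (X i, x)\<bar> * \<bar>\<phi> x\<bar>) + ennreal (real n) * ennreal ?d"
          by (simp add: ennreal_mult[symmetric] ennreal_plus[symmetric] ennreal_leI del: ennreal_plus)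
        then show ?thesis using True by (simp add: \<psi>_def)
      next
        case False
        then have \<psi>: "\<psi> n x = \<phi> x" by (simp only: \<psi>_def if_False)
        have "\<bar>u (X i, x) - u0 x\<bar> * \<bar>\<phi> x\<bar> \<le> (\<bar>W (X i, x)\<bar> + (\<bar>heatV u0 (X i, x)\<bar> + \<bar>u0 x\<bar>)) * \<bar>\<phi> x\<bar>"
          using 1 2 by (intro mult_right_mono) auto
        also have "\<dots> = \<bar>W (X i, x)\<bar> * \<bar>\<phi> x\<bar> + (\<bar>heatV u0 (X i, x)\<bar> * \<bar>\<psi> n x\<bar> + \<bar>u0 x\<bar> * \<bar>\<psi> n x\<bar>)"
          unfolding \<psi> by (simp only: distrib_right)
        finally have "ennreal (\<bar>u (X i, x) - u0 x\<bar> * \<bar>\<phi> x\<bar>) \<le> ennreal (\<bar>W (X i, x)\<bar> * \<bar>\<phi> x\<bar>) + (ennreal (\<bar>heatV u0 (X i, x)\<bar> * \<bar>\<psi> n x\<bar>) + ennreal (\<bar>u0 x\<bar> * \<bar>\<psi> n x\<bar>))"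
          by (simp add: ennreal_plus[symmetric] ennreal_leI del: ennreal_plus)
        also have "\<dots> \<le> ennreal (\<bar>W (X i, x)\<bar> * \<bar>\<phi> x\<bar>) + (ennreal (real n) * (ennreal ?d * ?I x)
          + (ennreal (\<bar>heatV u0 (X i, x)\<bar> * \<bar>\<psi> n x\<bar>) + ennreal (\<bar>u0 x\<bar> * \<bar>\<psi> n x\<bar>)))"
          by (intro add_left_mono) (simp add: add_increasing)
        finally show ?thesis .
      qed
    qed
    also have "\<dots> = (\<integral>\<^sup>+x. ennreal (\<bar>W (X i, x)\<bar> * \<bar>\<phi> x\<bar>) \<partial>lborel) + (ennreal (real n) * ?J i
          + ((\<integral>\<^sup>+x. ennreal (\<bar>heatV u0 (X i, x)\<bar> * \<bar>\<psi> n x\<bar>) \<partial>lborel) + (\<integral>\<^sup>+x. ennreal (\<bar>u0 x\<bar> * \<bar>\<psi> n x\<bar>) \<partial>lborel)))"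
    proof -
      have "(\<integral>\<^sup>+x. ennreal (real n) * (ennreal \<bar>heatE u0 (X i, x) - u0 x\<bar> * ?I x) \<partial>lborel) = ennreal (real n) * ?J i"
        by (rule nn_integral_cmult) measurable
      moreover have "(\<integral>\<^sup>+x. ennreal (\<bar>heatV u0 (X i, x)\<bar> * \<bar>\<psi> n x\<bar>) + ennreal (\<bar>u0 x\<bar> * \<bar>\<psi> n x\<bar>) \<partial>lborel)
         = (\<integral>\<^sup>+x. ennreal (\<bar>heatV u0 (X i, x)\<bar> * \<bar>\<psi> n x\<bar>) \<partial>lborel) + (\<integral>\<^sup>+x. ennreal (\<bar>u0 x\<bar> * \<bar>\<psi> n x\<bar>) \<partial>lborel)"
        by (rule nn_integral_add) measurable
      moreover have "(\<integral>\<^sup>+x. ennreal (\<bar>W (X i, x)\<bar> * \<bar>\<phi> x\<bar>) + (ennreal (real n) * (ennreal \<bar>heatE u0 (X i, x) - u0 x\<bar> * ?I x)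
          + (ennreal (\<bar>heatV u0 (X i, x)\<bar> * \<bar>\<psi> n x\<bar>) + ennreal (\<bar>u0 x\<bar> * \<bar>\<psi> n x\<bar>))) \<partial>lborel)
         = (\<integral>\<^sup>+x. ennreal (\<bar>W (X i, x)\<bar> * \<bar>\<phi> x\<bar>) \<partial>lborel) + ((\<integral>\<^sup>+x. ennreal (real n) * (ennreal \<bar>heatE u0 (X i, x) - u0 x\<bar> * ?I x) \<partial>lborel)
          + (\<integral>\<^sup>+x. ennreal (\<bar>heatV u0 (X i, x)\<bar> * \<bar>\<psi> n x\<bar>) + ennreal (\<bar>u0 x\<bar> * \<bar>\<psi> n x\<bar>) \<partial>lborel))"
        by (rule nn_integral_add3) measurable
      ultimately show ?thesis by (simp only:)
    qed
    also have "\<dots> \<le> ennreal (e / 4) + (ennreal (real n) * ennreal (e / (4 * (real n + 1))) + (ennreal (e / 8) + ennreal (e / 8)))"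
      using elim by (intro add_mono mult_left_mono part3 part4) auto
    also have "\<dots> = ennreal (e / 4 + (real n * (e / (4 * (real n + 1))) + (e / 8 + e / 8)))"
      using e by (simp add: ennreal_mult[symmetric] ennreal_plus[symmetric] del: ennreal_plus)
    also have "\<dots> \<le> ennreal e"
    proof (rule ennreal_leI)
      have "real n * (e / (4 * (real n + 1))) \<le> e / 4" using e by (simp add: field_simps)
      then show "e / 4 + (real n * (e / (4 * (real n + 1))) + (e / 8 + e / 8)) \<le> e" using e by linarith
    qed
    finally show ?case .
  qed
qed

end

section \<open>Norm bounds and decay of the solution\<close>

text \<open>|v| is at most \<alpha> exp ((v / \<alpha>)^2), which is \<alpha>, integrable on a
  compact set, plus an integrable function.\<close>

lemma exp_moment_loc_integrable:
  fixes v :: "'a::euclidean_space \<Rightarrow> real"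
  assumes [measurable]: "v \<in> borel_measurable borel" and \<alpha>: "\<alpha> > 0"
    and fin: "(\<integral>\<^sup>+x. ennreal (exp ((v x / \<alpha>)\<^sup>2) - 1) \<partial>lborel) < \<infinity>"
  shows "loc_integrable v"
  unfolding loc_integrable_def
proof (intro conjI allI impI)
  show "v \<in> borel_measurable lebesgue" by (intro measurable_completion) simp
  fix S :: "'a set" assume S: "compact S"
  then have [measurable]: "S \<in> sets borel" by (simp add: borel_compact)
  have "\<bar>v x\<bar> \<le> \<alpha> + \<alpha> * (exp ((v x / \<alpha>)\<^sup>2) - 1)" for x
  proof -
    have "\<bar>v x / \<alpha>\<bar> \<le> 1 + (v x / \<alpha>)\<^sup>2"
      using sum_squares_bound[of 1 "\<bar>v x / \<alpha>\<bar>"] abs_ge_zero[of "v x / \<alpha>"] by (simp only: power2_abs power_one mult_1_right)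
    also have "\<dots> \<le> exp ((v x / \<alpha>)\<^sup>2)" by (rule exp_ge_add_one_self)
    finally show ?thesis using \<alpha> by (simp add: pos_divide_le_eq right_diff_distrib mult.commute[of _ \<alpha>])
  qed
  then have "(\<integral>\<^sup>+x. ennreal (norm (indicator S x *\<^sub>R v x)) \<partial>lborel)
     \<le> (\<integral>\<^sup>+x. ennreal \<alpha> * indicator S x + ennreal \<alpha> * ennreal (exp ((v x / \<alpha>)\<^sup>2) - 1) \<partial>lborel)"
    using \<alpha> by (intro nn_integral_mono)
      (auto split: split_indicator simp: ennreal_mult[symmetric] ennreal_plus[symmetric] ennreal_leI simp del: ennreal_plus)
  also have "\<dots> = ennreal \<alpha> * emeasure lborel S + ennreal \<alpha> * (\<integral>\<^sup>+x. ennreal (exp ((v x / \<alpha>)\<^sup>2) - 1) \<partial>lborel)"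
    by (subst nn_integral_add) (auto simp: nn_integral_cmult nn_integral_cmult_indicator)
  also have "\<dots> < \<infinity>"
    using fin emeasure_compact_finite[OF S] by (simp add: ennreal_mult_less_top)
  finally have "integrable lborel (\<lambda>x. indicator S x *\<^sub>R v x)"
    by (intro integrableI_bounded) auto
  then show "set_integrable lebesgue S v"
    unfolding set_integrable_def by (subst integrable_completion) auto
qed

context semilinear_flow
begin

context
  fixes \<rho> :: real and u0 :: "'a \<Rightarrow> real" and u W :: "real \<times> 'a \<Rightarrow> real"
  assumes \<rho>: "\<rho> > 0" and u0: "small_data \<rho> u0" and W: "admissible \<rho> W"
    and um [measurable]: "u \<in> borel_measurable borel"
    and u_le: "\<And>z. \<bar>u z\<bar> \<le> heatV u0 z + W z" and u_diff: "\<And>z. \<bar>u z - heatE u0 z\<bar> \<le> W z"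
begin

lemma datum_measurable [measurable]: "u0 \<in> borel_measurable borel"
  using u0 by (simp add: small_data_def)

lemma W_measurable [measurable]: "W \<in> borel_measurable borel"
  using W by (simp add: admissible_def)

lemma W_nonneg: "W z \<ge> 0"
  using W unfolding admissible_def by blast

lemma W_le_rho: "t > 0 \<Longrightarrow> W (t, x) \<le> \<rho>"
proof -
  assume t: "t > 0"
  have "(1 + t) powr (- g / 2) \<le> (1 + t) powr 0" using t g_pos by (intro powr_mono) auto
  then have "\<rho> * (1 + t) powr (- g / 2) \<le> \<rho>" using t \<rho> by (intro mult_left_le) auto
  then show ?thesis using admissible_sup[OF _ W t, of x] \<rho> by linarith
qed

lemma W_exp: "t > 0 \<Longrightarrow> \<alpha> > 0 \<Longrightarrow>
  (\<integral>\<^sup>+x. ennreal (exp ((W (t, x) / \<alpha>)\<^sup>2) - 1) \<partial>lborel) \<le> ennreal (exp ((\<rho> / \<alpha>)\<^sup>2) / \<alpha>\<^sup>2 * (\<rho> * min 1 t)\<^sup>2)"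
  using W W_le_rho W_nonneg by (intro exp_integral_le_of_L2) (auto simp: admissible_def)

text \<open>Split u into its two majorants by (v + w)^2 \<le> 2 v^2 + 2 w^2 and the exponential of
  the sum by the arithmetic-geometric mean. At scale 2 \<rho> the modular of W is at most exp (1 /
  4) / 4 < 1.\<close>

lemma solution_exp:
  assumes t: "t > 0"
  shows "(\<integral>\<^sup>+x. ennreal (exp ((u (t, x) / (4 * \<rho>))\<^sup>2) - 1) \<partial>lborel) \<le> 1"
proof -
  have le: "exp ((u (t, x) / (4 * \<rho>))\<^sup>2) - 1 \<le> (1/2) * (exp ((heatV u0 (t, x) / \<rho>)\<^sup>2) - 1) + (1/2) * (exp ((W (t, x) / (2 * \<rho>))\<^sup>2) - 1)" for x
  proof -
    let ?v = "heatV u0 (t, x)" and ?w = "W (t, x)"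
    have "(u (t, x))\<^sup>2 \<le> (?v + ?w)\<^sup>2"
      using u_le[of "(t, x)"] heatV_nonneg[of u0 "(t, x)"] W_nonneg[of "(t, x)"] by (simp add: abs_le_square_iff[symmetric])
    also have "\<dots> \<le> 2 * ?v\<^sup>2 + 2 * ?w\<^sup>2" using sum_squares_bound[of ?v ?w] by (simp add: power2_sum)
    finally have "(u (t, x) / (4 * \<rho>))\<^sup>2 \<le> (2 * ?v\<^sup>2 + 2 * ?w\<^sup>2) / (4 * \<rho>)\<^sup>2"
      unfolding power_divide by (intro divide_right_mono) auto
    also have "\<dots> = (?v / (2 * \<rho>))\<^sup>2 / 2 + (?w / (2 * \<rho>))\<^sup>2 / 2"
      using \<rho> by (simp add: power2_eq_square field_simps)
    also have "\<dots> \<le> (?v / \<rho>)\<^sup>2 / 2 + (?w / (2 * \<rho>))\<^sup>2 / 2"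
    proof -
      have "(?v / (2 * \<rho>))\<^sup>2 \<le> (?v / \<rho>)\<^sup>2"
        using \<rho> heatV_nonneg[of u0 "(t, x)"] by (intro power_mono divide_left_mono) auto
      then show ?thesis by simp
    qed
    finally have "exp ((u (t, x) / (4 * \<rho>))\<^sup>2) \<le> exp ((?v / \<rho>)\<^sup>2 / 2 + (?w / (2 * \<rho>))\<^sup>2 / 2)" by simp
    also have "\<dots> = exp ((?v / \<rho>)\<^sup>2 / 2) * exp ((?w / (2 * \<rho>))\<^sup>2 / 2)" by (rule exp_add)
    also have "\<dots> \<le> ((exp ((?v / \<rho>)\<^sup>2 / 2))\<^sup>2 + (exp ((?w / (2 * \<rho>))\<^sup>2 / 2))\<^sup>2) / 2"
      using sum_squares_bound[of "exp ((?v / \<rho>)\<^sup>2 / 2)" "exp ((?w / (2 * \<rho>))\<^sup>2 / 2)"] by simp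
    also have "\<dots> = (exp ((?v / \<rho>)\<^sup>2) + exp ((?w / (2 * \<rho>))\<^sup>2)) / 2"
      by (simp add: exp_double[symmetric])
    finally show ?thesis by (simp add: field_simps)
  qed
  have w1: "(\<integral>\<^sup>+x. ennreal (exp ((W (t, x) / (2 * \<rho>))\<^sup>2) - 1) \<partial>lborel) \<le> 1"
  proof -
    have "(\<integral>\<^sup>+x. ennreal (exp ((W (t, x) / (2 * \<rho>))\<^sup>2) - 1) \<partial>lborel) \<le> ennreal (exp ((\<rho> / (2 * \<rho>))\<^sup>2) / (2 * \<rho>)\<^sup>2 * (\<rho> * min 1 t)\<^sup>2)"
      by (rule W_exp[OF t]) (use \<rho> in simp)
    also have "\<dots> \<le> ennreal 1"
    proof (rule ennreal_leI)
      have "(\<rho> * min 1 t)\<^sup>2 \<le> \<rho>\<^sup>2" using \<rho> t by (intro power_mono mult_left_le) auto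
      then have "exp ((\<rho> / (2 * \<rho>))\<^sup>2) / (2 * \<rho>)\<^sup>2 * (\<rho> * min 1 t)\<^sup>2 \<le> exp ((\<rho> / (2 * \<rho>))\<^sup>2) / (2 * \<rho>)\<^sup>2 * \<rho>\<^sup>2"
        by (intro mult_left_mono) auto
      also have "\<dots> = exp (1 / 4) / 4" using \<rho> by (simp add: power2_eq_square)
      also have "\<dots> \<le> 1"
      proof -
        have "exp (1 / 4) \<le> exp (1::real)" by simp
        also have "\<dots> \<le> 3" by (rule exp_le)
        finally show ?thesis by simp
      qed
      finally show "exp ((\<rho> / (2 * \<rho>))\<^sup>2) / (2 * \<rho>)\<^sup>2 * (\<rho> * min 1 t)\<^sup>2 \<le> 1" .
    qed
    finally show ?thesis by simp
  qed
  have "(\<integral>\<^sup>+x. ennreal (exp ((u (t, x) / (4 * \<rho>))\<^sup>2) - 1) \<partial>lborel)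
      \<le> (\<integral>\<^sup>+x. ennreal (1/2) * ennreal (exp ((heatV u0 (t, x) / \<rho>)\<^sup>2) - 1) + ennreal (1/2) * ennreal (exp ((W (t, x) / (2 * \<rho>))\<^sup>2) - 1) \<partial>lborel)"
  proof (rule nn_integral_mono)
    fix x
    show "ennreal (exp ((u (t, x) / (4 * \<rho>))\<^sup>2) - 1) \<le> ennreal (1/2) * ennreal (exp ((heatV u0 (t, x) / \<rho>)\<^sup>2) - 1) + ennreal (1/2) * ennreal (exp ((W (t, x) / (2 * \<rho>))\<^sup>2) - 1)"
      (is "?l \<le> ?r")
    proof -
      have "?l \<le> ennreal ((1/2) * (exp ((heatV u0 (t, x) / \<rho>)\<^sup>2) - 1) + (1/2) * (exp ((W (t, x) / (2 * \<rho>))\<^sup>2) - 1))"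
        by (rule ennreal_leI[OF le])
      also have "\<dots> = ennreal ((1/2) * (exp ((heatV u0 (t, x) / \<rho>)\<^sup>2) - 1)) + ennreal ((1/2) * (exp ((W (t, x) / (2 * \<rho>))\<^sup>2) - 1))"
        by (rule ennreal_plus) simp_all
      also have "\<dots> = ?r" by (intro arg_cong2[where f = plus] ennreal_mult') simp_all
      finally show ?thesis .
    qed
  qed
  also have "\<dots> = ennreal (1/2) * (\<integral>\<^sup>+x. ennreal (exp ((heatV u0 (t, x) / \<rho>)\<^sup>2) - 1) \<partial>lborel) + ennreal (1/2) * (\<integral>\<^sup>+x. ennreal (exp ((W (t, x) / (2 * \<rho>))\<^sup>2) - 1) \<partial>lborel)"
    by (subst nn_integral_add) (auto simp: nn_integral_cmult)
  also have "\<dots> \<le> ennreal (1/2) * 1 + ennreal (1/2) * 1"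
    by (intro add_mono mult_left_mono heatV_exp[OF \<rho> u0 t] w1) auto
  also have "\<dots> = ennreal (1/2 + 1/2)" by (subst ennreal_plus) auto
  finally show ?thesis by simp
qed

lemma solution_norm_diff:
  "((\<lambda>t. expL2_norm (\<lambda>x. u (t, x) - heatE u0 (t, x))) \<longlongrightarrow> 0) (at_right 0)"
proof (rule tendstoI)
  fix e :: real assume e: "e > 0"
  define a where "a = e / 2"
  have a: "a > 0" "a < e" using e by (auto simp: a_def)
  have "((\<lambda>t. exp ((\<rho> / a)\<^sup>2) / a\<^sup>2 * (\<rho> * min 1 t)\<^sup>2) \<longlongrightarrow> exp ((\<rho> / a)\<^sup>2) / a\<^sup>2 * (\<rho> * min 1 0)\<^sup>2) (at_right 0)"
    by (intro tendsto_intros) (use a in auto)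
  then have "eventually (\<lambda>t. exp ((\<rho> / a)\<^sup>2) / a\<^sup>2 * (\<rho> * min 1 t)\<^sup>2 < 1) (at_right 0)"
    by (rule order_tendstoD) simp
  moreover have "eventually (\<lambda>t::real. t > 0) (at_right 0)" by (rule eventually_at_right_less)
  ultimately show "eventually (\<lambda>t. dist (expL2_norm (\<lambda>x. u (t, x) - heatE u0 (t, x))) 0 < e) (at_right 0)"
  proof eventually_elim
    case (elim t)
    let ?d = "\<lambda>x. u (t, x) - heatE u0 (t, x)"
    have "(\<integral>\<^sup>+x. ennreal (exp ((?d x)\<^sup>2 / a\<^sup>2) - 1) \<partial>lebesgue) = (\<integral>\<^sup>+x. ennreal (exp ((?d x / a)\<^sup>2) - 1) \<partial>lborel)"
      by (simp add: nn_integral_completion power_divide)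
    also have "\<dots> \<le> (\<integral>\<^sup>+x. ennreal (exp ((W (t, x) / a)\<^sup>2) - 1) \<partial>lborel)"
    proof (intro nn_integral_mono ennreal_leI diff_right_mono)
      fix x
      have "(?d x)\<^sup>2 \<le> (W (t, x))\<^sup>2"
        using u_diff[of "(t, x)"] W_nonneg[of "(t, x)"] by (simp add: abs_le_square_iff[symmetric])
      then show "exp ((?d x / a)\<^sup>2) \<le> exp ((W (t, x) / a)\<^sup>2)"
        unfolding power_divide by (simp add: divide_right_mono)
    qed
    also have "\<dots> \<le> ennreal (exp ((\<rho> / a)\<^sup>2) / a\<^sup>2 * (\<rho> * min 1 t)\<^sup>2)" by (rule W_exp[OF elim(2) a(1)])
    also have "\<dots> \<le> ennreal 1" by (rule ennreal_leI) (use elim in simp)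
    finally have "(\<integral>\<^sup>+x. ennreal (exp ((?d x)\<^sup>2 / a\<^sup>2) - 1) \<partial>lebesgue) \<le> 1" by simp
    from expL2_norm_le[OF a(1) this] show ?case using a by (simp add: dist_real_def)
  qed
qed

text \<open>\<open>total_moment\<close> with \<mu> = 0 gives decay in 1 + t with exponent g (q / 2 -
  1). The required exponent \<sigma> q = q / (m - 1) - g lies between 0 and this one, so the bound
  by a power of t holds for small and large t alike.\<close>

lemma solution_Lp:
  assumes q: "q > g * (m - 1)"
  shows "\<exists>C>0. \<forall>t>0. (\<integral>\<^sup>+x. ennreal (\<bar>u (t, x)\<bar> powr q) \<partial>lborel) \<le> ennreal ((C * t powr (- (1 / (m - 1) - g / q))) powr q)"
proof -
  have q2: "q \<ge> 2" using q g_m by linarith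
  obtain C where C: "C > 0" and H: "\<And>\<rho> \<mu> t u0 W. \<lbrakk>\<rho> > 0; \<mu> \<ge> 0; 16 * \<mu> * \<rho>\<^sup>2 \<le> 1; t > 0; small_data \<rho> u0; admissible \<rho> W\<rbrakk> \<Longrightarrow>
      (\<integral>\<^sup>+x. ennreal ((heatV u0 (t, x) + W (t, x)) powr q * exp (\<mu> * (heatV u0 (t, x) + W (t, x))\<^sup>2)) \<partial>lborel)
        \<le> ennreal (C * \<rho> powr q * (1 + t) powr (- (g * (q / 2 - 1))))"
    using total_moment[OF q2] by blast
  define D where "D = (C * \<rho> powr q) powr (1 / q)"
  have D: "D > 0" using C \<rho> by (simp add: D_def)
  have Dq: "D powr q = C * \<rho> powr q" using C \<rho> q2 by (simp add: D_def powr_powr)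
  define \<sigma> where "\<sigma> = 1 / (m - 1) - g / q"
  have "\<sigma> * q \<le> g * (q / 2 - 1) \<and> 0 \<le> \<sigma> * q"
  proof -
    have eq: "\<sigma> * q = q / (m - 1) - g" using q2 by (simp add: \<sigma>_def left_diff_distrib)
    have m1: "m - 1 > 0" using m_ge by simp
    have "2 / (m - 1) \<le> g" using g_m m1 by (simp add: pos_divide_le_eq)
    then have "q / 2 * (2 / (m - 1)) \<le> q / 2 * g" using q2 by (intro mult_left_mono) auto
    then have 1: "q / (m - 1) \<le> q / 2 * g" by simp
    have 2: "g \<le> q / (m - 1)" using q m1 by (simp add: pos_le_divide_eq)
    show ?thesis unfolding eq using 1 2 by (simp add: algebra_simps)
  qed
  then have \<sigma>: "\<sigma> * q \<le> g * (q / 2 - 1)" "0 \<le> \<sigma> * q" by auto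
  show ?thesis
  proof (intro exI[of _ D] conjI D allI impI)
    fix t :: real assume t: "t > 0"
    have "(\<integral>\<^sup>+x. ennreal (\<bar>u (t, x)\<bar> powr q) \<partial>lborel) \<le> (\<integral>\<^sup>+x. ennreal ((heatV u0 (t, x) + W (t, x)) powr q * exp (0 * (heatV u0 (t, x) + W (t, x))\<^sup>2)) \<partial>lborel)"
      using u_le q2 by (intro nn_integral_mono ennreal_leI) (auto intro!: powr_mono2)
    also have "\<dots> \<le> ennreal (C * \<rho> powr q * (1 + t) powr (- (g * (q / 2 - 1))))"
      by (rule H[OF \<rho> _ _ t u0 W]) auto
    also have "\<dots> \<le> ennreal (D powr q * t powr (- (\<sigma> * q)))"
    proof (rule ennreal_leI)
      have "t powr (\<sigma> * q) \<le> (1 + t) powr (\<sigma> * q)" using t \<sigma> by (intro powr_mono2) auto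
      also have "\<dots> \<le> (1 + t) powr (g * (q / 2 - 1))" using t \<sigma> by (intro powr_mono) auto
      finally have "(1 + t) powr (- (g * (q / 2 - 1))) \<le> t powr (- (\<sigma> * q))"
        using t unfolding powr_minus by (intro le_imp_inverse_le) auto
      then show "C * \<rho> powr q * (1 + t) powr (- (g * (q / 2 - 1))) \<le> D powr q * t powr (- (\<sigma> * q))"
        unfolding Dq using C by (intro mult_left_mono) auto
    qed
    also have "D powr q * t powr (- (\<sigma> * q)) = (D * t powr (- \<sigma>)) powr q"
      using D t by (simp add: powr_mult powr_powr)
    finally show "(\<integral>\<^sup>+x. ennreal (\<bar>u (t, x)\<bar> powr q) \<partial>lborel) \<le> ennreal ((D * t powr (- (1 / (m - 1) - g / q))) powr q)"
      unfolding \<sigma>_def .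
  qed
qed

text \<open>The datum is taken in L^q with q = g (m - 1), for which g / q = 1 / (m - 1). For W the
  decay g / 2 suffices, as g / 2 \<ge> 1 / (m - 1).\<close>

lemma solution_Linfty: "\<exists>C>0. \<forall>t>0. \<forall>x. \<bar>u (t, x)\<bar> \<le> C * t powr (- (1 / (m - 1)))"
proof -
  define q where "q = g * (m - 1)"
  have q2: "q \<ge> 2" using g_m by (simp add: q_def)
  have m1: "m - 1 > 0" using m_ge by simp
  have gq: "- g / q = - (1 / (m - 1))" using g_pos m1 by (simp add: q_def)
  obtain B where B: "B \<ge> 0" "(\<integral>\<^sup>+y. ennreal (\<bar>u0 y\<bar> powr q) \<partial>lborel) \<le> ennreal B"
    using small_data_moment[OF q2 \<rho> u0] by blast
  define C where "C = (kap powr (q - 1) * A) powr (1 / q) * B powr (1 / q)"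
  have C: "C \<ge> 0" by (simp add: C_def)
  show ?thesis
  proof (intro exI[of _ "C + \<rho>"] conjI allI impI)
    show "C + \<rho> > 0" using C \<rho> by simp
    fix t :: real and x assume t: "t > 0"
    have V: "heatV u0 (t, x) \<le> C * t powr (- (1 / (m - 1)))"
      using heatV_conv_bound(2)[OF q2 datum_measurable B t, of x] unfolding gq C_def by (simp add: mult_ac)
    have "2 / (m - 1) \<le> g" using g_m m1 by (simp add: pos_divide_le_eq)
    then have "(1 + t) powr (- g / 2) \<le> (1 + t) powr (- (1 / (m - 1)))" using t by (intro powr_mono) auto
    also have "\<dots> \<le> t powr (- (1 / (m - 1)))" using t m1 by (intro powr_mono2') auto
    finally have "\<rho> * (1 + t) powr (- g / 2) \<le> \<rho> * t powr (- (1 / (m - 1)))" using \<rho> by (intro mult_left_mono) auto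
    then have "W (t, x) \<le> \<rho> * t powr (- (1 / (m - 1)))" using admissible_sup[OF _ W t, of x] \<rho> by linarith
    with V show "\<bar>u (t, x)\<bar> \<le> (C + \<rho>) * t powr (- (1 / (m - 1)))"
      using u_le[of "(t, x)"] by (simp add: distrib_right)
  qed
qed

lemma solution_weak_star:
  assumes \<phi>m[measurable]: "\<phi> \<in> borel_measurable borel"
    and \<alpha>: "\<alpha> > 0" "(\<integral>\<^sup>+x. ennreal (young_conj_expsq (\<bar>\<phi> x\<bar> / \<alpha>)) \<partial>lborel) < \<infinity>"
  shows "((\<lambda>t. \<integral>x. u (t, x) * \<phi> x \<partial>lborel) \<longlongrightarrow> (\<integral>x. u0 x * \<phi> x \<partial>lborel)) (at_right 0)"
  unfolding tendsto_at_iff_sequentially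
proof (intro allI impI)
  fix X :: "nat \<Rightarrow> real" assume X: "\<forall>i. X i \<in> {0<..} - {0}" "X \<longlonglongrightarrow> 0"
  then have X0: "X i > 0" for i by auto
  have pair: "integrable lborel (\<lambda>x. v x * \<phi> x)"
    if [measurable]: "v \<in> borel_measurable borel" and r: "r > 0" "(\<integral>\<^sup>+x. ennreal (exp ((v x / r)\<^sup>2) - 1) \<partial>lborel) \<le> 1" for v r
  proof -
    have "(\<integral>\<^sup>+x. ennreal (\<bar>v x\<bar> * \<bar>\<phi> x\<bar>) \<partial>lborel) \<le> ennreal (r * \<alpha>) * (1 + (\<integral>\<^sup>+x. ennreal (young_conj_expsq (\<bar>\<phi> x\<bar> / \<alpha>)) \<partial>lborel))"
      by (rule orlicz_pairing_le[OF _ _ r(1) \<alpha>(1) r(2) order_refl]) measurable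
    also have "\<dots> < \<infinity>" using \<alpha>(2) by (simp add: ennreal_mult_less_top)
    finally show ?thesis by (intro integrableI_bounded) (auto simp: abs_mult)
  qed
  have i1: "integrable lborel (\<lambda>x. u (X i, x) * \<phi> x)" for i
    by (rule pair[OF _ _ solution_exp[OF X0]]) (use \<rho> in simp_all)
  have i2: "integrable lborel (\<lambda>x. u0 x * \<phi> x)"
  proof (rule pair)
    have "u0 x / (\<rho> / kap) = kap * u0 x / \<rho>" for x by simp
    then show "(\<integral>\<^sup>+x. ennreal (exp ((u0 x / (\<rho> / kap))\<^sup>2) - 1) \<partial>lborel) \<le> 1"
      using u0 by (simp only: small_data_def)
  qed (use \<rho> kap_pos in simp_all)
  let ?J = "\<lambda>i. \<integral>\<^sup>+x. ennreal (\<bar>u (X i, x) - u0 x\<bar> * \<bar>\<phi> x\<bar>) \<partial>lborel"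
  have J: "?J \<longlonglongrightarrow> 0" by (rule weak_star_convergence[OF \<rho> u0 W um u_diff \<phi>m \<alpha> X0 X(2)])
  have le: "ennreal \<bar>(\<integral>x. u (X i, x) * \<phi> x \<partial>lborel) - (\<integral>x. u0 x * \<phi> x \<partial>lborel)\<bar> \<le> ?J i" for i
  proof -
    have "(\<integral>x. u (X i, x) * \<phi> x \<partial>lborel) - (\<integral>x. u0 x * \<phi> x \<partial>lborel) = (\<integral>x. (u (X i, x) - u0 x) * \<phi> x \<partial>lborel)"
      unfolding left_diff_distrib by (rule Bochner_Integration.integral_diff[OF i1 i2, symmetric])
    moreover have "integrable lborel (\<lambda>x. (u (X i, x) - u0 x) * \<phi> x)"
      unfolding left_diff_distrib by (rule Bochner_Integration.integrable_diff[OF i1 i2])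
    from integral_norm_bound_ennreal[OF this]
    have "ennreal \<bar>(\<integral>x. (u (X i, x) - u0 x) * \<phi> x \<partial>lborel)\<bar> \<le> ?J i" by (simp add: abs_mult)
    ultimately show ?thesis by simp
  qed
  have "(\<lambda>i. ennreal \<bar>(\<integral>x. u (X i, x) * \<phi> x \<partial>lborel) - (\<integral>x. u0 x * \<phi> x \<partial>lborel)\<bar>) \<longlonglongrightarrow> 0"
    by (rule tendsto_sandwich[OF _ _ tendsto_const J]) (use le in auto)
  then have "(\<lambda>i. ennreal \<bar>(\<integral>x. u (X i, x) * \<phi> x \<partial>lborel) - (\<integral>x. u0 x * \<phi> x \<partial>lborel)\<bar>) \<longlonglongrightarrow> ennreal 0" by simp
  then have "(\<lambda>i. \<bar>(\<integral>x. u (X i, x) * \<phi> x \<partial>lborel) - (\<integral>x. u0 x * \<phi> x \<partial>lborel)\<bar>) \<longlonglongrightarrow> 0"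
    by (rule tendsto_ennrealD) auto
  then have "(\<lambda>i. (\<integral>x. u (X i, x) * \<phi> x \<partial>lborel) - (\<integral>x. u0 x * \<phi> x \<partial>lborel)) \<longlonglongrightarrow> 0"
    by (rule tendsto_rabs_zero_cancel)
  then show "((\<lambda>t. \<integral>x. u (t, x) * \<phi> x \<partial>lborel) \<circ> X) \<longlonglongrightarrow> (\<integral>x. u0 x * \<phi> x \<partial>lborel)"
    unfolding o_def by (rule LIM_zero_cancel)
qed

end

end

section \<open>The polyharmonic problem\<close>

text \<open>K rescales the product majorant as the kernel itself scales, so its mass C * k0 is the
  same at all times; as \<open>cauchy_prod\<close> is at most 1, the constant C also serves as
  A.\<close>

lemma polyharm_semilinear_flow:
  fixes d :: nat and m C0 lam :: real and f :: "real \<Rightarrow> real"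
  assumes d: "d \<ge> 1" and m: "m \<ge> 2" and Nm: "real DIM('a::euclidean_space) * (m - 1) / (2 * real d) \<ge> 2"
    and f0: "f 0 = 0" and C0: "C0 > 0" and lam: "lam > 0"
    and f: "\<And>u v. \<bar>f u - f v\<bar> \<le> C0 * \<bar>u - v\<bar> *
                 (\<bar>u\<bar> powr (m - 1) * exp (lam * u\<^sup>2) + \<bar>v\<bar> powr (m - 1) * exp (lam * v\<^sup>2))"
  obtains K :: "real \<times> 'a::euclidean_space \<Rightarrow> real" and A kap where
    "semilinear_flow K A kap (real DIM('a) / (2 * real d)) m C0 lam
       (\<lambda>z. if fst z > 0 then polyharm_kernel d (fst z) (snd z) else 0) f"
proof -
  let ?g = "real DIM('a) / (2 * real d)"
  let ?l = "\<lambda>t::real. t powr (1 / (2 * real d))"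
  let ?E = "\<lambda>z::real \<times> 'a. if fst z > 0 then polyharm_kernel d (fst z) (snd z) else 0"
  obtain C where C: "C > 0" "\<And>x::'a. \<bar>polyharm_kernel d 1 x\<bar> \<le> C * cauchy_prod x"
    using polyharm_kernel_bound[OF d] by blast
  define K where "K z = (if fst z > 0 then C * fst z powr (- ?g) * cauchy_prod (snd z /\<^sub>R ?l (fst z)) else 0)" for z :: "real \<times> 'a"
  define k0 where "k0 = enn2real (integral\<^sup>N lborel (\<lambda>x::'a. ennreal (cauchy_prod x)))"
  have k0: "integral\<^sup>N lborel (\<lambda>x::'a. ennreal (cauchy_prod x)) = ennreal k0"
    using nn_integral_cauchy_prod[where 'a='a] by (simp add: k0_def cauchy_prod_def[symmetric])
  have k0_pos: "k0 > 0"
  proof (rule ccontr)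
    assume "\<not> k0 > 0"
    then have "integral\<^sup>N lborel (\<lambda>x::'a. ennreal (cauchy_prod x)) = 0" using k0 by (simp add: ennreal_neg)
    then have "AE x::'a in lborel. ennreal (cauchy_prod x) = 0" by (subst (asm) nn_integral_0_iff_AE) auto
    then have "AE x::'a in lborel. False"
    proof eventually_elim
      case (elim x)
      then show ?case using cauchy_prod_pos[of x] by (simp add: ennreal_eq_0_iff)
    qed
    then show False by (simp add: AE_iff_null null_sets_def)
  qed
  have [measurable]: "fst \<in> borel_measurable (borel :: (real \<times> 'a) measure)"
    "snd \<in> borel_measurable (borel :: (real \<times> 'a) measure)"
    by (simp_all add: borel_prod[symmetric])
  have "semilinear_flow K C (C * k0) ?g m C0 lam ?E f"
  proof
    show "K \<in> borel_measurable borel" unfolding K_def by measurable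
    show "0 \<le> K z" for z using C(1) less_imp_le[OF cauchy_prod_pos]
      unfolding K_def by (auto intro!: mult_nonneg_nonneg)
    show "K (t, x) = 0" if "t \<le> 0" for t x using that by (simp add: K_def)
    show "K (t, x) \<le> C * t powr - ?g" if "t > 0" for t x
      using that C cauchy_prod_le_1 by (simp add: K_def mult_left_le)
    show "(\<integral>\<^sup>+x. ennreal (K (t, x)) \<partial>lborel) = ennreal (C * k0)" if t: "t > 0" for t
    proof -
      have lN: "\<bar>?l t\<bar> ^ DIM('a) = t powr ?g" using t by (simp add: powr_power)
      have m1: "(\<lambda>x. ennreal (cauchy_prod (x /\<^sub>R ?l t :: 'a))) \<in> borel_measurable borel" by measurable
      have "(\<integral>\<^sup>+x. ennreal (cauchy_prod (x /\<^sub>R ?l t :: 'a)) \<partial>lborel)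
          = ennreal (\<bar>?l t\<bar> ^ DIM('a)) * (\<integral>\<^sup>+x. ennreal (cauchy_prod ((0 + ?l t *\<^sub>R x) /\<^sub>R ?l t :: 'a)) \<partial>lborel)"
        using t by (intro nn_integral_lborel_affine[OF m1]) simp
      also have "\<dots> = ennreal (t powr ?g) * ennreal k0" unfolding lN using t k0 by simp
      finally have s: "(\<integral>\<^sup>+x. ennreal (cauchy_prod (x /\<^sub>R ?l t :: 'a)) \<partial>lborel) = ennreal (t powr ?g) * ennreal k0" .
      have "(\<integral>\<^sup>+x. ennreal (K (t, x)) \<partial>lborel) = (\<integral>\<^sup>+x. ennreal (C * t powr (- ?g)) * ennreal (cauchy_prod (x /\<^sub>R ?l t :: 'a)) \<partial>lborel)"
        using t C(1) by (intro nn_integral_cong) (simp add: K_def ennreal_mult'[symmetric])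
      also have "\<dots> = ennreal (C * t powr (- ?g)) * (\<integral>\<^sup>+x. ennreal (cauchy_prod (x /\<^sub>R ?l t :: 'a)) \<partial>lborel)"
        by (rule nn_integral_cmult) measurable
      also have "\<dots> = ennreal (C * t powr (- ?g) * (t powr ?g * k0))"
        unfolding s using C k0_pos by (simp add: ennreal_mult)
      also have "C * t powr (- ?g) * (t powr ?g * k0) = C * k0" using t by (simp add: powr_minus)
      finally show ?thesis .
    qed
    show "C > 0" "C * k0 > 0" "?g > 0" using C k0_pos d by simp_all
    show "m \<ge> 2" "C0 > 0" "lam > 0" "f 0 = 0" by (rule m C0 lam f0)+
    show "2 \<le> ?g * (m - 1)" using Nm by simp
    show "?E \<in> borel_measurable borel" by measurable
    show "\<bar>?E z\<bar> \<le> K z" for z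
    proof (cases "fst z > 0")
      case True
      have "\<bar>polyharm_kernel d (fst z) (snd z)\<bar> = fst z powr (- ?g) * \<bar>polyharm_kernel d 1 (snd z /\<^sub>R ?l (fst z))\<bar>"
        unfolding polyharm_kernel_scaling[OF True d] by (simp add: abs_mult)
      also have "\<dots> \<le> fst z powr (- ?g) * (C * cauchy_prod (snd z /\<^sub>R ?l (fst z)))"
        by (intro mult_left_mono C) simp
      finally show ?thesis using True by (simp add: K_def mult_ac)
    qed (simp add: K_def)
    show "\<bar>f u - f v\<bar> \<le> C0 * \<bar>u - v\<bar> * (\<bar>u\<bar> powr (m - 1) * exp (lam * u\<^sup>2) + \<bar>v\<bar> powr (m - 1) * exp (lam * v\<^sup>2))" for u v
      by (rule f)
    show "((\<lambda>t. \<integral>y. ?E (t, x - y) * G y \<partial>lborel) \<longlongrightarrow> G x) (at_right 0)"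
      if G: "continuous_on UNIV G" "\<And>x. \<bar>G x\<bar> \<le> b" for G :: "'a \<Rightarrow> real" and b x
    proof (rule Lim_transform_eventually[OF polyharm_convolution_tendsto[OF d G]])
      have "eventually (\<lambda>t::real. t > 0) (at_right 0)" by (rule eventually_at_right_less)
      then show "\<forall>\<^sub>F t in at_right 0. (\<integral>y. polyharm_kernel d t (x - y) * G y \<partial>lborel) = (\<integral>y. ?E (t, x - y) * G y \<partial>lborel)"
        by eventually_elim simp
    qed
  qed
  then show ?thesis by (rule that)
qed

section \<open>From Borel representatives to the completed measure\<close>

lemma lebesgue_integral_eq_lborel:
  fixes h h' :: "'a::euclidean_space \<Rightarrow> real"
  assumes [measurable]: "h \<in> borel_measurable lebesgue" "h' \<in> borel_measurable borel" and ae: "AE x in lborel. h x = h' x"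
  shows "(\<integral>x. h x \<partial>lebesgue) = (\<integral>x. h' x \<partial>lborel)"
proof -
  have m: "h' \<in> borel_measurable lebesgue" by (intro measurable_completion) simp
  have "AE x in lebesgue. h x = h' x" using ae by (simp only: AE_completion_iff)
  then have "(\<integral>x. h x \<partial>lebesgue) = (\<integral>x. h' x \<partial>lebesgue)"
    using m by (intro integral_cong_AE) auto
  also have "\<dots> = (\<integral>x. h' x \<partial>lborel)" by (rule integral_completion) simp
  finally show ?thesis .
qed

lemma nn_integral_lebesgue_eq_lborel:
  fixes h h' :: "'a::euclidean_space \<Rightarrow> ennreal"
  assumes ae: "AE x in lborel. h x = h' x"
  shows "(\<integral>\<^sup>+x. h x \<partial>lebesgue) = (\<integral>\<^sup>+x. h' x \<partial>lborel)"
  by (simp add: nn_integral_completion nn_integral_cong_AE[OF ae])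

theorem theorem6p2:
  fixes d :: nat and m :: real and f :: "real \<Rightarrow> real"
    and C0 lam :: real
  assumes hd: "d \<ge> 2"
    and hm: "m \<ge> 2"
    and hNm: "real DIM('a::euclidean_space) * (m - 1) / (2 * real d) \<ge> 2"
    and hf0: "f 0 = 0"
    and hC0: "C0 > 0" and hlam: "lam > 0"
    and hf: "\<And>u v. \<bar>f u - f v\<bar> \<le> C0 * \<bar>u - v\<bar> *
                 (\<bar>u\<bar> powr (m - 1) * exp (lam * u\<^sup>2) + \<bar>v\<bar> powr (m - 1) * exp (lam * v\<^sup>2))"
  shows "\<exists>\<epsilon>>0. \<forall>u0::'a \<Rightarrow> real. u0 \<in> expL2 \<and> expL2_norm u0 \<le> \<epsilon> \<longrightarrow>
           (\<exists>u. weak_mild_solution d f u0 u \<and>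
                ((\<lambda>t. expL2_norm (\<lambda>x. u t x - polyharm_heat d t u0 x)) \<longlongrightarrow> 0) (at_right 0) \<and>
                (\<forall>p::ereal.
                   ((real DIM('a) \<ge> 4 * real d \<and>
                       ereal (real DIM('a) * (m - 1) / (2 * real d)) < p \<and> p < \<infinity>) \<or>
                    (real DIM('a) < 4 * real d \<and>
                       ereal (max m (2 * real DIM('a) * (m - 1) / (4 * real d - real DIM('a)))) \<le> p))
                   \<longrightarrow> (\<exists>C>0. Lp_decay u p C
                          (1 / (m - 1) - real DIM('a) / (2 * real d * real_of_ereal p)))))"
proof -
  let ?g = "real DIM('a) / (2 * real d)"
  let ?E = "\<lambda>z::real \<times> 'a. if fst z > 0 then polyharm_kernel d (fst z) (snd z) else 0"
  have d1: "d \<ge> 1" using hd by simp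
  obtain K :: "real \<times> 'a \<Rightarrow> real" and A kap where flow: "semilinear_flow K A kap ?g m C0 lam ?E f"
    using polyharm_semilinear_flow[OF d1 hm hNm hf0 hC0 hlam hf] by blast
  interpret semilinear_flow K A kap ?g m C0 lam ?E f by (rule flow)
  obtain \<rho> where \<rho>: "\<rho> > 0"
    and fin: "\<And>u0 W z. small_data \<rho> u0 \<Longrightarrow> admissible \<rho> W \<Longrightarrow> duh (src u0 W) z < \<infinity>"
    and ex: "\<And>u0. small_data \<rho> u0 \<Longrightarrow> \<exists>u W. admissible \<rho> W \<and> u \<in> borel_measurable borel \<and>
       (\<forall>z. \<bar>u z\<bar> \<le> heatV u0 z + W z) \<and> (\<forall>z. \<bar>u z - heatE u0 z\<bar> \<le> W z) \<and>
       (\<forall>z. u z = heatE u0 z + (\<integral>w. ?E (z - w) * fsrc u w \<partial>lborel))"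
    using mild_solution_exists by blast
  show ?thesis
  \<comment> \<open>Half of the admissible size \<rho> / kap: \<open>expL2_norm_less\<close> needs
    the norm strictly below the scale at which the modular is bounded.\<close>
  proof (intro exI[of _ "\<rho> / (2 * kap)"] conjI allI impI)
    show "0 < \<rho> / (2 * kap)" using \<rho> kap_pos by simp
    fix u0 :: "'a \<Rightarrow> real"
    assume u0: "u0 \<in> expL2 \<and> expL2_norm u0 \<le> \<rho> / (2 * kap)"
    have u0m[measurable]: "u0 \<in> borel_measurable lebesgue" using u0 by (simp add: expL2_def loc_integrable_def)
    \<comment> \<open>The estimates are for Borel functions; passing to a Borel representative
      changes the datum on a null set only, which no integral sees.\<close>
    obtain v0 where v0m[measurable]: "v0 \<in> borel_measurable borel" and v0_ae: "AE x in lborel. u0 x = v0 x"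
      using completion_ex_borel_measurable_real[OF u0m] by auto
    have small: "small_data \<rho> v0"
      unfolding small_data_def
    proof (intro conjI v0m)
      have "\<rho> / (2 * kap) < \<rho> / kap" using \<rho> kap_pos by (simp add: field_simps)
      then have lt: "expL2_norm u0 < \<rho> / kap" using u0 by linarith
      have "(\<integral>\<^sup>+x. ennreal (exp ((kap * v0 x / \<rho>)\<^sup>2) - 1) \<partial>lborel) = (\<integral>\<^sup>+x. ennreal (exp ((u0 x)\<^sup>2 / (\<rho> / kap)\<^sup>2) - 1) \<partial>lebesgue)"
      proof (rule nn_integral_lebesgue_eq_lborel[symmetric])
        show "AE x in lborel. ennreal (exp ((u0 x)\<^sup>2 / (\<rho> / kap)\<^sup>2) - 1) = ennreal (exp ((kap * v0 x / \<rho>)\<^sup>2) - 1)"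
          using v0_ae by eventually_elim (simp add: power_divide power_mult_distrib mult.commute)
      qed
      also have "\<dots> \<le> 1" using u0 by (intro expL2_norm_less lt) simp
      finally show "(\<integral>\<^sup>+x. ennreal (exp ((kap * v0 x / \<rho>)\<^sup>2) - 1) \<partial>lborel) \<le> 1" .
    qed
    obtain u W where W: "admissible \<rho> W" and um[measurable]: "u \<in> borel_measurable borel"
      and u_le: "\<And>z. \<bar>u z\<bar> \<le> heatV v0 z + W z" and u_diff: "\<And>z. \<bar>u z - heatE v0 z\<bar> \<le> W z"
      and mild: "\<And>z. u z = heatE v0 z + (\<integral>w. ?E (z - w) * fsrc u w \<partial>lborel)"
      using ex[OF small] by blast
    note props = \<rho> small W um u_le u_diff
    have kernel_m[measurable]: "(\<lambda>y. polyharm_kernel d t (x - y)) \<in> borel_measurable borel" for t and x :: 'a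
      using measurable_compose[OF _ borel_measurable_polyharm_kernel, of "\<lambda>y::'a. (t, x - y)" borel d] by simp
    have heat: "polyharm_heat d t u0 x = heatE v0 (t, x)" if "t > 0" for t x
    proof -
      have "(\<lambda>y. polyharm_kernel d t (x - y)) \<in> borel_measurable lebesgue"
        by (intro measurable_completion) simp
      then have "polyharm_heat d t u0 x = (\<integral>y. polyharm_kernel d t (x - y) * v0 y \<partial>lborel)"
        unfolding polyharm_heat_def using v0_ae by (intro lebesgue_integral_eq_lborel) auto
      then show ?thesis using that by (simp add: heatE_def)
    qed
    have Wm: "W \<in> borel_measurable borel" using W by (simp add: admissible_def)
    have u_meas: "(\<lambda>x. u (t, x)) \<in> borel_measurable borel" for t by measurable
    have exp_le: "(\<integral>\<^sup>+x. ennreal (exp ((u (t, x))\<^sup>2 / (4 * \<rho>)\<^sup>2) - 1) \<partial>lebesgue) \<le> 1" if "t > 0" for t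
      using solution_exp[OF props that] by (simp add: nn_integral_completion power_divide)
    have Linf: "Linf_expL2 (\<lambda>t x. u (t, x))"
      unfolding Linf_expL2_def
    proof (intro conjI exI[of _ "4 * \<rho>"] AE_I2 impI)
      have "(\<lambda>(t, x). (t, x)) \<in> lborel \<Otimes>\<^sub>M lebesgue \<rightarrow>\<^sub>M (borel :: (real \<times> 'a) measure)"
        unfolding borel_prod[symmetric]
      proof (rule measurable_pair)
        show "fst \<circ> (\<lambda>(t, x). (t, x)) \<in> lborel \<Otimes>\<^sub>M (lebesgue :: 'a measure) \<rightarrow>\<^sub>M (borel :: real measure)"
          using measurable_fst[of "lborel :: real measure" "lebesgue :: 'a measure"] by (simp add: o_def split_beta)
        have "(\<lambda>x. x) \<in> lebesgue \<rightarrow>\<^sub>M (borel :: 'a measure)" by (rule measurable_completion) simp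
        from measurable_compose[OF measurable_snd this]
        show "snd \<circ> (\<lambda>(t, x). (t, x)) \<in> lborel \<Otimes>\<^sub>M (lebesgue :: 'a measure) \<rightarrow>\<^sub>M (borel :: 'a measure)"
          by (simp add: o_def split_beta)
      qed
      from measurable_compose[OF this um] show "(\<lambda>(t, x). u (t, x)) \<in> borel_measurable (lborel \<Otimes>\<^sub>M lebesgue)"
        by (simp add: split_beta)
      fix t :: real assume t: "t > 0"
      show "expL2_norm (\<lambda>x. u (t, x)) \<le> 4 * \<rho>"
        by (rule expL2_norm_le(1)[OF _ exp_le[OF t]]) (use \<rho> in simp)
      have "(\<integral>\<^sup>+x. ennreal (exp ((u (t, x) / (4 * \<rho>))\<^sup>2) - 1) \<partial>lborel) < \<infinity>"
        using le_less_trans[OF solution_exp[OF props t]] by simp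
      then have "loc_integrable (\<lambda>x. u (t, x))"
        using \<rho> by (intro exp_moment_loc_integrable[OF u_meas, of "4 * \<rho>"]) auto
      moreover have "(\<integral>\<^sup>+x. ennreal (exp ((u (t, x))\<^sup>2 / (4 * \<rho>)\<^sup>2) - 1) \<partial>lebesgue) < \<infinity>"
        using le_less_trans[OF exp_le[OF t]] by simp
      ultimately show "(\<lambda>x. u (t, x)) \<in> expL2"
        unfolding expL2_def using \<rho> by (intro CollectI conjI exI[of _ "4 * \<rho>"]) auto
    qed
    have duhamel: "set_integrable lborel {0..t} (\<lambda>s. polyharm_heat d (t - s) (\<lambda>y. f (u (s, y))) x)
        \<and> u (t, x) = polyharm_heat d t u0 x + (\<integral>s\<in>{0..t}. polyharm_heat d (t - s) (\<lambda>y. f (u (s, y))) x \<partial>lborel)"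
      if t: "t > 0" for t x
    proof -
      let ?H = "\<lambda>w. ?E ((t, x) - w) * fsrc u w"
      have i: "integrable (lborel \<Otimes>\<^sub>M lborel) ?H"
        unfolding lborel_prod by (rule integrable_E_fsrc[OF v0m Wm um fin[OF small W] u_le])
      define p where "p s = polyharm_heat d (t - s) (\<lambda>y. f (u (s, y))) x" for s
      define q where "q s = (\<integral>y. ?H (s, y) \<partial>lborel)" for s
      have qi: "integrable lborel q" unfolding q_def by (rule lborel_pair.integrable_fst'[OF i])
      have [measurable]: "q \<in> borel_measurable borel" using borel_measurable_integrable[OF qi] by simp
      have qI: "integral\<^sup>L lborel q = (\<integral>w. ?H w \<partial>lborel)"
        unfolding q_def lborel_prod[symmetric] by (rule lborel_pair.integral_fst'[OF i])
      \<comment> \<open>The interval {0..t} contains s = t, where \<open>polyharm_heat\<close> is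
        taken at time 0 and need not vanish, and s = 0, where \<open>fsrc\<close> is cut off; these
        two points are null.\<close>
      have pq: "q s = indicator {0..t} s *\<^sub>R p s" if "s \<noteq> 0" "s \<noteq> t" for s
      proof (cases "0 < s \<and> s < t")
        case True
        have "p s = (\<integral>y. polyharm_kernel d (t - s) (x - y) * f (u (s, y)) \<partial>lborel)"
          unfolding p_def polyharm_heat_def by (rule integral_completion) measurable
        with True show ?thesis by (simp add: q_def fsrc_def)
      next
        case False
        then have "?H (s, y) = 0" for y using that by (auto simp: fsrc_def)
        then have "q s = (\<integral>(y::'a). 0 \<partial>lborel)"
          unfolding q_def by (intro Bochner_Integration.integral_cong refl)
        then have "q s = 0" by simp
        with False that show ?thesis by (auto split: split_indicator)
      qed
      \<comment> \<open>\<open>lborel\<close> is not complete, so measurability does not follow from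
        a.e. equality with q; it is read off an exact formula that alters q at two points.\<close>
      have eq: "(\<lambda>s. indicator {0..t} s *\<^sub>R p s) = (\<lambda>s. if s = 0 then p 0 else if s = t then p t else q s)"
        using pq t by auto
      have pm: "(\<lambda>s. indicator {0..t} s *\<^sub>R p s) \<in> borel_measurable lborel" unfolding eq by measurable
      have ae: "AE s in lborel. q s = indicator {0..t} s *\<^sub>R p s"
      proof -
        have "AE s in lborel. s \<noteq> (0::real)" "AE s in lborel. s \<noteq> t" by (rule AE_lborel_singleton)+
        then show ?thesis by eventually_elim (rule pq)
      qed
      have "integrable lborel (\<lambda>s. indicator {0..t} s *\<^sub>R p s)"
        using qi ae pm by (subst integrable_cong_AE[symmetric, of q]) auto
      moreover have "(\<integral>s. indicator {0..t} s *\<^sub>R p s \<partial>lborel) = integral\<^sup>L lborel q"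
        using ae pm by (intro integral_cong_AE[symmetric]) auto
      ultimately show ?thesis
        using mild[of "(t, x)"] heat[OF t, of x] qI
        unfolding set_integrable_def set_lebesgue_integral_def p_def[symmetric] by simp
    qed
    have weak: "((\<lambda>t. \<integral>x. u (t, x) * \<phi> x \<partial>lebesgue) \<longlongrightarrow> (\<integral>x. u0 x * \<phi> x \<partial>lebesgue)) (at_right 0)"
      if \<phi>: "\<phi> \<in> expL2_predual" for \<phi>
    proof -
      have \<phi>m[measurable]: "\<phi> \<in> borel_measurable lebesgue" using \<phi> by (simp add: expL2_predual_def)
      obtain \<alpha> where \<alpha>: "\<alpha> > 0" "(\<integral>\<^sup>+x. ennreal (young_conj_expsq (\<bar>\<phi> x\<bar> / \<alpha>)) \<partial>lebesgue) < \<infinity>"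
        using \<phi> by (auto simp: expL2_predual_def)
      obtain \<psi> where \<psi>m[measurable]: "\<psi> \<in> borel_measurable borel" and \<psi>_ae: "AE x in lborel. \<phi> x = \<psi> x"
        using completion_ex_borel_measurable_real[OF \<phi>m] by auto
      have "(\<integral>\<^sup>+x. ennreal (young_conj_expsq (\<bar>\<phi> x\<bar> / \<alpha>)) \<partial>lebesgue) = (\<integral>\<^sup>+x. ennreal (young_conj_expsq (\<bar>\<psi> x\<bar> / \<alpha>)) \<partial>lborel)"
        by (rule nn_integral_lebesgue_eq_lborel) (use \<psi>_ae in \<open>eventually_elim, simp\<close>)
      with \<alpha> have fin\<psi>: "(\<integral>\<^sup>+x. ennreal (young_conj_expsq (\<bar>\<psi> x\<bar> / \<alpha>)) \<partial>lborel) < \<infinity>" by simp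
      have u_leb: "(\<lambda>x. u (t, x)) \<in> borel_measurable lebesgue" for t
        by (intro measurable_completion) simp
      have 1: "(\<integral>x. u (t, x) * \<phi> x \<partial>lebesgue) = (\<integral>x. u (t, x) * \<psi> x \<partial>lborel)" for t
        using u_leb \<psi>_ae by (intro lebesgue_integral_eq_lborel) auto
      have 2: "(\<integral>x. u0 x * \<phi> x \<partial>lebesgue) = (\<integral>x. v0 x * \<psi> x \<partial>lborel)"
        using v0_ae \<psi>_ae by (intro lebesgue_integral_eq_lborel) auto
      show ?thesis unfolding 1 2 by (rule solution_weak_star[OF props \<psi>m \<alpha>(1) fin\<psi>])
    qed
    have sol: "weak_mild_solution d f u0 (\<lambda>t x. u (t, x))"
      unfolding weak_mild_solution_def using Linf duhamel weak by auto
    have diff: "((\<lambda>t. expL2_norm (\<lambda>x. u (t, x) - polyharm_heat d t u0 x)) \<longlongrightarrow> 0) (at_right 0)"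
    proof (rule Lim_transform_eventually[OF solution_norm_diff[OF props]])
      have "eventually (\<lambda>t::real. t > 0) (at_right 0)" by (rule eventually_at_right_less)
      then show "\<forall>\<^sub>F t in at_right 0. expL2_norm (\<lambda>x. u (t, x) - heatE v0 (t, x)) = expL2_norm (\<lambda>x. u (t, x) - polyharm_heat d t u0 x)"
        by eventually_elim (simp add: heat)
    qed
    have decay: "\<exists>C>0. Lp_decay (\<lambda>t x. u (t, x)) p C (1 / (m - 1) - real DIM('a) / (2 * real d * real_of_ereal p))"
      if p: "(real DIM('a) \<ge> 4 * real d \<and>
                       ereal (real DIM('a) * (m - 1) / (2 * real d)) < p \<and> p < \<infinity>) \<or>
                    (real DIM('a) < 4 * real d \<and>
                       ereal (max m (2 * real DIM('a) * (m - 1) / (4 * real d - real DIM('a)))) \<le> p)" for p :: ereal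
    proof (cases p)
      case (real q)
      have "q > ?g * (m - 1)"
      proof (cases "real DIM('a) \<ge> 4 * real d")
        case True
        with p real show ?thesis by simp
      next
        case False
        then have Nd: "0 < 4 * real d - real DIM('a)" by simp
        \<comment> \<open>The lower bound on p has denominator 4d - N instead of 4d and therefore
          strictly exceeds g (m - 1), as \<open>solution_Lp\<close> requires.\<close>
        have "?g * (m - 1) = 2 * real DIM('a) * (m - 1) / (4 * real d)" using d1 by simp
        also have "\<dots> < 2 * real DIM('a) * (m - 1) / (4 * real d - real DIM('a))"
          using Nd d1 hm by (intro divide_strict_left_mono mult_pos_pos) auto
        also have "\<dots> \<le> q" using False p real by simp
        finally show ?thesis .
      qed
      from solution_Lp[OF props this] obtain C where C: "C > 0"
        "\<And>t. t > 0 \<Longrightarrow> (\<integral>\<^sup>+x. ennreal (\<bar>u (t, x)\<bar> powr q) \<partial>lborel) \<le> ennreal ((C * t powr (- (1 / (m - 1) - ?g / q))) powr q)"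
        by blast
      have "?g / q = real DIM('a) / (2 * real d * q)" by simp
      then show ?thesis
        unfolding Lp_decay_def real using C by (intro exI[of _ C]) (simp add: nn_integral_completion)
    next
      case PInf
      obtain C where C: "C > 0" "\<And>t x. t > 0 \<Longrightarrow> \<bar>u (t, x)\<bar> \<le> C * t powr (- (1 / (m - 1)))"
        using solution_Linfty[OF props] by blast
      \<comment> \<open>\<open>real_of_ereal\<close> sends infinity to 0 and division by 0 gives 0,
        so the exponent in the claim is 1 / (m - 1).\<close>
      then show ?thesis
        unfolding Lp_decay_def PInf by (intro exI[of _ C]) simp
    next
      case MInf
      with p show ?thesis by (auto simp: max_def split: if_splits)
    qed
    show "\<exists>u. weak_mild_solution d f u0 u \<and>
                ((\<lambda>t. expL2_norm (\<lambda>x. u t x - polyharm_heat d t u0 x)) \<longlongrightarrow> 0) (at_right 0) \<and>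
                (\<forall>p::ereal.
                   ((real DIM('a) \<ge> 4 * real d \<and>
                       ereal (real DIM('a) * (m - 1) / (2 * real d)) < p \<and> p < \<infinity>) \<or>
                    (real DIM('a) < 4 * real d \<and>
                       ereal (max m (2 * real DIM('a) * (m - 1) / (4 * real d - real DIM('a)))) \<le> p))
                   \<longrightarrow> (\<exists>C>0. Lp_decay u p C
                          (1 / (m - 1) - real DIM('a) / (2 * real d * real_of_ereal p))))"
      using sol diff decay by (intro exI[of _ "\<lambda>t x. u (t, x)"]) blast
  qed
qed

end
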